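(* The map $\mathbf{W}:\Delta(K\times L)\to\mathbb{R}$ (the value of the continuous-time game with incomplete information with matrices $(G^{k\ell})_{(k,\ell)\in K\times L}$) is the unique $K$-concave and $L$-convex Lipschitz continuous function satisfying: (1) for all $Q\in\Delta(L)^K$, $\zeta\mapsto\mathbf{W}_K^\sharp(\zeta,Q)$ is a viscosity sub-solution of $$-w(\zeta)+\langle Dw(\zeta),\zeta\rangle+u_K(-Dw(\zeta),Q)\ge0\quad\text{on }\mathbb{R}^K;$$ (2) for all $P\in\Delta(K)^L$, $\eta\mapsto\mathbf{W}_L^\flat(P,\eta)$ is a viscosity super-solution of $$-w(\eta)+\langle Dw(\eta),\eta\rangle+u_L(P,Dw(\eta))\le0\quad\text{on }\mathbb{R}^L.$$
   Context: Data. $K,L,I,J$ are finite sets; $\Delta(X)$ is the set of probability distributions on a finite set $X$. $U=\Delta(I)$, $V=\Delta(J)$. For each $(k,\ell)\in K\times L$, $G^{k\ell}:I\times J\to\mathbb{R}$ is a matrix game, extended bilinearly to $U\times V$. Average game. $u(\pi)=\max_{a\in U}\min_{b\in V}\sum_{(k,\ell)}\pi^{k\ell}G^{k\ell}(a,b)=\min_{b\in V}\max_{a\in U}\sum_{(k,\ell)}\pi^{k\ell}G^{k\ell}(a,b)$ for $\pi\in\Delta(K\times L)$. Continuous-time game. A pair $(k,\ell)$ is drawn according to $\pi\in\Delta(K\times L)$; player 1 (maximizer) is informed of $k$, player 2 (minimizer) of $\ell$; they then play on $[0,1]$ with running payoff $G^{k\ell}$ and no state variable. Let $\mathcal{U}$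 (resp. $\mathcal{V}$) be the set of Lebesgue-measurable maps $[0,1]\to U$ (resp. $V$), with the $L^1$ topology. Let $\mathcal{S}=\{([0,1]^m,\mathcal{B}([0,1]^m),\mathcal{L}_m): m\ge1\}$ (Borel sets and Lebesgue measure). A random strategy $\alpha\in\mathcal{A}_r$ of player 1 is a pair consisting of a probability space $(\Omega_\alpha,\mathcal{F}_\alpha,\mathbb{P}_\alpha)\in\mathcal{S}$ and a measurable map $\alpha:\Omega_\alpha\times\mathcal{V}\to\mathcal{U}$ (Borel $\sigma$-fields on $\mathcal{U},\mathcal{V}$) for which there is a finite partition $0=s_0<\dots<s_N=1$ such that for all $0\le m<N$, $\omega\in\Omega_\alpha$, $\mathbf{v}_1,\mathbf{v}_2\in\mathcal{V}$: $\mathbf{v}_1=\mathbf{v}_2$ a.e. on $[s_0,s_m]$ implies $\alpha(\omega,\mathbf{v}_1)=\alpha(\omega,\mathbf{v}_2)$ a.e. on $[s_0,s_{m+1}]$. $\mathcal{B}_r$ is defined symmetrically for player 2. For $(\alpha,\beta)\in\mathcal{A}_r\times\mathcal{B}_r$ and $\omega=(\omega_1,\omega_2)\in\Omega_\alpha\times\Omega_\beta$ there is a unique pair $(\mathbf{u}_\omega,\mathbf{v}_\omega)\in\mathcal{U}\times\mathcal{V}$ (up to a.e. equality) with $\alpha(\omega_1,\mathbf{v}_\omega)=\mathbf{u}_\omega$, $\beta(\omega_2,\mathbf{u}_\omega)=\mathbf{v}_\omega$. For $\hat\alpha=(\hat\alpha^k)_k\in\mathcal{A}_r^K$ and $\hat\beta=(\hat\beta^\ell)_\ell\in\mathcal{B}_r^L$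 the payoff is $$\sum_{(k,\ell)}\pi^{k\ell}\int_{\Omega_{\hat\alpha^k}\times\Omega_{\hat\beta^\ell}}\int_0^1G^{k\ell}(\mathbf{u}_\omega(s),\mathbf{v}_\omega(s))\,ds\;d\,\mathbb{P}_{\hat\alpha^k}\otimes\mathbb{P}_{\hat\beta^\ell}(\omega),$$ where $(\mathbf{u}_\omega,\mathbf{v}_\omega)$ is the pair induced by $(\hat\alpha^k,\hat\beta^\ell)$ at $\omega$. $\mathbf{W}(\pi)$ is the value of this game, i.e. the common value of $\sup_{\hat\alpha}\inf_{\hat\beta}$ and $\inf_{\hat\beta}\sup_{\hat\alpha}$ of this payoff (it exists). Notation. For $p\in\Delta(K)$, $Q\in\Delta(L)^K$: $(p\otimes Q)(k,\ell)=p(k)Q(\ell|k)$. For $q\in\Delta(L)$, $P\in\Delta(K)^L$: $(q\otimes P)(k,\ell)=q(\ell)P(k|\ell)$. For $\varphi:\Delta(K\times L)\to\mathbb{R}$: $\varphi_K(p,Q)=\varphi(p\otimes Q)$, $\varphi_L(P,q)=\varphi(q\otimes P)$; $\varphi$ is $K$-concave if $\varphi_K(\cdot,Q)$ is concave on $\Delta(K)$ for all $Q\in\Delta(L)^K$, and $L$-convex if $\varphi_L(P,\cdot)$ is convex on $\Delta(L)$ for all $P\in\Delta(K)^L$. Conjugates: $\varphi_K^\sharp(\zeta,Q)=\sup_{p\in\Delta(K)}\{\varphi_K(p,Q)-\langle p,\zeta\rangle\}$ for $\zeta\in\mathbb{R}^K$; $\varphi_L^\flat(P,\eta)=\inf_{q\in\Delta(L)}\{\varphi_L(P,q)+\langle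 q,\eta\rangle\}$ for $\eta\in\mathbb{R}^L$. Viscosity meaning. In (1): the function $w=\mathbf{W}_K^\sharp(\cdot,Q)$ is upper semicontinuous and, whenever $\phi\in\mathcal{C}^1(\mathbb{R}^K;\mathbb{R})$ is such that $w-\phi$ has a local maximum at $\zeta$, $-w(\zeta)+\langle D\phi(\zeta),\zeta\rangle+u_K(-D\phi(\zeta),Q)\ge0$. In (2): $w=\mathbf{W}_L^\flat(P,\cdot)$ is lower semicontinuous and, whenever $w-\phi$ has a local minimum at $\eta$ with $\phi\in\mathcal{C}^1(\mathbb{R}^L;\mathbb{R})$, $-w(\eta)+\langle D\phi(\eta),\eta\rangle+u_L(P,D\phi(\eta))\le0$. (At such points $-D\phi(\zeta)\in\Delta(K)$, resp. $D\phi(\eta)\in\Delta(L)$, so the expressions make sense.) *)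

theory Defs
  imports "HOL-Analysis.Analysis"
begin

section \<open>Probability vectors, products and the average game\<close>

definition prob_simplex :: "(real ^ 'x::finite) set" where
  "prob_simplex = {p. (\<forall>x. 0 \<le> p $ x) \<and> (\<Sum>x\<in>UNIV. p $ x) = 1}"

definition disintK :: "real ^ 'k \<Rightarrow> real ^ 'l ^ 'k \<Rightarrow> real ^ ('k::finite \<times> 'l::finite)" where
  "disintK p Q = (\<chi> kl. p $ fst kl * Q $ fst kl $ snd kl)"

definition disintL :: "real ^ 'l \<Rightarrow> real ^ 'k ^ 'l \<Rightarrow> real ^ ('k::finite \<times> 'l::finite)" where
  "disintL q P = (\<chi> kl. q $ snd kl * P $ snd kl $ fst kl)"

text \<open>A family of matrix games is \<open>G k l :: real ^ 'j ^ 'i\<close>; its bilinear extension to mixed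
  actions is \<open>a \<bullet> (G k l *v b)\<close>. The supremum and infimum below are attained by compactness;
  by the minimax theorem they may be exchanged.\<close>

definition avg_value ::
  "('k::finite \<Rightarrow> 'l::finite \<Rightarrow> real ^ 'j::finite ^ 'i::finite) \<Rightarrow> real ^ ('k \<times> 'l) \<Rightarrow> real" where
  "avg_value G \<pi> =
     (SUP a\<in>prob_simplex. INF b\<in>prob_simplex.
        \<Sum>(k, l)\<in>UNIV. \<pi> $ (k, l) * (a \<bullet> (G k l *v b)))"

section \<open>The continuous-time game\<close>

definition controls :: "(real \<Rightarrow> real ^ 'a::finite) set" where
  "controls = {u \<in> {0..1} \<rightarrow>\<^sub>E prob_simplex. u \<in> borel_measurable (lebesgue_on {0..1})}"

definition L1_dist :: "(real \<Rightarrow> real ^ 'a::finite) \<Rightarrow> (real \<Rightarrow> real ^ 'a) \<Rightarrow> real" where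
  "L1_dist u u' = (\<integral>s. norm (u s - u' s) \<partial>lebesgue_on {0..1})"

text \<open>Controls are kept as functions rather than as classes modulo a.e. equality, so
  \<^const>\<open>L1_dist\<close> is only a pseudometric. Its open sets are saturated for a.e. equality, so the
  sigma-algebra below is the preimage of the Borel sigma-algebra of the \<open>L1\<close> quotient.\<close>

definition control_space :: "(real \<Rightarrow> real ^ 'a::finite) measure" where
  "control_space =
     sigma controls
       {S. S \<subseteq> controls \<and> (\<forall>u\<in>S. \<exists>e>0. \<forall>u'\<in>controls. L1_dist u u' < e \<longrightarrow> u' \<in> S)}"

text \<open>The cube \<open>[0,1]^m\<close> with its Borel sets and Lebesgue measure; points are functions on
  \<open>{..<m}\<close>.\<close>

definition cube :: "nat \<Rightarrow> (nat \<Rightarrow> real) measure" where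
  "cube m = (\<Pi>\<^sub>M i\<in>{..<m}. restrict_space lborel {0..1})"

text \<open>A random strategy is a pair \<open>(m, \<alpha>)\<close> whose first component selects the probability space
  \<open>cube m\<close>. The opponent's controls take values in \<open>real ^ 'b\<close>, the player's own in
  \<open>real ^ 'a\<close>. Taking the last grid index in the delay condition shows that \<open>\<alpha> \<omega>\<close> respects a.e.
  equality, hence is well defined on classes of controls.\<close>

type_synonym ('b, 'a) strategy =
  "nat \<times> ((nat \<Rightarrow> real) \<Rightarrow> (real \<Rightarrow> real ^ 'b) \<Rightarrow> real \<Rightarrow> real ^ 'a)"

definition random_strategies :: "('b::finite, 'a::finite) strategy set" where
  "random_strategies =
     {(m, \<alpha>). 1 \<le> m \<and>
        (\<lambda>(\<omega>, v). \<alpha> \<omega> v) \<in> cube m \<Otimes>\<^sub>M control_space \<rightarrow>\<^sub>M control_space \<and>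
        (\<exists>(N::nat) s :: nat \<Rightarrow> real.
           s 0 = 0 \<and> s N = 1 \<and> (\<forall>n<N. s n < s (Suc n)) \<and>
           (\<forall>n<N. \<forall>\<omega>\<in>space (cube m). \<forall>v1\<in>controls. \<forall>v2\<in>controls.
              (AE t in lebesgue_on {s 0..s n}. v1 t = v2 t) \<longrightarrow>
              (AE t in lebesgue_on {s 0..s (Suc n)}. \<alpha> \<omega> v1 t = \<alpha> \<omega> v2 t)))}"

text \<open>The pair of controls induced by two strategies at fixed random events is determined up to
  a.e. equality; any representative will do, since it is only used under an integral.\<close>

definition induced_controls ::
  "((real \<Rightarrow> real ^ 'j) \<Rightarrow> real \<Rightarrow> real ^ 'i) \<Rightarrow>
   ((real \<Rightarrow> real ^ 'i) \<Rightarrow> real \<Rightarrow> real ^ 'j) \<Rightarrow>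
   (real \<Rightarrow> real ^ 'i::finite) \<times> (real \<Rightarrow> real ^ 'j::finite)" where
  "induced_controls a b =
     (SOME (u, v). u \<in> controls \<and> v \<in> controls \<and>
        (AE t in lebesgue_on {0..1}. a v t = u t) \<and>
        (AE t in lebesgue_on {0..1}. b u t = v t))"

definition running_payoff ::
  "real ^ 'j::finite ^ 'i::finite \<Rightarrow> (real \<Rightarrow> real ^ 'i) \<times> (real \<Rightarrow> real ^ 'j) \<Rightarrow> real" where
  "running_payoff A = (\<lambda>(u, v). \<integral>s. u s \<bullet> (A *v v s) \<partial>lebesgue_on {0..1})"

definition payoff ::
  "('k::finite \<Rightarrow> 'l::finite \<Rightarrow> real ^ 'j::finite ^ 'i::finite) \<Rightarrow> real ^ ('k \<times> 'l) \<Rightarrow>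
   ('k \<Rightarrow> ('j, 'i) strategy) \<Rightarrow> ('l \<Rightarrow> ('i, 'j) strategy) \<Rightarrow> real" where
  "payoff G \<pi> \<alpha> \<beta> =
     (\<Sum>(k, l)\<in>UNIV. \<pi> $ (k, l) *
        (\<integral>(\<omega>1, \<omega>2). running_payoff (G k l) (induced_controls (snd (\<alpha> k) \<omega>1) (snd (\<beta> l) \<omega>2))
           \<partial>(cube (fst (\<alpha> k)) \<Otimes>\<^sub>M cube (fst (\<beta> l)))))"

definition lower_value ::
  "('k::finite \<Rightarrow> 'l::finite \<Rightarrow> real ^ 'j::finite ^ 'i::finite) \<Rightarrow> real ^ ('k \<times> 'l) \<Rightarrow> real" where
  "lower_value G \<pi> =
     (SUP \<alpha>\<in>{\<alpha>. \<forall>k. \<alpha> k \<in> random_strategies}. INF \<beta>\<in>{\<beta>. \<forall>l. \<beta> l \<in> random_strategies}.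
        payoff G \<pi> \<alpha> \<beta>)"

definition upper_value ::
  "('k::finite \<Rightarrow> 'l::finite \<Rightarrow> real ^ 'j::finite ^ 'i::finite) \<Rightarrow> real ^ ('k \<times> 'l) \<Rightarrow> real" where
  "upper_value G \<pi> =
     (INF \<beta>\<in>{\<beta>. \<forall>l. \<beta> l \<in> random_strategies}. SUP \<alpha>\<in>{\<alpha>. \<forall>k. \<alpha> k \<in> random_strategies}.
        payoff G \<pi> \<alpha> \<beta>)"

definition game_value ::
  "('k::finite \<Rightarrow> 'l::finite \<Rightarrow> real ^ 'j::finite ^ 'i::finite) \<Rightarrow> real ^ ('k \<times> 'l) \<Rightarrow> real" where
  "game_value G \<pi> = (THE w. lower_value G \<pi> = w \<and> upper_value G \<pi> = w)"

section \<open>Concavity, convexity and conjugates\<close>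

definition K_concave :: "(real ^ ('k::finite \<times> 'l::finite) \<Rightarrow> real) \<Rightarrow> bool" where
  "K_concave \<phi> \<longleftrightarrow>
     (\<forall>Q. (\<forall>k. Q $ k \<in> prob_simplex) \<longrightarrow> concave_on prob_simplex (\<lambda>p. \<phi> (disintK p Q)))"

definition L_convex :: "(real ^ ('k::finite \<times> 'l::finite) \<Rightarrow> real) \<Rightarrow> bool" where
  "L_convex \<phi> \<longleftrightarrow>
     (\<forall>P. (\<forall>l. P $ l \<in> prob_simplex) \<longrightarrow> convex_on prob_simplex (\<lambda>q. \<phi> (disintL q P)))"

definition conjK ::
  "(real ^ ('k::finite \<times> 'l::finite) \<Rightarrow> real) \<Rightarrow> real ^ 'k \<Rightarrow> real ^ 'l ^ 'k \<Rightarrow> real" where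
  "conjK \<phi> \<zeta> Q = (SUP p\<in>prob_simplex. \<phi> (disintK p Q) - p \<bullet> \<zeta>)"

definition conjL ::
  "(real ^ ('k::finite \<times> 'l::finite) \<Rightarrow> real) \<Rightarrow> real ^ 'k ^ 'l \<Rightarrow> real ^ 'l \<Rightarrow> real" where
  "conjL \<phi> P \<eta> = (INF q\<in>prob_simplex. \<phi> (disintL q P) + q \<bullet> \<eta>)"

section \<open>Viscosity solutions on the whole space\<close>

definition usc :: "('a::topological_space \<Rightarrow> real) \<Rightarrow> bool" where
  "usc w \<longleftrightarrow> (\<forall>x c. w x < c \<longrightarrow> (\<forall>\<^sub>F y in nhds x. w y < c))"

definition lsc :: "('a::topological_space \<Rightarrow> real) \<Rightarrow> bool" where
  "lsc w \<longleftrightarrow> (\<forall>x c. c < w x \<longrightarrow> (\<forall>\<^sub>F y in nhds x. c < w y))"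

definition C1_gradient :: "('a::euclidean_space \<Rightarrow> real) \<Rightarrow> ('a \<Rightarrow> 'a) \<Rightarrow> bool" where
  "C1_gradient \<phi> D \<longleftrightarrow> (\<forall>x. GDERIV \<phi> x :> D x) \<and> continuous_on UNIV D"

definition local_max_at :: "('a::topological_space \<Rightarrow> real) \<Rightarrow> 'a \<Rightarrow> bool" where
  "local_max_at f x \<longleftrightarrow> (\<forall>\<^sub>F y in nhds x. f y \<le> f x)"

definition local_min_at :: "('a::topological_space \<Rightarrow> real) \<Rightarrow> 'a \<Rightarrow> bool" where
  "local_min_at f x \<longleftrightarrow> (\<forall>\<^sub>F y in nhds x. f x \<le> f y)"

text \<open>Sign convention: sub-solutions of \<open>F(x, w(x), Dw(x)) \<ge> 0\<close> and super-solutions of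
  \<open>F(x, w(x), Dw(x)) \<le> 0\<close>.\<close>

definition viscosity_subsolution ::
  "('a::euclidean_space \<Rightarrow> real \<Rightarrow> 'a \<Rightarrow> real) \<Rightarrow> ('a \<Rightarrow> real) \<Rightarrow> bool" where
  "viscosity_subsolution F w \<longleftrightarrow> usc w \<and>
     (\<forall>\<phi> D x. C1_gradient \<phi> D \<and> local_max_at (\<lambda>y. w y - \<phi> y) x \<longrightarrow> 0 \<le> F x (w x) (D x))"

definition viscosity_supersolution ::
  "('a::euclidean_space \<Rightarrow> real \<Rightarrow> 'a \<Rightarrow> real) \<Rightarrow> ('a \<Rightarrow> real) \<Rightarrow> bool" where
  "viscosity_supersolution F w \<longleftrightarrow> lsc w \<and>
     (\<forall>\<phi> D x. C1_gradient \<phi> D \<and> local_min_at (\<lambda>y. w y - \<phi> y) x \<longrightarrow> F x (w x) (D x) \<le> 0)"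

definition dual_solution ::
  "('k::finite \<Rightarrow> 'l::finite \<Rightarrow> real ^ 'j::finite ^ 'i::finite) \<Rightarrow>
   (real ^ ('k \<times> 'l) \<Rightarrow> real) \<Rightarrow> bool" where
  "dual_solution G \<phi> \<longleftrightarrow>
     K_concave \<phi> \<and> L_convex \<phi> \<and> (\<exists>C. C-lipschitz_on prob_simplex \<phi>) \<and>
     (\<forall>Q. (\<forall>k. Q $ k \<in> prob_simplex) \<longrightarrow>
        viscosity_subsolution (\<lambda>\<zeta> r d. - r + d \<bullet> \<zeta> + avg_value G (disintK (- d) Q))
          (\<lambda>\<zeta>. conjK \<phi> \<zeta> Q)) \<and>
     (\<forall>P. (\<forall>l. P $ l \<in> prob_simplex) \<longrightarrow>
        viscosity_supersolution (\<lambda>\<eta> r d. - r + d \<bullet> \<eta> + avg_value G (disintL d P))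
          (\<lambda>\<eta>. conjL \<phi> P \<eta>))"

end

theory Submission
  imports Defs "HOL-Probability.Probability"
begin

text \<open>Uniqueness is a comparison principle: at a maximum point \<open>\<pi> = p \<otimes> Q\<close> of
  \<open>\<phi> - \<psi> + \<epsilon> |\<pi>|\<^sup>2\<close>, concavity of \<open>\<psi>\<close> makes \<open>p\<close> a strongly exposed point of \<open>\<phi>\<^sub>K(\<cdot>, Q)\<close>, so the
  conjugate admits a quadratic test function with gradient \<open>- p\<close> and (1) reads \<open>\<phi>(\<pi>) \<le> u(\<pi>)\<close>;
  symmetrically (2) gives \<open>u(\<pi>) \<le> \<psi>(\<pi>)\<close>. The upper value satisfies (1): if player 2 plays a fixed
  mixed action on \<open>[0, h]\<close> irrespective of \<open>l\<close> and then continues optimally in the rescaled dual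
  game, the conjugate satisfies a dynamic programming inequality, whose limit \<open>h \<rightarrow> 0\<close> is the
  viscosity inequality. Exchanging the players, the lower value satisfies (2), and the comparison
  principle yields that the upper value is at most the lower value.\<close>

section \<open>Minimax by separation\<close>

text \<open>One penalty, the squared norm of \<open>\<pi>\<close>, has to serve both players
  although they factor \<open>\<pi>\<close> differently. It can: in the coordinates
  \<open>p\<close>, \<open>Q\<close> it is a quadratic form in \<open>p\<close> whose weights, the
  squared norms of the laws \<open>Q $ k\<close>, are bounded below independently of
  \<open>Q\<close>, and it is invariant under the exchange of the players. A single maximum point
  thus yields both inequalities.

  In the game, player 2 must react through strategies that are measurable, delayed on a finite grid
  and realized on a cube. Hence the behaviour of player 1 on \<open>[0, h]\<close> is summarized by
  its mean action, which is all that matters against a constant action, and the mean is observed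
  only up to a finite covering: finitely many continuations keep the delay set finite and the
  dimension of the cube bounded. The conjugate is identified with the value of the dual game by
  separation in the space of payoff vectors; for this the random strategies of player 2 must be
  closed under mixing, and one additional coordinate of the cube provides the lottery.\<close>

lemma convex_prob_simplex: "convex (prob_simplex :: (real ^ 'x::finite) set)"
  unfolding prob_simplex_def convex_def
  by (auto simp: sum.distrib sum_distrib_left[symmetric])

lemma axis_in_prob_simplex: "axis k 1 \<in> (prob_simplex :: (real ^ 'x::finite) set)"
  unfolding prob_simplex_def by (auto simp: axis_def)

lemma prob_simplex_nonempty: "(prob_simplex :: (real ^ 'x::finite) set) \<noteq> {}"
  using axis_in_prob_simplex by blast

lemma prob_simplexD:
  assumes "p \<in> (prob_simplex :: (real ^ 'x::finite) set)"
  shows "0 \<le> p $ x" "p $ x \<le> 1" "(\<Sum>x\<in>UNIV. p $ x) = 1"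
proof -
  show 1: "0 \<le> p $ x" "(\<Sum>x\<in>UNIV. p $ x) = 1"
    using assms by (auto simp: prob_simplex_def)
  show "p $ x \<le> 1"
    using assms member_le_sum[of x UNIV "\<lambda>x. p $ x"] by (auto simp: prob_simplex_def)
qed

lemma norm_prob_simplex: "p \<in> prob_simplex \<Longrightarrow> norm (p :: real ^ 'x::finite) \<le> 1"
  using norm_le_l1_cart[of p] prob_simplexD[of p] by simp

lemma compact_prob_simplex: "compact (prob_simplex :: (real ^ 'x::finite) set)"
proof -
  have "closed (prob_simplex :: (real ^ 'x::finite) set)"
    unfolding prob_simplex_def
    by (intro closed_Collect_conj closed_Collect_all closed_Collect_le closed_Collect_eq
        continuous_intros)
  then show ?thesis
    by (auto simp: compact_eq_bounded_closed bounded_iff intro: norm_prob_simplex)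
qed

lemma inner_prob_simplex_le:
  assumes "p \<in> (prob_simplex :: (real ^ 'x::finite) set)" "\<And>k. x $ k \<le> c"
  shows "p \<bullet> x \<le> c"
proof -
  have "p \<bullet> x \<le> (\<Sum>k\<in>UNIV. p $ k * c)"
    unfolding inner_vec_def using prob_simplexD[OF assms(1)] assms(2)
    by (intro sum_mono) (auto intro: mult_left_mono)
  then show ?thesis
    using prob_simplexD[OF assms(1)] by (simp add: sum_distrib_right[symmetric])
qed

text \<open>Upward closure rules out negative components of the normal of a separating hyperplane,
  so the normal can be scaled to a probability vector, which then contradicts \<open>below\<close>.
  This form of the minimax theorem is used twice: for the pure actions of player 1 in
  \<open>minimax_approx\<close> and for the types of player 1 in \<open>conjK_less\<close>.\<close>

lemma separation_upward_closed:
  fixes C :: "(real ^ 'k::finite) set"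
  assumes "convex C" "C \<noteq> {}"
    and up: "\<And>x y. x \<in> C \<Longrightarrow> (\<And>k. x $ k \<le> y $ k) \<Longrightarrow> y \<in> C"
    and below: "\<And>p. p \<in> prob_simplex \<Longrightarrow> \<exists>x\<in>C. p \<bullet> x < c"
  shows "(\<chi> k. c) \<in> C"
proof (rule ccontr)
  assume "(\<chi> k. c) \<notin> C"
  then obtain a b where ab: "a \<noteq> 0" "a \<bullet> (\<chi> k. c) \<le> b" "\<And>x. x \<in> C \<Longrightarrow> b \<le> a \<bullet> x"
    using separating_hyperplane_sets[of "{\<chi> k. c}" C] assms(1,2) by auto
  obtain x0 where x0: "x0 \<in> C" using assms(2) by auto
  have a_nonneg: "0 \<le> a $ k" for k
  proof (rule ccontr)
    assume neg: "\<not> 0 \<le> a $ k"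
    \<comment> \<open>\<open>t\<close> moves \<open>x0\<close> so far along coordinate
      \<open>k\<close> that the inner product with \<open>a\<close> drops below
      \<open>b\<close>.\<close>
    define t where "t = (\<bar>a \<bullet> x0 - b\<bar> + 1) / (- a $ k)"
    have "t \<ge> 0" unfolding t_def using neg by (intro divide_nonneg_nonneg) auto
    then have "x0 + t *\<^sub>R axis k 1 \<in> C"
      by (intro up[OF x0]) (auto simp: axis_def)
    then have "b \<le> a \<bullet> x0 + t * a $ k"
      using ab(3) by (fastforce simp: inner_add_right inner_axis)
    also have "t * a $ k = - (\<bar>a \<bullet> x0 - b\<bar> + 1)"
      using neg by (simp add: t_def field_simps)
    finally show False by linarith
  qed
  define s where "s = (\<Sum>k\<in>UNIV. a $ k)"
  have "s > 0"
  proof -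
    obtain k where "a $ k \<noteq> 0" using ab(1) by (auto simp: vec_eq_iff)
    then have "a $ k > 0" using a_nonneg[of k] by linarith
    then show ?thesis
      unfolding s_def using a_nonneg by (intro sum_pos2[of _ k]) auto
  qed
  define p where "p = (1 / s) *\<^sub>R a"
  have "p \<in> prob_simplex"
    using a_nonneg \<open>s > 0\<close>
    by (auto simp: prob_simplex_def p_def s_def sum_divide_distrib[symmetric])
  then obtain x where x: "x \<in> C" "p \<bullet> x < c" using below by blast
  have "a \<bullet> x < s * c"
    using x(2) \<open>s > 0\<close> by (simp add: p_def field_simps)
  moreover have "a \<bullet> (\<chi> k. c) = s * c"
    by (simp add: inner_vec_def s_def sum_distrib_right)
  ultimately show False using ab(2) ab(3)[OF x(1)] by linarith
qed

section \<open>Matrix games and their values\<close>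

lemma bilinear_bound:
  fixes M :: "real ^ 'j::finite ^ 'i::finite"
  shows "\<exists>B. \<forall>a\<in>prob_simplex. \<forall>b\<in>prob_simplex. \<bar>a \<bullet> (M *v b)\<bar> \<le> B"
proof -
  have "compact ((\<lambda>(a, b). a \<bullet> (M *v b)) ` (prob_simplex \<times> prob_simplex))"
    by (intro compact_continuous_image compact_Times compact_prob_simplex)
      (auto simp: case_prod_unfold intro!: continuous_intros
        linear_continuous_on_compose[OF _ matrix_vector_mul_linear])
  then obtain B where "\<forall>x\<in>(\<lambda>(a, b). a \<bullet> (M *v b)) ` (prob_simplex \<times> prob_simplex). norm x \<le> B"
    using compact_imp_bounded bounded_iff by metis
  then show ?thesis by (intro exI[of _ B]) auto
qed

text \<open>Each point of \<open>C\<close> dominates, row by row, what some \<open>b\<close>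
  concedes to the pure actions of player 1. Separation turns a reply \<open>b\<close> to every
  \<open>a\<close> into one \<open>b\<close> that is good against all rows, hence against all
  mixtures of rows. The strict inequality spares the attainment of supremum and infimum.\<close>

lemma minimax_approx:
  fixes M :: "real ^ 'j::finite ^ 'i::finite"
  assumes "c > (SUP a\<in>prob_simplex. INF b\<in>prob_simplex. a \<bullet> (M *v b))"
  shows "\<exists>b\<in>prob_simplex. \<forall>a\<in>prob_simplex. a \<bullet> (M *v b) \<le> c"
proof -
  obtain B where B: "\<And>a b. a \<in> prob_simplex \<Longrightarrow> b \<in> prob_simplex \<Longrightarrow> \<bar>a \<bullet> (M *v b)\<bar> \<le> B"
    using bilinear_bound[of M] by blast
  have bdd: "bdd_below ((\<lambda>b. a \<bullet> (M *v b)) ` prob_simplex)" if "a \<in> prob_simplex" for a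
    using B[OF that] by (intro bdd_belowI2[of _ "-B"]) (meson abs_le_iff minus_le_iff)
  have bdd': "bdd_above ((\<lambda>a. INF b\<in>prob_simplex. a \<bullet> (M *v b)) ` prob_simplex)"
  proof (intro bdd_aboveI2)
    fix a :: "real ^ 'i" assume a: "a \<in> prob_simplex"
    have "(INF b\<in>prob_simplex. a \<bullet> (M *v b)) \<le> a \<bullet> (M *v axis undefined 1)"
      by (intro cINF_lower bdd a axis_in_prob_simplex)
    also have "\<dots> \<le> B" using B[OF a axis_in_prob_simplex] by (simp add: abs_le_iff)
    finally show "(INF b\<in>prob_simplex. a \<bullet> (M *v b)) \<le> B" .
  qed
  define C where "C = {x. \<exists>b\<in>prob_simplex. \<forall>i. (M *v b) $ i \<le> x $ i}"
  have "(\<chi> i. c) \<in> C"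
  proof (rule separation_upward_closed)
    show "convex C"
    proof (rule convexI)
      fix x y and u v :: real
      assume xy: "x \<in> C" "y \<in> C" and uv: "0 \<le> u" "0 \<le> v" "u + v = 1"
      obtain b1 where b1: "b1 \<in> prob_simplex" "\<And>i. (M *v b1) $ i \<le> x $ i"
        using xy by (auto simp: C_def)
      obtain b2 where b2: "b2 \<in> prob_simplex" "\<And>i. (M *v b2) $ i \<le> y $ i"
        using xy by (auto simp: C_def)
      have "u *\<^sub>R b1 + v *\<^sub>R b2 \<in> prob_simplex"
        using convexD[OF convex_prob_simplex b1(1) b2(1) uv] .
      moreover have "(M *v (u *\<^sub>R b1 + v *\<^sub>R b2)) $ i \<le> (u *\<^sub>R x + v *\<^sub>R y) $ i" for i
        using mult_left_mono[OF b1(2)[of i] uv(1)] mult_left_mono[OF b2(2)[of i] uv(2)]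
        by (simp add: matrix_vector_right_distrib matrix_vector_mult_scaleR)
      ultimately show "u *\<^sub>R x + v *\<^sub>R y \<in> C"
        by (auto simp: C_def)
    qed
    show "C \<noteq> {}"
      using axis_in_prob_simplex by (force simp: C_def)
    show "y \<in> C" if "x \<in> C" "\<And>k. x $ k \<le> y $ k" for x y
      using that order_trans unfolding C_def by blast
    fix p :: "real ^ 'i" assume p: "p \<in> prob_simplex"
    have "(INF b\<in>prob_simplex. p \<bullet> (M *v b)) < c"
      using cSUP_upper[OF p bdd'] assms by linarith
    then obtain b where "b \<in> prob_simplex" "p \<bullet> (M *v b) < c"
      using cINF_less_iff[OF prob_simplex_nonempty bdd[OF p]] by blast
    then show "\<exists>x\<in>C. p \<bullet> x < c"
      by (auto simp: C_def)
  qed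
  then show ?thesis
    unfolding C_def using inner_prob_simplex_le by fastforce
qed

definition avg_matrix ::
  "('k::finite \<Rightarrow> 'l::finite \<Rightarrow> real ^ 'j::finite ^ 'i::finite) \<Rightarrow> real ^ ('k \<times> 'l) \<Rightarrow> real ^ 'j ^ 'i" where
  "avg_matrix G \<pi> = (\<Sum>(k, l)\<in>UNIV. \<pi> $ (k, l) *\<^sub>R G k l)"

lemma inner_avg_matrix:
  "a \<bullet> (avg_matrix G \<pi> *v b) = (\<Sum>(k, l)\<in>UNIV. \<pi> $ (k, l) * (a \<bullet> (G k l *v b)))"
proof -
  have *: "linear (\<lambda>M. a \<bullet> (M *v b))"
    by (auto simp: linear_iff matrix_vector_mult_add_rdistrib inner_add_right
        scaleR_matrix_vector_assoc[symmetric])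
  show ?thesis
    unfolding avg_matrix_def case_prod_unfold
    by (simp add: linear_sum[OF *] linear_scale[OF *])
qed

lemma avg_value_eq:
  "avg_value G \<pi> = (SUP a\<in>prob_simplex. INF b\<in>prob_simplex. a \<bullet> (avg_matrix G \<pi> *v b))"
  unfolding avg_value_def inner_avg_matrix ..

section \<open>Exchanging the players\<close>

text \<open>The minimizer of \<open>G\<close> becomes the maximizer, hence the sign and the
  transposition. Together with \<open>swap_vec\<close> and \<open>swap_fun\<close> this turns every
  result on (1) into its counterpart on (2).\<close>

definition swap_game ::
  "('k::finite \<Rightarrow> 'l::finite \<Rightarrow> real ^ 'j::finite ^ 'i::finite) \<Rightarrow> 'l \<Rightarrow> 'k \<Rightarrow> real ^ 'i ^ 'j" where
  "swap_game G l k = - transpose (G k l)"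

definition swap_vec :: "real ^ ('a::finite \<times> 'b::finite) \<Rightarrow> real ^ ('b \<times> 'a)" where
  "swap_vec \<pi> = (\<chi> x. \<pi> $ (snd x, fst x))"

definition swap_fun ::
  "(real ^ ('a::finite \<times> 'b::finite) \<Rightarrow> real) \<Rightarrow> real ^ ('b \<times> 'a) \<Rightarrow> real" where
  "swap_fun \<phi> \<pi> = - \<phi> (swap_vec \<pi>)"

lemma swap_vec_nth [simp]: "swap_vec \<pi> $ (x, y) = \<pi> $ (y, x)"
  by (simp add: swap_vec_def)

lemma swap_vec_swap_vec [simp]: "swap_vec (swap_vec \<pi>) = \<pi>"
  by (auto simp: vec_eq_iff)

lemma swap_fun_swap_fun [simp]: "swap_fun (swap_fun \<phi>) = \<phi>"
  by (auto simp: swap_fun_def)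

lemma swap_vec_disint [simp]:
  "swap_vec (disintL q P) = disintK q P" "swap_vec (disintK p Q) = disintL p Q"
  by (auto simp: vec_eq_iff disintL_def disintK_def)

lemma sum_swap_pair: "(\<Sum>(k, l)\<in>UNIV. f k l) = (\<Sum>(l, k)\<in>UNIV. f (k::'a::finite) (l::'b::finite))"
  by (rule sum.reindex_bij_witness[of _ prod.swap prod.swap]) auto

lemma swap_vec_prob_simplex [simp]: "swap_vec \<pi> \<in> prob_simplex \<longleftrightarrow> \<pi> \<in> prob_simplex"
proof -
  have "(\<Sum>x\<in>UNIV. swap_vec \<pi> $ x) = (\<Sum>x\<in>UNIV. \<pi> $ x)"
    by (rule sum.reindex_bij_witness[of _ prod.swap prod.swap]) auto
  then show ?thesis
    by (auto simp: prob_simplex_def)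
qed

lemma avg_matrix_swap: "avg_matrix (swap_game G) (swap_vec \<pi>) = - transpose (avg_matrix G \<pi>)"
proof -
  have lin: "linear (\<lambda>M :: real ^ 'j ^ 'i. - transpose M)"
    by (auto simp: linear_iff transpose_def vec_eq_iff)
  show ?thesis
    unfolding avg_matrix_def
    by (subst sum_swap_pair)
      (simp add: case_prod_unfold swap_game_def linear_sum[OF lin] linear_scale[OF lin])
qed

text \<open>The SUP-INF of the exchanged game is minus an INF-SUP of the original one, so this is
  the minimax equality: weak duality gives one inequality, the almost optimal \<open>b\<close> of
  \<open>minimax_approx\<close> the other.\<close>

lemma avg_value_swap: "avg_value (swap_game G) (swap_vec \<pi>) = - avg_value G \<pi>"
proof -
  define M where "M = avg_matrix G \<pi>"
  have *: "b \<bullet> (- transpose M *v a) = - (a \<bullet> (M *v b))" for a b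
  proof -
    have "- transpose M *v a = - (transpose M *v a)"
      by (auto simp: vec_eq_iff matrix_vector_mult_def sum_negf)
    then show ?thesis
      by (metis dot_lmul_matrix inner_commute inner_minus_right transpose_matrix_vector)
  qed
  obtain B where B: "\<And>a b. a \<in> prob_simplex \<Longrightarrow> b \<in> prob_simplex \<Longrightarrow> \<bar>a \<bullet> (M *v b)\<bar> \<le> B"
    using bilinear_bound[of M] by blast
  have bdd1: "bdd_below ((\<lambda>b. a \<bullet> (M *v b)) ` prob_simplex)" if "a \<in> prob_simplex" for a
    using B[OF that] by (intro bdd_belowI2[of _ "-B"]) (meson abs_le_iff minus_le_iff)
  have bdd2: "bdd_below ((\<lambda>a. - (a \<bullet> (M *v b))) ` prob_simplex)" if "b \<in> prob_simplex" for b
    using B[OF _ that] by (intro bdd_belowI2[of _ "-B"]) (auto simp: abs_le_iff)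
  define v where "v = (SUP a\<in>prob_simplex. INF b\<in>prob_simplex. a \<bullet> (M *v b))"
  define v' where "v' = (SUP b\<in>prob_simplex. INF a\<in>prob_simplex. - (a \<bullet> (M *v b)))"
  have weak: "(INF b\<in>prob_simplex. a \<bullet> (M *v b)) \<le> - (INF a\<in>prob_simplex. - (a \<bullet> (M *v b)))"
    if "a \<in> prob_simplex" "b \<in> prob_simplex" for a b
    using cINF_lower[OF bdd1[OF that(1)] that(2)] cINF_lower[OF bdd2[OF that(2)] that(1)] by linarith
  have weak': "v \<le> - (INF a\<in>prob_simplex. - (a \<bullet> (M *v b)))" if "b \<in> prob_simplex" for b
    unfolding v_def using weak[OF _ that] by (intro cSUP_least prob_simplex_nonempty)
  have "v' \<le> - v"
    unfolding v'_def using weak' by (intro cSUP_least prob_simplex_nonempty) force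
  moreover have "- v \<le> v'"
  proof (rule field_le_epsilon)
    fix e :: real assume "e > 0"
    then obtain b where b: "b \<in> prob_simplex" "\<And>a. a \<in> prob_simplex \<Longrightarrow> a \<bullet> (M *v b) \<le> v + e"
      using minimax_approx[of M "v + e"] by (auto simp: v_def)
    have "- v - e \<le> (INF a\<in>prob_simplex. - (a \<bullet> (M *v b)))"
      using b(2) by (intro cINF_greatest prob_simplex_nonempty) force
    also have "\<dots> \<le> v'"
      unfolding v'_def using weak'
      by (intro cSUP_upper b bdd_aboveI2[of _ _ "- v"]) force
    finally show "- v \<le> v' + e" by simp
  qed
  ultimately show ?thesis
    unfolding avg_value_eq avg_matrix_swap M_def[symmetric] * v_def[symmetric] v'_def[symmetric]
    by simp
qed

text \<open>Condition (1) in isolation. Condition (2) is the same condition for the exchanged game,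
  so the analysis can be confined to (1).\<close>

definition dual_subsolution ::
  "('k::finite \<Rightarrow> 'l::finite \<Rightarrow> real ^ 'j::finite ^ 'i::finite) \<Rightarrow>
   (real ^ ('k \<times> 'l) \<Rightarrow> real) \<Rightarrow> bool" where
  "dual_subsolution G \<phi> \<longleftrightarrow>
     (\<forall>Q. (\<forall>k. Q $ k \<in> prob_simplex) \<longrightarrow>
        viscosity_subsolution (\<lambda>\<zeta> r d. - r + d \<bullet> \<zeta> + avg_value G (disintK (- d) Q))
          (\<lambda>\<zeta>. conjK \<phi> \<zeta> Q))"

section \<open>Concavity, conjugates and viscosity inequalities under the exchange of the
  players\<close>

lemma K_concave_swap: "K_concave (swap_fun \<phi>) \<longleftrightarrow> L_convex \<phi>"
  by (simp add: K_concave_def L_convex_def concave_on_def swap_fun_def)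

lemma dist_swap_vec [simp]: "dist (swap_vec x) (swap_vec y) = dist x y"
proof -
  have "(\<Sum>i\<in>UNIV. (dist (swap_vec x $ i) (swap_vec y $ i))\<^sup>2) = (\<Sum>i\<in>UNIV. (dist (x $ i) (y $ i))\<^sup>2)"
    by (rule sum.reindex_bij_witness[of _ prod.swap prod.swap]) auto
  then show ?thesis
    by (simp add: dist_vec_def L2_set_def)
qed

lemma lipschitz_swap_fun:
  assumes "C-lipschitz_on prob_simplex \<phi>"
  shows "C-lipschitz_on prob_simplex (swap_fun \<phi>)"
proof -
  have "dist (- \<phi> (swap_vec x)) (- \<phi> (swap_vec y)) \<le> C * dist x y"
    if "x \<in> prob_simplex" "y \<in> prob_simplex" for x y
    using lipschitz_onD[OF assms, of "swap_vec x" "swap_vec y"] that by (simp add: dist_minus)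
  then show ?thesis
    using lipschitz_on_nonneg[OF assms] by (intro lipschitz_onI) (auto simp: swap_fun_def)
qed

lemma conjL_eq_conjK_swap: "conjL \<phi> P \<eta> = - conjK (swap_fun \<phi>) \<eta> P"
  by (simp add: conjL_def conjK_def Inf_real_def image_image swap_fun_def)

lemma C1_gradient_uminus: "C1_gradient \<phi> D \<Longrightarrow> C1_gradient (\<lambda>x. - \<phi> x) (\<lambda>x. - D x)"
  unfolding C1_gradient_def by (auto intro!: continuous_intros GDERIV_minus)

lemma viscosity_supersolution_uminus:
  assumes "\<And>x r d. F' x r d = - F x (- r) (- d)"
  shows "viscosity_supersolution F' w \<longleftrightarrow> viscosity_subsolution F (\<lambda>x. - w x)"
proof -
  have "lsc w \<longleftrightarrow> usc (\<lambda>x. - w x)"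
  proof
    assume w: "lsc w"
    show "usc (\<lambda>x. - w x)"
      unfolding usc_def
    proof (intro allI impI)
      fix x c assume "- w x < c"
      then have "\<forall>\<^sub>F y in nhds x. - c < w y"
        using w by (auto simp: lsc_def)
      then show "\<forall>\<^sub>F y in nhds x. - w y < c"
        by (auto elim!: eventually_mono)
    qed
  next
    assume w: "usc (\<lambda>x. - w x)"
    show "lsc w"
      unfolding lsc_def
    proof (intro allI impI)
      fix x c assume "c < w x"
      moreover have "- w x < - c \<longrightarrow> (\<forall>\<^sub>F y in nhds x. - w y < - c)"
        using w unfolding usc_def by blast
      ultimately show "\<forall>\<^sub>F y in nhds x. c < w y"
        by simp
    qed
  qed
  moreover have "(\<forall>\<phi> D x. C1_gradient \<phi> D \<and> local_min_at (\<lambda>y. w y - \<phi> y) x \<longrightarrow> F' x (w x) (D x) \<le> 0)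
    \<longleftrightarrow> (\<forall>\<phi> D x. C1_gradient \<phi> D \<and> local_max_at (\<lambda>y. - w y - \<phi> y) x \<longrightarrow> 0 \<le> F x (- w x) (D x))"
    (is "?L = ?R")
  proof
    assume L: ?L
    show ?R
    proof (intro allI impI)
      fix \<phi> D x assume a: "C1_gradient \<phi> D \<and> local_max_at (\<lambda>y. - w y - \<phi> y) x"
      then have "C1_gradient (\<lambda>x. - \<phi> x) (\<lambda>x. - D x)" "local_min_at (\<lambda>y. w y - - \<phi> y) x"
        by (auto simp: C1_gradient_uminus local_min_at_def local_max_at_def elim!: eventually_mono)
      with L have "F' x (w x) (- D x) \<le> 0" by blast
      then show "0 \<le> F x (- w x) (D x)" by (simp add: assms)
    qed
  next
    assume R: ?R
    show ?L
    proof (intro allI impI)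
      fix \<phi> D x assume a: "C1_gradient \<phi> D \<and> local_min_at (\<lambda>y. w y - \<phi> y) x"
      then have "C1_gradient (\<lambda>x. - \<phi> x) (\<lambda>x. - D x)" "local_max_at (\<lambda>y. - w y - - \<phi> y) x"
        by (auto simp: C1_gradient_uminus local_min_at_def local_max_at_def elim!: eventually_mono)
      with R have "0 \<le> F x (- w x) (- D x)" by blast
      then show "F' x (w x) (D x) \<le> 0" by (simp add: assms)
    qed
  qed
  ultimately show ?thesis
    unfolding viscosity_supersolution_def viscosity_subsolution_def by blast
qed

lemma dual_solution_iff:
  "dual_solution G \<phi> \<longleftrightarrow>
     K_concave \<phi> \<and> L_convex \<phi> \<and> (\<exists>C. C-lipschitz_on prob_simplex \<phi>) \<and>
     dual_subsolution G \<phi> \<and> dual_subsolution (swap_game G) (swap_fun \<phi>)"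
proof -
  have "viscosity_supersolution (\<lambda>\<eta> r d. - r + d \<bullet> \<eta> + avg_value G (disintL d P)) (conjL \<phi> P)
    \<longleftrightarrow> viscosity_subsolution
      (\<lambda>\<zeta> r d. - r + d \<bullet> \<zeta> + avg_value (swap_game G) (disintK (- d) P))
      (\<lambda>\<zeta>. conjK (swap_fun \<phi>) \<zeta> P)" for P
  proof -
    have "conjK (swap_fun \<phi>) \<zeta> P = - conjL \<phi> P \<zeta>" for \<zeta>
      by (simp add: conjL_eq_conjK_swap)
    then show ?thesis
      using avg_value_swap[of G "disintL d P" for d]
      by (simp only:) (rule viscosity_supersolution_uminus, simp)
  qed
  then show ?thesis
    unfolding dual_solution_def dual_subsolution_def by simp
qed

section \<open>Comparison principle\<close>

text \<open>Concavity alone allows infinite slope at the boundary of \<open>S\<close>. The Lipschitz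
  bound keeps the hypograph \<open>A\<close> disjoint from the region \<open>B\<close> above the
  cone with vertex \<open>(p0, f p0)\<close> and slope \<open>C\<close>; a hyperplane between them
  cannot be vertical because \<open>B\<close> lies over the whole space.\<close>

lemma concave_lipschitz_supergradient:
  fixes f :: "'a::euclidean_space \<Rightarrow> real"
  assumes "concave_on S f" "C-lipschitz_on S f" "p0 \<in> S"
  shows "\<exists>z. \<forall>p\<in>S. f p \<le> f p0 + z \<bullet> (p - p0)"
proof -
  have "convex S" using assms(1) by (simp add: concave_on_iff)
  define A where "A = {(p, r). p \<in> S \<and> r \<le> f p}"
  define B where "B = {(x, r). f p0 + C * norm (x - p0) < r}"
  have "C \<ge> 0" using assms(2) by (rule lipschitz_on_nonneg)
  have "convex A"
  proof (rule convexI)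
    fix x y and u v :: real
    assume "x \<in> A" "y \<in> A" and uv: "0 \<le> u" "0 \<le> v" "u + v = 1"
    then obtain p r p' r' where xy: "x = (p, r)" "y = (p', r')" "p \<in> S" "p' \<in> S" "r \<le> f p" "r' \<le> f p'"
      by (auto simp: A_def)
    have "u * r + v * r' \<le> u * f p + v * f p'"
      using xy uv by (intro add_mono mult_left_mono) auto
    also have "\<dots> \<le> f (u *\<^sub>R p + v *\<^sub>R p')"
      using assms(1) xy uv by (auto simp: concave_on_iff)
    finally show "u *\<^sub>R x + v *\<^sub>R y \<in> A"
      using convexD[OF \<open>convex S\<close> xy(3,4) uv] xy by (auto simp: A_def)
  qed
  have "convex B"
  proof (rule convexI)
    fix x y and u v :: real
    assume "x \<in> B" "y \<in> B" and uv: "0 \<le> u" "0 \<le> v" "u + v = 1"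
    then obtain p r p' r' where xy: "x = (p, r)" "y = (p', r')"
      "f p0 + C * norm (p - p0) < r" "f p0 + C * norm (p' - p0) < r'"
      by (auto simp: B_def)
    have "u *\<^sub>R p + v *\<^sub>R p' - p0 = u *\<^sub>R (p - p0) + v *\<^sub>R (p' - p0)"
    proof -
      have "u *\<^sub>R p + v *\<^sub>R p' - (u + v) *\<^sub>R p0 = u *\<^sub>R (p - p0) + v *\<^sub>R (p' - p0)"
        by (simp add: algebra_simps)
      then show ?thesis using uv(3) by simp
    qed
    then have "norm (u *\<^sub>R p + v *\<^sub>R p' - p0) \<le> u * norm (p - p0) + v * norm (p' - p0)"
      using norm_triangle_ineq[of "u *\<^sub>R (p - p0)" "v *\<^sub>R (p' - p0)"] uv by simp
    then have *: "C * norm (u *\<^sub>R p + v *\<^sub>R p' - p0) \<le> C * (u * norm (p - p0) + v * norm (p' - p0))"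
      using \<open>C \<ge> 0\<close> by (rule mult_left_mono)
    have "f p0 + C * norm (u *\<^sub>R p + v *\<^sub>R p' - p0)
      \<le> u * (f p0 + C * norm (p - p0)) + v * (f p0 + C * norm (p' - p0))"
    proof -
      have "u * f p0 + v * f p0 = f p0"
        using uv(3) by (metis distrib_right mult_1)
      with * show ?thesis by (simp add: algebra_simps)
    qed
    also have "\<dots> < u * r + v * r'"
    proof (cases "u = 0")
      case True then show ?thesis using uv xy by simp
    next
      case False
      then show ?thesis using uv xy
        by (intro add_less_le_mono mult_strict_left_mono mult_left_mono) auto
    qed
    finally show "u *\<^sub>R x + v *\<^sub>R y \<in> B"
      using xy by (auto simp: B_def)
  qed
  have "A \<inter> B = {}"
  proof -
    have "f p \<le> f p0 + C * norm (p - p0)" if "p \<in> S" for p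
      using lipschitz_onD[OF assms(2) that assms(3)] by (simp add: dist_norm)
    then show ?thesis by (force simp: A_def B_def)
  qed
  moreover have "(p0, f p0) \<in> A" "(p0, f p0 + 1) \<in> B"
    using assms(3) by (auto simp: A_def B_def)
  ultimately obtain ab b where ab: "ab \<noteq> 0" "\<And>x. x \<in> A \<Longrightarrow> ab \<bullet> x \<le> b" "\<And>x. x \<in> B \<Longrightarrow> b \<le> ab \<bullet> x"
    using separating_hyperplane_sets[OF \<open>convex A\<close> \<open>convex B\<close>] by blast
  obtain a s where as: "ab = (a, s)" by (cases ab)
  have inA: "a \<bullet> p + s * f p \<le> b" if "p \<in> S" for p
    using ab(2)[of "(p, f p)"] that by (simp add: A_def as)
  have inB: "b \<le> a \<bullet> x + s * r" if "f p0 + C * norm (x - p0) < r" for x r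
    using ab(3)[of "(x, r)"] that by (simp add: B_def as)
  have "s \<ge> 0"
    using inA[OF assms(3)] inB[of p0 "f p0 + 1"] by (simp add: algebra_simps)
  moreover have "s \<noteq> 0"
  proof
    assume "s = 0"
    \<comment> \<open>If the hyperplane were vertical, \<open>a \<bullet> x\<close> would be at
      least \<open>b\<close> for every \<open>x\<close>; the choice \<open>p0 - a\<close> then
      forces \<open>a = 0\<close>.\<close>
    have "b \<le> a \<bullet> p0 - a \<bullet> a"
      using inB[of "p0 - a" "f p0 + C * norm (p0 - a - p0) + 1"] \<open>s = 0\<close>
      by (simp add: inner_diff_right)
    moreover have "a \<bullet> p0 \<le> b" using inA[OF assms(3)] \<open>s = 0\<close> by simp
    ultimately have "a \<bullet> a \<le> 0" by simp
    then have "a = 0" using inner_gt_zero_iff[of a] by fastforce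
    then show False using ab(1) as \<open>s = 0\<close> by (simp add: zero_prod_def)
  qed
  ultimately have "s > 0" by simp
  have b_le: "b \<le> a \<bullet> p0 + s * f p0"
  proof (rule field_le_epsilon)
    fix e :: real assume "e > 0"
    then show "b \<le> a \<bullet> p0 + s * f p0 + e"
      using inB[of p0 "f p0 + e / s"] \<open>s > 0\<close> by (simp add: algebra_simps)
  qed
  have "f p \<le> f p0 + (- (1 / s) *\<^sub>R a) \<bullet> (p - p0)" if "p \<in> S" for p
  proof -
    have "s * f p \<le> s * f p0 - a \<bullet> (p - p0)"
      using inA[OF that] b_le by (simp add: inner_diff_right)
    then have "f p \<le> (s * f p0 - a \<bullet> (p - p0)) / s"
      using \<open>s > 0\<close> by (simp add: field_simps)
    then show ?thesis using \<open>s > 0\<close> by (simp add: diff_divide_distrib)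
  qed
  then show ?thesis by blast
qed

section \<open>Disintegration of joint laws and convexity of the squared norm\<close>

lemma disintK_in_prob_simplex:
  assumes "p \<in> prob_simplex" "\<And>k. Q $ k \<in> prob_simplex"
  shows "disintK p Q \<in> prob_simplex"
proof -
  have "(\<Sum>kl\<in>UNIV. disintK p Q $ kl) = (\<Sum>k\<in>UNIV. \<Sum>l\<in>UNIV. p $ k * Q $ k $ l)"
    unfolding sum.cartesian_product by (simp add: disintK_def case_prod_unfold)
  also have "\<dots> = 1"
    using prob_simplexD(3)[OF assms(1)] prob_simplexD(3)[OF assms(2)]
    by (simp add: sum_distrib_left[symmetric])
  finally show ?thesis
    using prob_simplexD(1)[OF assms(1)] prob_simplexD(1)[OF assms(2)]
    by (auto simp: prob_simplex_def disintK_def)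
qed

lemma disintK_exhaust:
  fixes \<pi> :: "real ^ ('k::finite \<times> 'l::finite)"
  assumes "\<pi> \<in> prob_simplex"
  obtains p Q where "p \<in> prob_simplex" "\<And>k. Q $ k \<in> prob_simplex" "\<pi> = disintK p Q"
proof
  define p where "p = (\<chi> k. \<Sum>l\<in>UNIV. \<pi> $ (k, l))"
  \<comment> \<open>The conditional law of \<open>l\<close> given \<open>k\<close>. Where the
    marginal vanishes any law will do, and a vertex keeps \<open>Q $ k\<close> in the
    simplex.\<close>
  define Q where "Q = (\<chi> k. if p $ k = 0 then axis undefined 1 else (\<chi> l. \<pi> $ (k, l) / p $ k))"
  have nonneg: "0 \<le> \<pi> $ x" for x using assms by (rule prob_simplexD)
  have "(\<Sum>k\<in>UNIV. p $ k) = (\<Sum>kl\<in>UNIV. \<pi> $ kl)"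
    unfolding p_def by (simp add: sum.cartesian_product)
  then show "p \<in> prob_simplex"
    using assms nonneg by (auto simp: prob_simplex_def p_def intro: sum_nonneg)
  show "Q $ k \<in> prob_simplex" for k
  proof (cases "p $ k = 0")
    case False
    then show ?thesis
      using nonneg
      by (auto simp: Q_def prob_simplex_def sum_divide_distrib[symmetric] p_def
          intro: sum_nonneg divide_nonneg_nonneg)
  qed (simp add: Q_def axis_in_prob_simplex)
  have "\<pi> $ (k, l) = disintK p Q $ (k, l)" for k l
  proof (cases "p $ k = 0")
    case True
    then have "\<pi> $ (k, l) = 0"
      using nonneg by (simp add: p_def sum_nonneg_eq_0_iff)
    then show ?thesis using True by (simp add: disintK_def)
  qed (simp add: disintK_def Q_def)
  then show "\<pi> = disintK p Q" by (auto simp: vec_eq_iff)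
qed

lemma disintK_linear: "linear (\<lambda>p. disintK p Q)"
  by (auto simp: linear_iff disintK_def vec_eq_iff algebra_simps)

lemma norm_disintK_power2: "(norm (disintK p Q))\<^sup>2 = (\<Sum>k\<in>UNIV. (norm (Q $ k))\<^sup>2 * (p $ k)\<^sup>2)"
proof -
  have "(norm (disintK p Q))\<^sup>2 = (\<Sum>k\<in>UNIV. \<Sum>l\<in>UNIV. (p $ k * Q $ k $ l)\<^sup>2)"
    unfolding sum.cartesian_product power2_norm_eq_inner inner_vec_def
    by (simp add: disintK_def case_prod_unfold power2_eq_square)
  then show ?thesis
    unfolding power2_norm_eq_inner
    by (simp add: inner_vec_def power2_eq_square sum_distrib_left sum_distrib_right mult_ac)
qed

lemma norm_disintK_le:
  assumes "\<And>k. Q $ k \<in> prob_simplex"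
  shows "norm (disintK p Q) \<le> norm p"
proof -
  have "(norm (disintK p Q))\<^sup>2 \<le> (\<Sum>k\<in>UNIV. (p $ k)\<^sup>2)"
    unfolding norm_disintK_power2 using norm_prob_simplex[OF assms]
    by (intro sum_mono) (simp add: mult_left_le_one_le power_le_one)
  also have "\<dots> = (norm p)\<^sup>2"
    unfolding power2_norm_eq_inner by (simp add: inner_vec_def power2_eq_square)
  finally show ?thesis by (simp add: power2_le_iff_abs_le)
qed

lemma norm_prob_simplex_ge:
  assumes "q \<in> (prob_simplex :: (real ^ 'l::finite) set)"
  shows "1 / real CARD('l) \<le> (norm q)\<^sup>2"
proof -
  have "(\<Sum>l\<in>UNIV. 1 * q $ l)\<^sup>2 \<le> (\<Sum>l\<in>(UNIV::'l set). 1\<^sup>2) * (\<Sum>l\<in>UNIV. (q $ l)\<^sup>2)"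
    by (rule Cauchy_Schwarz_ineq_sum)
  moreover have "(norm q)\<^sup>2 = (\<Sum>l\<in>UNIV. (q $ l)\<^sup>2)"
    unfolding power2_norm_eq_inner by (simp add: inner_vec_def power2_eq_square)
  ultimately show ?thesis
    using prob_simplexD(3)[OF assms] by (simp add: field_simps)
qed

text \<open>The squared norm of \<open>disintK p Q\<close> is a diagonal quadratic form in
  \<open>p\<close> with weights \<open>(norm (Q $ k))\<^sup>2\<close>, and Cauchy-Schwarz bounds
  these below by \<open>1 / CARD('l)\<close>. The modulus of convexity is therefore the same for all
  \<open>Q\<close>.\<close>

lemma norm_disintK_strongly_convex:
  fixes Q :: "real ^ 'l::finite ^ 'k::finite"
  assumes "\<And>k. Q $ k \<in> prob_simplex"
  shows "\<exists>z. \<forall>p'. (norm (disintK p Q))\<^sup>2 + z \<bullet> (p' - p) + (norm (p' - p))\<^sup>2 / CARD('l)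
    \<le> (norm (disintK p' Q))\<^sup>2"
proof (intro exI allI)
  fix p'
  \<comment> \<open>The gradient of the quadratic form at \<open>p\<close>.\<close>
  define z where "z = (\<chi> k. 2 * (norm (Q $ k))\<^sup>2 * p $ k)"
  have "(norm (p' - p))\<^sup>2 / CARD('l) = (\<Sum>k\<in>UNIV. (1 / real CARD('l)) * (p' $ k - p $ k)\<^sup>2)"
    unfolding power2_norm_eq_inner
    by (simp add: inner_vec_def power2_eq_square sum_divide_distrib)
  also have "\<dots> \<le> (\<Sum>k\<in>UNIV. (norm (Q $ k))\<^sup>2 * (p' $ k - p $ k)\<^sup>2)"
    using norm_prob_simplex_ge[OF assms] by (intro sum_mono mult_right_mono) auto
  also have "\<dots> = (\<Sum>k\<in>UNIV. (norm (Q $ k))\<^sup>2 * (p' $ k)\<^sup>2 - (norm (Q $ k))\<^sup>2 * (p $ k)\<^sup>2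
      - z $ k * (p' $ k - p $ k))"
    by (intro sum.cong refl) (simp add: z_def power2_eq_square algebra_simps)
  also have "\<dots> = (norm (disintK p' Q))\<^sup>2 - (norm (disintK p Q))\<^sup>2 - z \<bullet> (p' - p)"
    unfolding norm_disintK_power2 by (simp add: sum_subtractf inner_vec_def)
  finally show "(norm (disintK p Q))\<^sup>2 + z \<bullet> (p' - p) + (norm (p' - p))\<^sup>2 / CARD('l)
    \<le> (norm (disintK p' Q))\<^sup>2"
    by simp
qed

text \<open>The conjugate of a function that is strongly exposed at \<open>p\<close> is touched from above by a
  quadratic test function with gradient \<open>- p\<close>.\<close>

lemma dual_subsolution_exposed_le:
  assumes sub: "dual_subsolution G \<phi>" and p: "p \<in> prob_simplex" and Q: "\<And>k. Q $ k \<in> prob_simplex"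
    and "c > 0"
    and exposed: "\<And>p'. p' \<in> prob_simplex \<Longrightarrow>
      \<phi> (disintK p' Q) \<le> \<phi> (disintK p Q) + z \<bullet> (p' - p) - c * (norm (p' - p))\<^sup>2"
  shows "\<phi> (disintK p Q) \<le> avg_value G (disintK p Q)"
proof -
  define m where "m = \<phi> (disintK p Q) - p \<bullet> z"
  \<comment> \<open>\<open>m + T y\<close> is the conjugate, over the whole space, of the paraboloid
    in \<open>exposed\<close>; the square completed below vanishes at its maximizer.\<close>
  define T where "T = (\<lambda>y. (1 / (4 * c)) * ((y - z) \<bullet> (y - z)) - p \<bullet> (y - z))"
  define D where "D = (\<lambda>y. (1 / (2 * c)) *\<^sub>R (y - z) - p)"
  have le: "\<phi> (disintK p' Q) - p' \<bullet> y \<le> m + T y" if "p' \<in> prob_simplex" for p' y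
  proof -
    have "0 \<le> ((2 * c) *\<^sub>R (p' - p) + (y - z)) \<bullet> ((2 * c) *\<^sub>R (p' - p) + (y - z))"
      by simp
    also have "\<dots> = 4 * c * (c * (norm (p' - p))\<^sup>2 + (p' - p) \<bullet> (y - z)
        + (1 / (4 * c)) * ((y - z) \<bullet> (y - z)))"
      unfolding power2_norm_eq_inner inner_add inner_scaleR_left inner_scaleR_right
        inner_commute[of "y - z" "p' - p"]
      using \<open>c > 0\<close> by (simp add: field_simps)
    finally have "0 \<le> c * (norm (p' - p))\<^sup>2 + (p' - p) \<bullet> (y - z) + (1 / (4 * c)) * ((y - z) \<bullet> (y - z))"
      using \<open>c > 0\<close> by (simp add: zero_le_mult_iff)
    moreover have "z \<bullet> (p' - p) - p' \<bullet> y = - (p \<bullet> z) - p \<bullet> (y - z) - (p' - p) \<bullet> (y - z)"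
      by (simp add: inner_diff inner_commute)
    ultimately show ?thesis
      using exposed[OF that] unfolding m_def T_def by linarith
  qed
  have conj_le: "conjK \<phi> y Q \<le> m + T y" for y
    unfolding conjK_def using le by (intro cSUP_least prob_simplex_nonempty) auto
  have "m \<le> conjK \<phi> z Q"
    unfolding conjK_def m_def using le by (intro cSUP_upper p bdd_aboveI2) auto
  moreover have "T z = 0" by (simp add: T_def)
  ultimately have conj_z: "conjK \<phi> z Q = m"
    using conj_le[of z] by simp
  have "C1_gradient T D"
    unfolding C1_gradient_def gderiv_def T_def D_def using \<open>c > 0\<close>
    by (auto intro!: derivative_eq_intros continuous_intros simp: fun_eq_iff inner_diff inner_commute)
      (simp add: field_simps)
  moreover have "local_max_at (\<lambda>y. conjK \<phi> y Q - T y) z"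
    using conj_le \<open>T z = 0\<close> by (auto simp: local_max_at_def conj_z algebra_simps)
  ultimately have "0 \<le> - conjK \<phi> z Q + D z \<bullet> z + avg_value G (disintK (- D z) Q)"
    using sub Q unfolding dual_subsolution_def viscosity_subsolution_def by blast
  \<comment> \<open>Since \<open>D z = - p\<close> and the conjugate at \<open>z\<close> is
    \<open>m\<close>, the terms in \<open>z\<close> cancel.\<close>
  then show ?thesis
    by (simp add: conj_z m_def D_def)
qed

lemma dual_subsolution_le_at_max:
  fixes \<phi> \<psi> :: "real ^ ('k::finite \<times> 'l::finite) \<Rightarrow> real"
  assumes sub: "dual_subsolution G \<phi>" and conc: "K_concave \<psi>" and lip: "C-lipschitz_on prob_simplex \<psi>"
    and \<pi>: "\<pi> \<in> prob_simplex" and "e > 0"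
    and max: "\<And>\<pi>'. \<pi>' \<in> prob_simplex \<Longrightarrow>
      \<phi> \<pi>' - \<psi> \<pi>' + e * (norm \<pi>')\<^sup>2 \<le> \<phi> \<pi> - \<psi> \<pi> + e * (norm \<pi>)\<^sup>2"
  shows "\<phi> \<pi> \<le> avg_value G \<pi>"
proof -
  obtain p Q where p: "p \<in> prob_simplex" and Q: "\<And>k. Q $ k \<in> prob_simplex" and \<pi>_eq: "\<pi> = disintK p Q"
    using disintK_exhaust[OF \<pi>] by metis
  have "C-lipschitz_on prob_simplex (\<lambda>p. \<psi> (disintK p Q))"
  proof (rule lipschitz_onI)
    fix x y :: "real ^ 'k" assume xy: "x \<in> prob_simplex" "y \<in> prob_simplex"
    have "dist (\<psi> (disintK x Q)) (\<psi> (disintK y Q)) \<le> C * dist (disintK x Q) (disintK y Q)"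
      using lipschitz_onD[OF lip] disintK_in_prob_simplex xy Q by blast
    also have "dist (disintK x Q) (disintK y Q) = norm (disintK (x - y) Q)"
      by (simp add: dist_norm linear_diff[OF disintK_linear])
    also have "\<dots> \<le> dist x y"
      using norm_disintK_le[OF Q] by (simp add: dist_norm)
    finally show "dist (\<psi> (disintK x Q)) (\<psi> (disintK y Q)) \<le> C * dist x y"
      using lipschitz_on_nonneg[OF lip] by (simp add: mult_left_mono)
  qed (rule lipschitz_on_nonneg[OF lip])
  moreover have "concave_on prob_simplex (\<lambda>p. \<psi> (disintK p Q))"
    using conc Q by (simp add: K_concave_def)
  ultimately have "\<exists>x. \<forall>p'\<in>prob_simplex. \<psi> (disintK p' Q) \<le> \<psi> (disintK p Q) + x \<bullet> (p' - p)"
    using p by (intro concave_lipschitz_supergradient)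
  then obtain x where x: "\<And>p'. p' \<in> prob_simplex \<Longrightarrow>
      \<psi> (disintK p' Q) \<le> \<psi> (disintK p Q) + x \<bullet> (p' - p)"
    by blast
  obtain z where z: "\<And>p'. (norm (disintK p Q))\<^sup>2 + z \<bullet> (p' - p) + (norm (p' - p))\<^sup>2 / CARD('l)
    \<le> (norm (disintK p' Q))\<^sup>2"
    using norm_disintK_strongly_convex[of Q p] Q by auto
  show ?thesis
    unfolding \<pi>_eq
  proof (rule dual_subsolution_exposed_le[OF sub p Q])
    show "e / CARD('l) > 0" using \<open>e > 0\<close> by simp
    fix p' :: "real ^ 'k" assume p': "p' \<in> prob_simplex"
    \<comment> \<open>Strong convexity of the penalty supplies the quadratic gap; its linear part is
      absorbed into the slope \<open>x - e *\<^sub>R z\<close>.\<close>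
    have "e * ((norm (disintK p Q))\<^sup>2 + z \<bullet> (p' - p) + (norm (p' - p))\<^sup>2 / CARD('l))
      \<le> e * (norm (disintK p' Q))\<^sup>2"
      using z \<open>e > 0\<close> by simp
    then show "\<phi> (disintK p' Q) \<le> \<phi> (disintK p Q) + (x - e *\<^sub>R z) \<bullet> (p' - p)
        - e / CARD('l) * (norm (p' - p))\<^sup>2"
      using max[OF disintK_in_prob_simplex[OF p' Q]] x[OF p'] unfolding \<pi>_eq
      by (simp add: distrib_left inner_diff_left)
  qed
qed

lemma norm_swap_vec: "norm (swap_vec y) = norm y"
  for y :: "real ^ ('a::finite \<times> 'b::finite)"
proof -
  have "(0 :: real ^ ('b \<times> 'a)) = swap_vec 0" by (simp add: vec_eq_iff)
  then show ?thesis using dist_swap_vec[of y 0] by (simp add: dist_norm)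
qed

text \<open>In the exchanged game \<open>swap_fun \<psi>\<close> plays the part of the sub-solution
  and \<open>swap_fun \<phi>\<close> that of the concave function. On the simplex the penalty lies
  between \<open>0\<close> and \<open>e\<close>, so passing from the maximum point to
  \<open>\<pi>\<close> costs at most \<open>e\<close>.\<close>

lemma dual_comparison:
  fixes \<phi> \<psi> :: "real ^ ('k::finite \<times> 'l::finite) \<Rightarrow> real"
  assumes \<phi>: "L_convex \<phi>" "C-lipschitz_on prob_simplex \<phi>" "dual_subsolution G \<phi>"
    and \<psi>: "K_concave \<psi>" "C'-lipschitz_on prob_simplex \<psi>" "dual_subsolution (swap_game G) (swap_fun \<psi>)"
    and \<pi>: "\<pi> \<in> prob_simplex"
  shows "\<phi> \<pi> \<le> \<psi> \<pi>"
proof (rule field_le_epsilon)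
  fix e :: real assume "e > 0"
  have "continuous_on prob_simplex (\<lambda>x. \<phi> x - \<psi> x + e * (norm x)\<^sup>2)"
    using \<phi>(2) \<psi>(2) by (intro continuous_intros lipschitz_on_continuous_on)
  from continuous_attains_sup[OF compact_prob_simplex prob_simplex_nonempty this]
  obtain x where x: "x \<in> prob_simplex"
    and max: "\<And>y. y \<in> prob_simplex \<Longrightarrow> \<phi> y - \<psi> y + e * (norm y)\<^sup>2 \<le> \<phi> x - \<psi> x + e * (norm x)\<^sup>2"
    by blast
  have "\<phi> x \<le> avg_value G x"
    by (rule dual_subsolution_le_at_max[OF \<phi>(3) \<psi>(1,2) x \<open>e > 0\<close> max])
  moreover have "swap_fun \<psi> (swap_vec x) \<le> avg_value (swap_game G) (swap_vec x)"
  proof (rule dual_subsolution_le_at_max[OF \<psi>(3) _ lipschitz_swap_fun[OF \<phi>(2)] _ \<open>e > 0\<close>])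
    show "K_concave (swap_fun \<phi>)" using \<phi>(1) by (simp add: K_concave_swap)
    fix y :: "real ^ ('l \<times> 'k)" assume "y \<in> prob_simplex"
    then show "swap_fun \<psi> y - swap_fun \<phi> y + e * (norm y)\<^sup>2
      \<le> swap_fun \<psi> (swap_vec x) - swap_fun \<phi> (swap_vec x) + e * (norm (swap_vec x))\<^sup>2"
      using max[of "swap_vec y"] by (simp add: swap_fun_def norm_swap_vec)
  qed (use x in simp)
  ultimately have "\<phi> x \<le> \<psi> x"
    by (simp add: avg_value_swap swap_fun_def)
  moreover have "e * (norm x)\<^sup>2 \<le> e"
    using norm_prob_simplex[OF x] \<open>e > 0\<close> by (simp add: power_le_one)
  moreover have "0 \<le> e * (norm \<pi>)\<^sup>2" using \<open>e > 0\<close> by simp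
  ultimately show "\<phi> \<pi> \<le> \<psi> \<pi> + e"
    using max[OF \<pi>] by linarith
qed

section \<open>The space of controls\<close>

lemma controlsD:
  assumes "u \<in> controls"
  shows "u \<in> borel_measurable (lebesgue_on {0..1})" "s \<in> {0..1} \<Longrightarrow> u s \<in> prob_simplex"
    "s \<notin> {0..1} \<Longrightarrow> u s = undefined"
  using assms by (auto simp: controls_def PiE_def extensional_def)

lemma controlsI:
  assumes "u \<in> borel_measurable (lebesgue_on {0..1})" "\<And>s. s \<in> {0..1} \<Longrightarrow> u s \<in> prob_simplex"
    "\<And>s. s \<notin> {0..1} \<Longrightarrow> u s = undefined"
  shows "u \<in> controls"
  using assms by (auto simp: controls_def PiE_def extensional_def)

lemma finite_measure_unit: "finite_measure (lebesgue_on {0..1::real})"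
  by (intro finite_measureI) (simp add: emeasure_restrict_space)

lemma integrable_unit_bounded:
  fixes f :: "real \<Rightarrow> 'b::{banach, second_countable_topology}"
  assumes "f \<in> borel_measurable (lebesgue_on {0..1})" "\<And>s. s \<in> {0..1} \<Longrightarrow> norm (f s) \<le> B"
  shows "integrable (lebesgue_on {0..1}) f"
  using assms
  by (intro finite_measure.integrable_const_bound[OF finite_measure_unit, of _ B] AE_I2)
    (auto simp: space_restrict_space)

lemma measure_unit [simp]: "measure (lebesgue_on {0..1::real}) {0..1} = 1"
  by (simp add: measure_restrict_space)

lemma integral_unit_const [simp]: "(\<integral>s. c \<partial>lebesgue_on {0..1::real}) = (c::real)"
  by (simp add: space_restrict_space)

lemma norm_integral_le:
  fixes f :: "'a \<Rightarrow> 'b::{banach, second_countable_topology}"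
  assumes "integrable M f" "integrable M g" "\<And>x. x \<in> space M \<Longrightarrow> norm (f x) \<le> g x"
  shows "norm (\<integral>x. f x \<partial>M) \<le> (\<integral>x. g x \<partial>M)"
  using assms by (intro order_trans[OF integral_norm_bound] integral_mono) auto

lemma integral_unit_bound:
  fixes f :: "real \<Rightarrow> real"
  assumes "f \<in> borel_measurable (lebesgue_on {0..1})" "\<And>s. s \<in> {0..1} \<Longrightarrow> \<bar>f s\<bar> \<le> B"
  shows "\<bar>\<integral>s. f s \<partial>lebesgue_on {0..1}\<bar> \<le> B"
proof -
  have "norm (\<integral>s. f s \<partial>lebesgue_on {0..1}) \<le> (\<integral>s. B \<partial>lebesgue_on {0..1::real})"
  proof (rule norm_integral_le)
    show "integrable (lebesgue_on {0..1}) f"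
      using assms by (intro integrable_unit_bounded[of _ B]) auto
    show "integrable (lebesgue_on {0..1::real}) (\<lambda>_. B)"
      by (intro integrable_unit_bounded[of _ "\<bar>B\<bar>"]) auto
  qed (use assms in \<open>auto simp: space_restrict_space\<close>)
  then show ?thesis by (simp only: integral_unit_const real_norm_def)
qed

lemma integrable_control_diff:
  assumes "u \<in> controls" "u' \<in> controls"
  shows "integrable (lebesgue_on {0..1}) (\<lambda>s. norm (u s - u' s))"
proof (rule integrable_unit_bounded)
  show "(\<lambda>s. norm (u s - u' s)) \<in> borel_measurable (lebesgue_on {0..1})"
    using controlsD(1)[OF assms(1)] controlsD(1)[OF assms(2)] by measurable
  show "norm (norm (u s - u' s)) \<le> 2" if "s \<in> {0..1}" for s
    using norm_prob_simplex[OF controlsD(2)[OF assms(1) that]]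
      norm_prob_simplex[OF controlsD(2)[OF assms(2) that]] norm_triangle_ineq4[of "u s" "u' s"]
    by simp
qed

lemma space_control_space [simp]: "space control_space = controls"
  unfolding control_space_def by (rule space_measure_of) auto

section \<open>Measurability on the space of controls from Lipschitz estimates in
  \<open>L1\<close>\<close>

lemma sets_control_spaceI:
  assumes "S \<subseteq> controls" "\<And>u. u \<in> S \<Longrightarrow> \<exists>e>0. \<forall>u'\<in>controls. L1_dist u u' < e \<longrightarrow> u' \<in> S"
  shows "S \<in> sets control_space"
  unfolding control_space_def using assms by (subst sets_measure_of) auto

lemma measurable_control_spaceI:
  assumes "f \<in> space M \<rightarrow> controls"
    and "\<And>S. S \<subseteq> controls \<Longrightarrow> (\<And>u. u \<in> S \<Longrightarrow> \<exists>e>0. \<forall>u'\<in>controls. L1_dist u u' < e \<longrightarrow> u' \<in> S) \<Longrightarrow>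
      f -` S \<inter> space M \<in> sets M"
  shows "f \<in> M \<rightarrow>\<^sub>M control_space"
  unfolding control_space_def using assms by (intro measurable_measure_of) auto

text \<open>The preimage of a generator of the sigma-algebra is again a generator, with the radius
  divided by \<open>C\<close>.\<close>

lemma measurable_control_space_lipschitz:
  fixes f :: "(real \<Rightarrow> real ^ 'a::finite) \<Rightarrow> real \<Rightarrow> real ^ 'b::finite"
  assumes f: "\<And>u. u \<in> controls \<Longrightarrow> f u \<in> controls"
    and lip: "\<And>u u'. u \<in> controls \<Longrightarrow> u' \<in> controls \<Longrightarrow> L1_dist (f u) (f u') \<le> C * L1_dist u u'"
    and "C > 0"
  shows "f \<in> control_space \<rightarrow>\<^sub>M control_space"
proof (rule measurable_control_spaceI)
  fix S :: "(real \<Rightarrow> real ^ 'b) set"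
  assume S: "S \<subseteq> controls" "\<And>u. u \<in> S \<Longrightarrow> \<exists>e>0. \<forall>u'\<in>controls. L1_dist u u' < e \<longrightarrow> u' \<in> S"
  show "f -` S \<inter> space control_space \<in> sets control_space"
  proof (rule sets_control_spaceI)
    fix u assume u: "u \<in> f -` S \<inter> space control_space"
    then obtain e where "e > 0" and e: "\<And>u'. u' \<in> controls \<Longrightarrow> L1_dist (f u) u' < e \<Longrightarrow> u' \<in> S"
      using S(2)[of "f u"] by auto
    have "u' \<in> f -` S \<inter> space control_space" if "u' \<in> controls" "L1_dist u u' < e / C" for u'
    proof -
      have "L1_dist (f u) (f u') \<le> C * L1_dist u u'" using lip u that by simp
      also have "\<dots> < e" using that \<open>C > 0\<close> by (simp add: field_simps)
      finally show ?thesis using e f that by simp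
    qed
    then show "\<exists>e>0. \<forall>u'\<in>controls. L1_dist u u' < e \<longrightarrow> u' \<in> f -` S \<inter> space control_space"
      using \<open>e > 0\<close> \<open>C > 0\<close> by (intro exI[of _ "e / C"]) auto
  qed auto
qed (use f in auto)

lemma borel_measurable_control_space_lipschitz:
  fixes f :: "(real \<Rightarrow> real ^ 'a::finite) \<Rightarrow> 'b::metric_space"
  assumes lip: "\<And>u u'. u \<in> controls \<Longrightarrow> u' \<in> controls \<Longrightarrow> dist (f u) (f u') \<le> C * L1_dist u u'"
    and "C > 0"
  shows "f \<in> borel_measurable control_space"
proof (rule borel_measurableI)
  fix S :: "'b set" assume "open S"
  show "f -` S \<inter> space control_space \<in> sets control_space"
  proof (rule sets_control_spaceI)
    fix u assume u: "u \<in> f -` S \<inter> space control_space"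
    then obtain e where "e > 0" and e: "\<And>y. dist y (f u) < e \<Longrightarrow> y \<in> S"
      using \<open>open S\<close> unfolding open_dist by blast
    have "u' \<in> f -` S \<inter> space control_space" if "u' \<in> controls" "L1_dist u u' < e / C" for u'
    proof -
      have "dist (f u) (f u') \<le> C * L1_dist u u'" using lip u that by simp
      also have "\<dots> < e" using that \<open>C > 0\<close> by (simp add: field_simps)
      finally show ?thesis using e that by (simp add: dist_commute)
    qed
    then show "\<exists>e>0. \<forall>u'\<in>controls. L1_dist u u' < e \<longrightarrow> u' \<in> f -` S \<inter> space control_space"
      using \<open>e > 0\<close> \<open>C > 0\<close> by (intro exI[of _ "e / C"]) auto
  qed auto
qed

lemma integral_unit_diff_le_L1_dist:
  fixes f :: "real \<Rightarrow> real ^ 'a::finite \<Rightarrow> real"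
  assumes "u \<in> controls" "u' \<in> controls"
    and meas: "\<And>u. u \<in> controls \<Longrightarrow> integrable (lebesgue_on {0..1}) (\<lambda>s. f s (u s))"
    and le: "\<And>s x y. s \<in> {0..1} \<Longrightarrow> \<bar>f s x - f s y\<bar> \<le> C * norm (x - y)"
  shows "dist (\<integral>s. f s (u s) \<partial>lebesgue_on {0..1}) (\<integral>s. f s (u' s) \<partial>lebesgue_on {0..1})
    \<le> C * L1_dist u u'"
proof -
  have "dist (\<integral>s. f s (u s) \<partial>lebesgue_on {0..1}) (\<integral>s. f s (u' s) \<partial>lebesgue_on {0..1})
    = norm (\<integral>s. f s (u s) - f s (u' s) \<partial>lebesgue_on {0..1})"
    using meas assms(1,2) by (simp add: dist_norm)
  also have "\<dots> \<le> (\<integral>s. C * norm (u s - u' s) \<partial>lebesgue_on {0..1})"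
    using meas assms(1,2) le integrable_control_diff[OF assms(1,2)]
    by (intro norm_integral_le) (auto simp: space_restrict_space)
  finally show ?thesis by (simp add: L1_dist_def)
qed

text \<open>The parameters range over a countable type, which is the purpose. An index beyond the
  end of the list yields some fixed value, so that no condition linking \<open>n\<close> and
  \<open>qs\<close> has to be carried along.\<close>

definition rat_step :: "nat \<Rightarrow> rat list \<Rightarrow> real \<Rightarrow> real" where
  "rat_step n qs s = of_rat (qs ! nat \<lfloor>real n * s\<rfloor>)"

lemma rat_step_measurable [measurable]: "rat_step n qs \<in> borel_measurable borel"
proof -
  have "(\<lambda>s. \<lfloor>real n * s\<rfloor>) \<in> borel \<rightarrow>\<^sub>M count_space UNIV"
    by measurable
  then show ?thesis
    unfolding rat_step_def by measurable
qed

lemma rat_step_measurable_unit [measurable]: "rat_step n qs \<in> borel_measurable (lebesgue_on {0..1})"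
  by (intro measurable_restrict_space1 measurable_completion) simp

lemma rat_step_bounded: "\<exists>B>0. \<forall>s\<in>{0..1}. \<bar>rat_step n qs s\<bar> \<le> B"
proof (intro exI conjI ballI)
  let ?B = "Max ((\<lambda>c. \<bar>of_rat (qs ! c)\<bar> :: real) ` {..n}) + 1"
  have "0 \<le> Max ((\<lambda>c. \<bar>of_rat (qs ! c)\<bar> :: real) ` {..n})"
    by (rule order_trans[OF abs_ge_zero Max_ge[of _ "\<bar>of_rat (qs ! 0)\<bar>"]]) auto
  then show "0 < ?B" by simp
  fix s :: real assume "s \<in> {0..1}"
  then have "real n * s \<le> real n" by (simp add: mult_left_le)
  then have "nat \<lfloor>real n * s\<rfloor> \<le> n" by linarith
  then have "\<bar>rat_step n qs s\<bar> \<le> Max ((\<lambda>c. \<bar>of_rat (qs ! c)\<bar> :: real) ` {..n})"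
    unfolding rat_step_def by (intro Max_ge) auto
  then show "\<bar>rat_step n qs s\<bar> \<le> ?B" by simp
qed

lemma rat_step_dense_continuous:
  assumes "continuous_on {0..1} g" "e > 0"
  obtains n qs where "\<And>s. s \<in> {0..1} \<Longrightarrow> \<bar>g s - rat_step n qs s\<bar> < e"
proof -
  have "uniformly_continuous_on {0..1} g"
    using assms(1) by (intro compact_uniformly_continuous) auto
  then obtain d where "d > 0"
    and d: "\<And>s t. s \<in> {0..1} \<Longrightarrow> t \<in> {0..1} \<Longrightarrow> dist t s < d \<Longrightarrow> dist (g t) (g s) < e / 2"
    unfolding uniformly_continuous_on_def using assms(2) by (meson half_gt_zero)
  obtain n where n: "1 / real (Suc n) < d"
    using \<open>d > 0\<close> nat_approx_posE by metis
  define N where "N = Suc n"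
  have "\<exists>q. \<bar>g (real c / real N) - real_of_rat q\<bar> < e / 2" for c
  proof -
    obtain q where "g (real c / real N) - e / 2 < of_rat q" "of_rat q < g (real c / real N)"
      using of_rat_dense[of "g (real c / real N) - e / 2" "g (real c / real N)"] assms(2) by auto
    then show ?thesis by (intro exI[of _ q]) auto
  qed
  then obtain q where q: "\<And>c. \<bar>g (real c / real N) - real_of_rat (q c)\<bar> < e / 2" by metis
  show thesis
  \<comment> \<open>\<open>Suc N\<close> values for \<open>N\<close> cells: the end point
    \<open>s = 1\<close> falls into the cell with index \<open>N\<close>.\<close>
  proof (rule that[of N "map q [0..<Suc N]"])
    fix s :: real assume s: "s \<in> {0..1}"
    define c where "c = nat \<lfloor>real N * s\<rfloor>"
    have "real N * s \<le> real N" "0 \<le> real N * s" using s by (auto simp: mult_left_le)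
    then have c: "c \<le> N" "real c \<le> real N * s" "real N * s < real c + 1"
      unfolding c_def by linarith+
    have "N > 0" by (simp add: N_def)
    have "rat_step N (map q [0..<Suc N]) s = of_rat (q c)"
      unfolding rat_step_def c_def[symmetric] using c(1) by (simp del: upt_Suc)
    moreover have "dist (g s) (g (real c / real N)) < e / 2"
    proof (rule d)
      have "s < (real c + 1) / real N" "real c / real N \<le> s"
        using c \<open>N > 0\<close> by (simp_all add: pos_less_divide_eq pos_divide_le_eq mult.commute)
      then have "s - real c / real N < 1 / real N" "real c / real N \<le> s"
        by (simp_all add: add_divide_distrib)
      then show "dist s (real c / real N) < d" using n by (simp add: dist_real_def N_def)
      show "real c / real N \<in> {0..1}" using c(1) \<open>N > 0\<close> by simp
    qed (rule s)
    ultimately show "\<bar>g s - rat_step N (map q [0..<Suc N]) s\<bar> < e"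
      using q[of c] unfolding dist_real_def by linarith
  qed
qed

text \<open>A measurable function is an a.e. limit of continuous ones; dominated convergence turns
  this into a limit in \<open>L1\<close>, and each continuous function is uniformly close to a
  rational step function.\<close>

lemma rat_step_dense:
  assumes f: "f \<in> borel_measurable (lebesgue_on {0..1})" and bound: "\<And>s. s \<in> {0..1} \<Longrightarrow> \<bar>f s\<bar> \<le> 1"
    and "e > 0"
  obtains n qs where "(\<integral>s. \<bar>f s - rat_step n qs s\<bar> \<partial>lebesgue_on {0..1}) < e"
proof -
  have "f measurable_on {0..1}"
    using f by (subst measurable_on_iff_borel_measurable) auto
  then obtain N g where N: "negligible N" and cont: "\<And>n. continuous_on UNIV (g n)"
    and lim: "\<And>x. x \<notin> N \<Longrightarrow> (\<lambda>n. g n x) \<longlonglongrightarrow> (if x \<in> {0..1} then f x else 0)"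
    unfolding measurable_on_def by blast
  \<comment> \<open>Clipping to \<open>[-1, 1]\<close> leaves the limit unchanged, as
    \<open>f\<close> takes its values there, and supplies the dominating constant.\<close>
  define h where "h = (\<lambda>n x. max (-1) (min 1 (g n x)))"
  have cont_h: "continuous_on {0..1} (h n)" for n
    unfolding h_def by (intro continuous_intros continuous_on_subset[OF cont]) auto
  have meas_h [measurable]: "h n \<in> borel_measurable (lebesgue_on {0..1})" for n
    by (rule continuous_imp_measurable_on_sets_lebesgue[OF cont_h]) auto
  note f [measurable]
  have h_close: "\<bar>f s - h n s\<bar> \<le> 2" if "s \<in> {0..1}" for n s
    using bound[OF that] unfolding h_def by (simp add: abs_le_iff) linarith
  have "AE s in lebesgue. s \<notin> N"
    using N by (intro AE_not_in) (simp add: negligible_iff_null_sets)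
  then have "AE s in lebesgue. s \<in> {0..1} \<longrightarrow> (\<lambda>n. \<bar>f s - h n s\<bar>) \<longlonglongrightarrow> 0"
  proof eventually_elim
    case (elim s)
    show ?case
    proof
      assume s: "s \<in> {0..1}"
      then have "(\<lambda>n. g n s) \<longlonglongrightarrow> f s" using lim[OF elim] by simp
      then have "(\<lambda>n. \<bar>f s - h n s\<bar>) \<longlonglongrightarrow> \<bar>f s - max (-1) (min 1 (f s))\<bar>"
        unfolding h_def by (intro tendsto_intros)
      moreover have "max (-1) (min 1 (f s)) = f s" using bound[OF s] by (simp add: abs_le_iff)
      ultimately show "(\<lambda>n. \<bar>f s - h n s\<bar>) \<longlonglongrightarrow> 0" by simp
    qed
  qed
  then have "AE s in lebesgue_on {0..1}. (\<lambda>n. \<bar>f s - h n s\<bar>) \<longlonglongrightarrow> 0"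
    by (subst AE_restrict_space_iff) auto
  moreover have "AE s in lebesgue_on {0..1}. norm \<bar>f s - h n s\<bar> \<le> 2" for n
    using h_close by (intro AE_I2) (simp add: space_restrict_space)
  moreover have "integrable (lebesgue_on {0..1::real}) (\<lambda>_. 2::real)"
    by (intro integrable_unit_bounded[of _ 2]) auto
  ultimately have "(\<lambda>n. \<integral>s. \<bar>f s - h n s\<bar> \<partial>lebesgue_on {0..1}) \<longlonglongrightarrow> (\<integral>s. 0 \<partial>lebesgue_on {0..1::real})"
    by (intro integral_dominated_convergence[where w = "\<lambda>_. 2"]) auto
  then have "(\<lambda>n. \<integral>s. \<bar>f s - h n s\<bar> \<partial>lebesgue_on {0..1}) \<longlonglongrightarrow> 0" by simp
  then have "\<forall>\<^sub>F n in sequentially. (\<integral>s. \<bar>f s - h n s\<bar> \<partial>lebesgue_on {0..1}) < e / 2"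
    using \<open>e > 0\<close> by (intro order_tendstoD) auto
  then obtain k where k: "(\<integral>s. \<bar>f s - h k s\<bar> \<partial>lebesgue_on {0..1}) < e / 2"
    by (meson eventually_sequentially order_refl)
  obtain n qs where nq: "\<And>s. s \<in> {0..1} \<Longrightarrow> \<bar>h k s - rat_step n qs s\<bar> < e / 2"
    using rat_step_dense_continuous[OF cont_h[of k], of "e / 2"] \<open>e > 0\<close> by auto
  have "(\<integral>s. \<bar>f s - rat_step n qs s\<bar> \<partial>lebesgue_on {0..1})
    \<le> (\<integral>s. \<bar>f s - h k s\<bar> + e / 2 \<partial>lebesgue_on {0..1})"
  proof (rule integral_mono)
    obtain B where "\<And>s. s \<in> {0..1} \<Longrightarrow> \<bar>rat_step n qs s\<bar> \<le> B"
      using rat_step_bounded[of n qs] by blast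
    then have "\<bar>f s - rat_step n qs s\<bar> \<le> 1 + B" if "s \<in> {0..1}" for s
      using bound[OF that] abs_triangle_ineq4[of "f s" "rat_step n qs s"] that by force
    then show "integrable (lebesgue_on {0..1}) (\<lambda>s. \<bar>f s - rat_step n qs s\<bar>)"
      by (intro integrable_unit_bounded[of _ "1 + B"]) auto
    show "integrable (lebesgue_on {0..1}) (\<lambda>s. \<bar>f s - h k s\<bar> + e / 2)"
      using \<open>e > 0\<close> h_close by (intro integrable_unit_bounded[of _ "2 + e / 2"]) auto
    fix s assume "s \<in> space (lebesgue_on {0..1::real})"
    then have "\<bar>h k s - rat_step n qs s\<bar> < e / 2"
      by (intro nq) (simp add: space_restrict_space)
    then show "\<bar>f s - rat_step n qs s\<bar> \<le> \<bar>f s - h k s\<bar> + e / 2"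
      by linarith
  qed
  also have "\<dots> = (\<integral>s. \<bar>f s - h k s\<bar> \<partial>lebesgue_on {0..1}) + e / 2"
  proof -
    have "integrable (lebesgue_on {0..1}) (\<lambda>s. \<bar>f s - h k s\<bar>)"
      using h_close by (intro integrable_unit_bounded[of _ 2]) auto
    moreover have "integrable (lebesgue_on {0..1::real}) (\<lambda>_. e / 2)"
      by (intro integrable_unit_bounded[of _ "\<bar>e / 2\<bar>"]) auto
    ultimately show ?thesis by simp
  qed
  also have "\<dots> < e" using k by simp
  finally show thesis by (rule that)
qed

section \<open>Bilinear pairings of controls and running payoffs\<close>

lemma control_component_le_1: "u \<in> controls \<Longrightarrow> s \<in> {0..1} \<Longrightarrow> \<bar>u s $ i\<bar> \<le> 1"
  using prob_simplexD(1,2)[OF controlsD(2)] by fastforce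

lemma control_component_measurable:
  assumes "u \<in> controls"
  shows "(\<lambda>s. u s $ i) \<in> borel_measurable (lebesgue_on {0..1})"
  using controlsD(1)[OF assms] by (rule measurable_compose) simp

lemma integrable_component_pairing:
  assumes "u \<in> controls" "v \<in> controls"
  shows "integrable (lebesgue_on {0..1}) (\<lambda>s. u s $ i * v s $ j)"
proof (rule integrable_unit_bounded)
  note assms[THEN control_component_measurable, measurable]
  show "(\<lambda>s. u s $ i * v s $ j) \<in> borel_measurable (lebesgue_on {0..1})"
    by measurable
  show "norm (u s $ i * v s $ j) \<le> 1 * 1" if "s \<in> {0..1}" for s
    unfolding real_norm_def abs_mult
    by (intro mult_mono control_component_le_1 assms that) auto
qed

text \<open>The pairing is jointly measurable because the step functions with rational data form a
  countable dense family in \<open>L1\<close>, over which its sublevel sets are unions of rectangles.\<close>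

lemma measurable_component_pairing:
  "(\<lambda>(u, v). \<integral>s. u s $ i * v s $ j \<partial>lebesgue_on {0..1})
    \<in> borel_measurable (control_space \<Otimes>\<^sub>M control_space)"
proof -
  let ?F = "\<lambda>u v. \<integral>s. u s $ i * v s $ j \<partial>lebesgue_on {0..1}"
  let ?A = "\<lambda>u n qs. \<integral>s. rat_step n qs s * u s $ i \<partial>lebesgue_on {0..1}"
  let ?D = "\<lambda>v n qs. \<integral>s. \<bar>v s $ j - rat_step n qs s\<bar> \<partial>lebesgue_on {0..1}"
  have intA: "integrable (lebesgue_on {0..1}) (\<lambda>s. rat_step n qs s * u s $ i)" if "u \<in> controls" for u n qs
  proof -
    obtain B where "B > 0" and B: "\<And>s. s \<in> {0..1} \<Longrightarrow> \<bar>rat_step n qs s\<bar> \<le> B"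
      using rat_step_bounded[of n qs] by auto
    note control_component_measurable[OF that, measurable]
    have "\<bar>rat_step n qs s * u s $ i\<bar> \<le> B * 1" if "s \<in> {0..1}" for s
      unfolding abs_mult using B[OF that] control_component_le_1[OF \<open>u \<in> controls\<close> that] \<open>B > 0\<close>
      by (intro mult_mono) auto
    then show ?thesis
      by (intro integrable_unit_bounded[of _ "B * 1"]) auto
  qed
  have intD: "integrable (lebesgue_on {0..1}) (\<lambda>s. \<bar>v s $ j - rat_step n qs s\<bar>)" if "v \<in> controls" for v n qs
  proof -
    obtain B where "B > 0" and B: "\<And>s. s \<in> {0..1} \<Longrightarrow> \<bar>rat_step n qs s\<bar> \<le> B"
      using rat_step_bounded[of n qs] by auto
    note control_component_measurable[OF that, measurable]
    have "\<bar>v s $ j - rat_step n qs s\<bar> \<le> 1 + B" if "s \<in> {0..1}" for s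
      using B[OF that] control_component_le_1[OF \<open>v \<in> controls\<close> that, of j]
        abs_triangle_ineq4[of "v s $ j" "rat_step n qs s"] by linarith
    then show ?thesis
      by (intro integrable_unit_bounded[of _ "1 + B"]) auto
  qed
  have measA [measurable]: "(\<lambda>u. ?A u n qs) \<in> borel_measurable control_space" for n qs
  proof -
    obtain B where "B > 0" and B: "\<And>s. s \<in> {0..1} \<Longrightarrow> \<bar>rat_step n qs s\<bar> \<le> B"
      using rat_step_bounded[of n qs] by auto
    show ?thesis
    proof (rule borel_measurable_control_space_lipschitz[OF integral_unit_diff_le_L1_dist \<open>B > 0\<close>])
      fix s and x y :: "real ^ 'a" assume "s \<in> {0..1::real}"
      then have "\<bar>rat_step n qs s\<bar> * \<bar>x $ i - y $ i\<bar> \<le> B * norm (x - y)"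
        using component_le_norm_cart[of "x - y" i] B \<open>B > 0\<close> by (intro mult_mono) auto
      then show "\<bar>rat_step n qs s * x $ i - rat_step n qs s * y $ i\<bar> \<le> B * norm (x - y)"
        by (simp add: abs_mult flip: right_diff_distrib)
    qed (use intA in auto)
  qed
  have measD [measurable]: "(\<lambda>v. ?D v n qs) \<in> borel_measurable control_space" for n qs
  proof (rule borel_measurable_control_space_lipschitz[OF integral_unit_diff_le_L1_dist])
    fix s and x y :: "real ^ 'b"
    show "\<bar>\<bar>x $ j - rat_step n qs s\<bar> - \<bar>y $ j - rat_step n qs s\<bar>\<bar> \<le> 1 * norm (x - y)"
      using component_le_norm_cart[of "x - y" j] by simp
  qed (use intD in auto)
  \<comment> \<open>Replacing a component of \<open>v\<close> by a step function changes the pairing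
    by at most \<open>?D\<close>, uniformly in \<open>u\<close>, because the components of
    \<open>u\<close> are bounded by 1.\<close>
  have close: "\<bar>?F u v - ?A u n qs\<bar> \<le> ?D v n qs" if uv: "u \<in> controls" "v \<in> controls" for u v n qs
  proof -
    have "?F u v - ?A u n qs = (\<integral>s. u s $ i * v s $ j - rat_step n qs s * u s $ i \<partial>lebesgue_on {0..1})"
      using integrable_component_pairing[OF uv] intA[OF uv(1)] by simp
    also have "norm \<dots> \<le> ?D v n qs"
    proof (rule norm_integral_le)
      fix s assume "s \<in> space (lebesgue_on {0..1::real})"
      then have "\<bar>u s $ i\<bar> \<le> 1" using control_component_le_1[OF uv(1)] by (simp add: space_restrict_space)
      then have "\<bar>u s $ i\<bar> * \<bar>v s $ j - rat_step n qs s\<bar> \<le> 1 * \<bar>v s $ j - rat_step n qs s\<bar>"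
        by (intro mult_right_mono) auto
      then show "norm (u s $ i * v s $ j - rat_step n qs s * u s $ i) \<le> \<bar>v s $ j - rat_step n qs s\<bar>"
        by (simp add: abs_mult[symmetric] algebra_simps)
    qed (use integrable_component_pairing[OF uv] intA[OF uv(1)] intD[OF uv(2)] in auto)
    finally show ?thesis by simp
  qed
  have "{x \<in> space (control_space \<Otimes>\<^sub>M control_space). (case x of (u, v) \<Rightarrow> ?F u v) < c} =
    (\<Union>(n, qs, r)\<in>UNIV. {u \<in> space control_space. ?A u n qs < c - of_rat r} \<times>
      {v \<in> space control_space. ?D v n qs < of_rat r})" (is "?L = ?R") for c
  proof
    show "?R \<subseteq> ?L"
    proof (clarsimp simp: space_pair_measure)
      fix n qs r u v
      assume "u \<in> controls" "?A u n qs < c - of_rat r" "v \<in> controls" "?D v n qs < of_rat r"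
      then show "?F u v < c" using close[of u v n qs] by linarith
    qed
    show "?L \<subseteq> ?R"
    proof (clarsimp simp: space_pair_measure)
      fix u :: "real \<Rightarrow> real ^ 'a" and v :: "real \<Rightarrow> real ^ 'b"
      assume uv: "u \<in> controls" "v \<in> controls" and less: "?F u v < c"
      \<comment> \<open>Half of the gap, since the error \<open>of_rat r\<close> is spent twice: in
        the estimate of \<open>?A\<close> by the pairing and in the margin
        \<open>c - of_rat r\<close>.\<close>
      define e where "e = (c - ?F u v) / 2"
      have "e > 0" using less by (simp add: e_def)
      then obtain r where r: "0 < real_of_rat r" "real_of_rat r < e"
        using of_rat_dense by blast
      obtain n qs where nq: "?D v n qs < of_rat r"
        using rat_step_dense[OF control_component_measurable[OF uv(2)] control_component_le_1[OF uv(2)] r(1)]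
        by blast
      have "?A u n qs < c - of_rat r"
        using close[OF uv, of n qs] nq r unfolding e_def by (simp add: field_simps)
      with nq show "\<exists>n qs r. ?A u n qs < c - of_rat r \<and> ?D v n qs < of_rat r"
        by blast
    qed
  qed
  moreover have "?R c \<in> sets (control_space \<Otimes>\<^sub>M control_space)" for c
  proof -
    have "{u \<in> space control_space. ?A u n qs < c - of_rat r} \<in> sets control_space"
      "{v \<in> space control_space. ?D v n qs < of_rat r} \<in> sets control_space" for n qs r
      by measurable
    then show ?thesis
      unfolding case_prod_unfold by (intro sets.countable_UN'' pair_measureI) blast+
  qed
  ultimately show ?thesis
    by (intro borel_measurable_iff_less[THEN iffD2] allI) simp
qed

lemma inner_matrix_vector: "x \<bullet> (A *v y) = (\<Sum>i\<in>UNIV. \<Sum>j\<in>UNIV. A $ i $ j * (x $ i * y $ j))"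
  by (simp add: inner_vec_def matrix_vector_mult_def sum_distrib_left mult_ac)

lemma integrable_running_payoff:
  assumes "u \<in> controls" "v \<in> controls"
  shows "integrable (lebesgue_on {0..1}) (\<lambda>s. u s \<bullet> (A *v v s))"
  unfolding inner_matrix_vector using integrable_component_pairing[OF assms] by auto

lemma running_payoff_eq_sum:
  assumes "u \<in> controls" "v \<in> controls"
  shows "running_payoff A (u, v) =
    (\<Sum>i\<in>UNIV. \<Sum>j\<in>UNIV. A $ i $ j * (\<integral>s. u s $ i * v s $ j \<partial>lebesgue_on {0..1}))"
  unfolding running_payoff_def inner_matrix_vector
  using integrable_component_pairing[OF assms] by simp

lemma running_payoff_measurable [measurable]:
  "running_payoff A \<in> borel_measurable (control_space \<Otimes>\<^sub>M control_space)"
proof (subst measurable_cong)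
  show "running_payoff A w = (\<Sum>i\<in>UNIV. \<Sum>j\<in>UNIV. A $ i $ j *
      (case w of (u, v) \<Rightarrow> \<integral>s. u s $ i * v s $ j \<partial>lebesgue_on {0..1}))"
    if "w \<in> space (control_space \<Otimes>\<^sub>M control_space)" for w
    using that running_payoff_eq_sum by (auto simp: space_pair_measure)
qed (intro borel_measurable_sum borel_measurable_times borel_measurable_const
      measurable_component_pairing)

definition matrix_bound :: "real ^ 'j::finite ^ 'i::finite \<Rightarrow> real" where
  "matrix_bound A = (\<Sum>i\<in>UNIV. \<Sum>j\<in>UNIV. \<bar>A $ i $ j\<bar>)"

lemma running_payoff_bound:
  assumes "u \<in> controls" "v \<in> controls"
  shows "\<bar>running_payoff A (u, v)\<bar> \<le> matrix_bound A"
proof -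
  have "\<bar>u s \<bullet> (A *v v s)\<bar> \<le> matrix_bound A" if "s \<in> {0..1}" for s
  proof -
    have "\<bar>A $ i $ j * (u s $ i * v s $ j)\<bar> \<le> \<bar>A $ i $ j\<bar> * (1 * 1)" for i j
      unfolding abs_mult using control_component_le_1[OF assms(1) that] control_component_le_1[OF assms(2) that]
      by (intro mult_left_mono mult_mono) auto
    then show ?thesis
      unfolding inner_matrix_vector matrix_bound_def
      by (intro order_trans[OF sum_abs] sum_mono) simp
  qed
  then show ?thesis
    unfolding running_payoff_def
    using integral_unit_bound[of "\<lambda>s. u s \<bullet> (A *v v s)"] integrable_running_payoff[OF assms, of A]
    by (simp add: borel_measurable_integrable)
qed

section \<open>Strategies with delay and induced controls\<close>

text \<open>The interval stands inside the almost everywhere quantifier, so that agreement up to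
  different times, also after an affine change of time, is stated over one measure.\<close>

definition eq_upto :: "real \<Rightarrow> (real \<Rightarrow> 'a) \<Rightarrow> (real \<Rightarrow> 'a) \<Rightarrow> bool" where
  "eq_upto t u v \<longleftrightarrow> (AE s in lebesgue. s \<in> {0..t} \<longrightarrow> u s = v s)"

lemma AE_lebesgue_on_iff_eq_upto: "(AE s in lebesgue_on {0..t}. u s = v s) \<longleftrightarrow> eq_upto t u v"
  unfolding eq_upto_def by (subst AE_restrict_space_iff) auto

lemma eq_upto_refl [simp]: "eq_upto t u u"
  by (simp add: eq_upto_def)

lemma eq_upto_sym: "eq_upto t u v \<Longrightarrow> eq_upto t v u"
  unfolding eq_upto_def by (auto elim!: eventually_mono)

lemma eq_upto_trans [trans]: "eq_upto t u v \<Longrightarrow> eq_upto t v w \<Longrightarrow> eq_upto t u w"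
proof -
  assume "eq_upto t u v" "eq_upto t v w"
  then show ?thesis unfolding eq_upto_def by eventually_elim auto
qed

lemma eq_upto_mono: "eq_upto t u v \<Longrightarrow> t' \<le> t \<Longrightarrow> eq_upto t' u v"
  unfolding eq_upto_def by (auto elim!: eventually_mono)

lemma eq_upto_0: "eq_upto 0 u v"
proof -
  have "AE s in lebesgue. s \<noteq> (0::real)"
    using AE_not_in[of "{0::real}" lebesgue] by simp
  then show ?thesis
    unfolding eq_upto_def by eventually_elim auto
qed

text \<open>Information gained between consecutive points of \<open>S\<close> has no influence before the later of the
  two. In contrast to an increasing grid, the finite set \<open>S\<close> can be enlarged freely.\<close>

definition delayed ::
  "real set \<Rightarrow> ((real \<Rightarrow> real ^ 'b::finite) \<Rightarrow> real \<Rightarrow> real ^ 'a::finite) \<Rightarrow> bool" where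
  "delayed S f \<longleftrightarrow>
     (\<forall>x y. \<forall>v1\<in>controls. \<forall>v2\<in>controls.
        0 \<le> x \<and> x < y \<and> y \<le> 1 \<and> S \<inter> {x<..<y} = {} \<and> eq_upto x v1 v2 \<longrightarrow>
        eq_upto y (f v1) (f v2))"

lemma delayedD:
  assumes "delayed S f" "v1 \<in> controls" "v2 \<in> controls" "0 \<le> x" "x < y" "y \<le> 1"
    "S \<inter> {x<..<y} = {}" "eq_upto x v1 v2"
  shows "eq_upto y (f v1) (f v2)"
  using assms unfolding delayed_def by blast

lemma delayed_mono: "delayed S f \<Longrightarrow> S \<subseteq> T \<Longrightarrow> delayed T f"
  unfolding delayed_def by blast

definition grid :: "real set \<Rightarrow> nat \<Rightarrow> (nat \<Rightarrow> real) \<Rightarrow> bool" where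
  "grid S N s \<longleftrightarrow> s 0 = 0 \<and> s N = 1 \<and> (\<forall>n\<le>N. 0 \<le> s n \<and> s n \<le> 1) \<and>
     (\<forall>n<N. s n < s (Suc n) \<and> S \<inter> {s n<..<s (Suc n)} = {})"

lemma gridD:
  assumes "grid S N s"
  shows "s 0 = 0" "s N = 1" "\<And>n. n < N \<Longrightarrow> s n < s (Suc n)"
    "\<And>n. n < N \<Longrightarrow> S \<inter> {s n<..<s (Suc n)} = {}" "\<And>n. n \<le> N \<Longrightarrow> 0 \<le> s n \<and> s n \<le> 1"
  using assms by (simp_all add: grid_def)

lemma finite_grid:
  fixes S :: "real set"
  assumes "finite S"
  shows "\<exists>N s. grid S N s"
proof -
  define T where "T = insert 0 (insert 1 (S \<inter> {0..1}))"
  have T: "finite T" "0 \<in> T" "1 \<in> T" "T \<subseteq> {0..1}" using assms by (auto simp: T_def)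
  define xs where "xs = sorted_list_of_set T"
  have xs: "set xs = T" "sorted_wrt (<) xs" "length xs = card T"
    using T(1) by (auto simp: xs_def strict_sorted_list_of_set)
  have less: "xs ! i < xs ! j" if "i < j" "j < length xs" for i j
    using sorted_wrt_nth_less[OF xs(2)] that by blast
  have in01: "xs ! i \<in> {0..1}" if "i < length xs" for i
    using T(4) xs(1) nth_mem[OF that] by blast
  obtain i0 where i0: "i0 < length xs" "xs ! i0 = 0" using T(2) xs(1) by (metis in_set_conv_nth)
  obtain i1 where i1: "i1 < length xs" "xs ! i1 = 1" using T(3) xs(1) by (metis in_set_conv_nth)
  have "i0 = 0"
  proof (rule ccontr)
    assume "i0 \<noteq> 0"
    then show False using less[of 0 i0] i0 in01[of 0] by fastforce
  qed
  have "i1 = length xs - 1"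
  proof (rule ccontr)
    assume "i1 \<noteq> length xs - 1"
    then show False using less[of i1 "length xs - 1"] i1 in01[of "length xs - 1"] by fastforce
  qed
  have "grid S (length xs - 1) ((!) xs)"
    unfolding grid_def
  proof (intro conjI allI impI)
    show "xs ! 0 = 0" "xs ! (length xs - 1) = 1"
      using i0 i1 \<open>i0 = 0\<close> \<open>i1 = length xs - 1\<close> by auto
    show "xs ! n < xs ! Suc n" if "n < length xs - 1" for n using less that by simp
    show "0 \<le> xs ! n" "xs ! n \<le> 1" if "n \<le> length xs - 1" for n
      using in01[of n] that i0(1) by simp_all
    show "S \<inter> {xs ! n<..<xs ! Suc n} = {}" if n: "n < length xs - 1" for n
    proof (rule ccontr)
      assume "S \<inter> {xs ! n<..<xs ! Suc n} \<noteq> {}"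
      then obtain z where z: "z \<in> S" "xs ! n < z" "z < xs ! Suc n" by auto
      moreover have "z \<in> {0..1}" using z in01[of n] in01[of "Suc n"] n by fastforce
      ultimately have "z \<in> set xs" by (simp add: xs T_def)
      then obtain k where k: "k < length xs" "xs ! k = z" by (metis in_set_conv_nth)
      have "k \<noteq> n" "k \<noteq> Suc n" using z k by auto
      moreover have "\<not> k < n" using less[of k n] z k n by force
      moreover have "\<not> Suc n < k" using less[of "Suc n" k] z k by force
      ultimately show False by linarith
    qed
  qed
  then show ?thesis by blast
qed

text \<open>With \<open>x\<close> the last point of \<open>S\<close> before \<open>t\<close>, or
  \<open>0\<close> if there is none, the gap between \<open>x\<close> and \<open>t\<close> is free
  of \<open>S\<close>, and agreement up to \<open>x\<close> already determines the output up to
  \<open>t\<close>.\<close>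

lemma delayed_nonanticipative:
  assumes "finite S" "delayed S f" "v1 \<in> controls" "v2 \<in> controls" "0 \<le> t" "t \<le> 1" "eq_upto t v1 v2"
  shows "eq_upto t (f v1) (f v2)"
proof (cases "t = 0")
  case False
  define x where "x = Max (insert 0 (S \<inter> {0<..<t}))"
  have fin: "finite (insert 0 (S \<inter> {0<..<t}))" using assms(1) by simp
  have "x \<in> insert 0 (S \<inter> {0<..<t})" unfolding x_def by (intro Max_in fin) simp
  then have x: "0 \<le> x" "x < t" using False assms(5) by auto
  have "S \<inter> {x<..<t} = {}"
  proof (rule ccontr)
    assume "S \<inter> {x<..<t} \<noteq> {}"
    then obtain z where z: "z \<in> S" "x < z" "z < t" by auto
    then have "z \<le> x" using x(1) unfolding x_def by (intro Max_ge[OF fin]) auto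
    then show False using z by simp
  qed
  then show ?thesis
    using delayedD[OF assms(2,3,4) x assms(6)] eq_upto_mono[OF assms(7)] x by simp
qed (simp add: eq_upto_0)

text \<open>A grid is obtained from \<open>S\<close> by sorting its points in \<open>[0, 1]\<close>
  together with the end points, and \<open>S\<close> from a grid as the set of its points. In both
  cases the set is common to all \<open>\<omega>\<close>.\<close>

lemma random_strategies_iff:
  fixes \<alpha> :: "(nat \<Rightarrow> real) \<Rightarrow> (real \<Rightarrow> real ^ 'b::finite) \<Rightarrow> real \<Rightarrow> real ^ 'a::finite"
  shows "(m, \<alpha>) \<in> random_strategies \<longleftrightarrow>
     1 \<le> m \<and> (\<lambda>(\<omega>, v). \<alpha> \<omega> v) \<in> cube m \<Otimes>\<^sub>M control_space \<rightarrow>\<^sub>M control_space \<and>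
     (\<exists>S. finite S \<and> (\<forall>\<omega>\<in>space (cube m). delayed S (\<alpha> \<omega>)))"
proof -
  define gridded where "gridded = (\<lambda>N s. s 0 = (0::real) \<and> s N = 1 \<and> (\<forall>n<N. s n < s (Suc n)) \<and>
           (\<forall>n<N. \<forall>\<omega>\<in>space (cube m). \<forall>v1\<in>controls. \<forall>v2\<in>controls.
              eq_upto (s n) v1 v2 \<longrightarrow> eq_upto (s (Suc n)) (\<alpha> \<omega> v1) (\<alpha> \<omega> v2)))"
  have "\<exists>N s. gridded N s" if S: "finite S" "\<And>\<omega>. \<omega> \<in> space (cube m) \<Longrightarrow> delayed S (\<alpha> \<omega>)" for S
  proof -
    obtain N s where "grid S N s"
      using finite_grid[OF S(1)] by blast
  note s = gridD[OF this]
    have "gridded N s"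
      unfolding gridded_def
    proof (intro conjI allI impI ballI)
      fix n \<omega> and v1 v2 :: "real \<Rightarrow> real ^ 'b"
      assume a: "n < N" "\<omega> \<in> space (cube m)" "v1 \<in> controls" "v2 \<in> controls" "eq_upto (s n) v1 v2"
      show "eq_upto (s (Suc n)) (\<alpha> \<omega> v1) (\<alpha> \<omega> v2)"
        using a s(5)[of n] s(5)[of "Suc n"]
        by (intro delayedD[OF S(2)[OF a(2)] a(3,4) _ s(3) _ s(4) a(5)]) auto
    qed (use s in auto)
    then show ?thesis by blast
  qed
  moreover have "\<exists>S. finite S \<and> (\<forall>\<omega>\<in>space (cube m). delayed S (\<alpha> \<omega>))" if "gridded N s" for N s
  proof -
    have s: "s 0 = 0" "s N = 1" and D: "\<And>n \<omega> v1 v2. n < N \<Longrightarrow> \<omega> \<in> space (cube m) \<Longrightarrow>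
        v1 \<in> controls \<Longrightarrow> v2 \<in> controls \<Longrightarrow>
        eq_upto (s n) v1 v2 \<Longrightarrow> eq_upto (s (Suc n)) (\<alpha> \<omega> v1) (\<alpha> \<omega> v2)"
      using that unfolding gridded_def by auto
    have "delayed (s ` {..N}) (\<alpha> \<omega>)" if \<omega>: "\<omega> \<in> space (cube m)" for \<omega>
      unfolding delayed_def
    proof (intro allI ballI impI, elim conjE)
      fix x y and v1 v2 :: "real \<Rightarrow> real ^ 'b"
      assume v: "v1 \<in> controls" "v2 \<in> controls" and xy: "0 \<le> x" "x < y" "y \<le> 1"
        "s ` {..N} \<inter> {x<..<y} = {}" and eq: "eq_upto x v1 v2"
      \<comment> \<open>The first grid time after \<open>x\<close>: its predecessor is at most
        \<open>x\<close>, and \<open>y\<close> does not exceed it because the gap contains no grid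
        time.\<close>
      define n where "n = (LEAST n. x < s n)"
      have "x < s N" using xy s(2) by simp
      then have n: "x < s n" "n \<le> N" unfolding n_def by (rule LeastI, rule Least_le)
      then obtain k where k: "n = Suc k" using s(1) xy(1) by (cases n) auto
      have "\<not> x < s k" using not_less_Least[of k "\<lambda>n. x < s n"] k unfolding n_def by simp
      then have "eq_upto (s k) v1 v2" by (intro eq_upto_mono[OF eq]) simp
      then have "eq_upto (s n) (\<alpha> \<omega> v1) (\<alpha> \<omega> v2)" using D \<omega> v k n by simp
      moreover have "s n \<notin> {x<..<y}" using xy(4) n(2) by blast
      then have "y \<le> s n" using n(1) by simp
      ultimately show "eq_upto y (\<alpha> \<omega> v1) (\<alpha> \<omega> v2)" by (rule eq_upto_mono)
    qed
    then show ?thesis by blast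
  qed
  moreover have "(m, \<alpha>) \<in> random_strategies \<longleftrightarrow> 1 \<le> m \<and>
      (\<lambda>(\<omega>, v). \<alpha> \<omega> v) \<in> cube m \<Otimes>\<^sub>M control_space \<rightarrow>\<^sub>M control_space \<and> (\<exists>N s. gridded N s)"
  proof -
    have "gridded N s \<longleftrightarrow> s 0 = 0 \<and> s N = 1 \<and> (\<forall>n<N. s n < s (Suc n)) \<and>
           (\<forall>n<N. \<forall>\<omega>\<in>space (cube m). \<forall>v1\<in>controls. \<forall>v2\<in>controls.
              (AE t in lebesgue_on {s 0..s n}. v1 t = v2 t) \<longrightarrow>
              (AE t in lebesgue_on {s 0..s (Suc n)}. \<alpha> \<omega> v1 t = \<alpha> \<omega> v2 t))" for N s
    proof (cases "s 0 = 0")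
      case True
      then show ?thesis
        unfolding gridded_def AE_lebesgue_on_iff_eq_upto[symmetric] True by simp
    qed (simp add: gridded_def)
    then show ?thesis
      unfolding random_strategies_def by simp
  qed
  ultimately show ?thesis by blast
qed

lemma random_strategiesD:
  assumes "\<alpha> \<in> random_strategies"
  shows "1 \<le> fst \<alpha>" "(\<lambda>(\<omega>, v). snd \<alpha> \<omega> v) \<in> cube (fst \<alpha>) \<Otimes>\<^sub>M control_space \<rightarrow>\<^sub>M control_space"
    "\<exists>S. finite S \<and> (\<forall>\<omega>\<in>space (cube (fst \<alpha>)). delayed S (snd \<alpha> \<omega>))"
  using assms by (cases \<alpha>; simp add: random_strategies_iff)+

lemma strategy_in_controls:
  assumes "\<alpha> \<in> random_strategies" "\<omega> \<in> space (cube (fst \<alpha>))" "v \<in> controls"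
  shows "snd \<alpha> \<omega> v \<in> controls"
  using measurable_space[OF random_strategiesD(2)[OF assms(1)], of "(\<omega>, v)"] assms(2,3)
  by (simp add: space_pair_measure)

section \<open>Induced controls as fixed points of the composed strategies\<close>

lemma delayed_comp:
  fixes a :: "(real \<Rightarrow> real ^ 'j::finite) \<Rightarrow> real \<Rightarrow> real ^ 'i::finite"
    and b :: "(real \<Rightarrow> real ^ 'i) \<Rightarrow> real \<Rightarrow> real ^ 'm::finite"
  assumes "delayed S a" "finite T" "delayed T b" "a ` controls \<subseteq> controls"
  shows "delayed S (\<lambda>v. b (a v))"
  unfolding delayed_def
proof (intro allI ballI impI, elim conjE)
  fix x y and v1 v2 :: "real \<Rightarrow> real ^ 'j"
  assume v: "v1 \<in> controls" "v2 \<in> controls" and xy: "0 \<le> x" "x < y" "y \<le> 1"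
    "S \<inter> {x<..<y} = {}" "eq_upto x v1 v2"
  have "eq_upto y (a v1) (a v2)" by (rule delayedD[OF assms(1) v xy])
  then show "eq_upto y (b (a v1)) (b (a v2))"
    using assms(4) v xy by (intro delayed_nonanticipative[OF assms(2,3)]) auto
qed

text \<open>Each application of \<open>c\<close> extends the agreement of consecutive iterates by
  one grid cell. \<open>N\<close> counts the cells and thus depends on \<open>S\<close> alone,
  neither on \<open>c\<close> nor on \<open>v\<close>; the measurability of the induced payoff in
  the random events rests on this uniformity.\<close>

lemma delayed_iterate_stabilizes:
  assumes "finite S"
  shows "\<exists>N. \<forall>(c :: (real \<Rightarrow> real ^ 'a::finite) \<Rightarrow> real \<Rightarrow> real ^ 'a) v.
    delayed S c \<and> c ` controls \<subseteq> controls \<and> v \<in> controls \<longrightarrow>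
    eq_upto 1 (c ((c ^^ N) v)) ((c ^^ N) v)"
proof -
  obtain N s where "grid S N s"
    using finite_grid[OF assms] by blast
  note s = gridD[OF this]
  show ?thesis
  proof (intro exI[of _ N] allI impI, elim conjE)
    fix c :: "(real \<Rightarrow> real ^ 'a) \<Rightarrow> real \<Rightarrow> real ^ 'a" and v :: "real \<Rightarrow> real ^ 'a"
    assume c: "delayed S c" "c ` controls \<subseteq> controls" and v: "v \<in> controls"
    have in_controls: "(c ^^ n) v \<in> controls" for n
      by (induction n) (use c v in auto)
    have "n \<le> N \<Longrightarrow> eq_upto (s n) ((c ^^ Suc n) v) ((c ^^ n) v)" for n
    proof (induction n)
      case 0
      then show ?case using s(1) by (simp add: eq_upto_0)
    next
      case (Suc n)
      then show ?case
        using delayedD[OF c(1) in_controls in_controls, of "s n" "s (Suc n)" "Suc n" n]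
          s(3)[of n] s(4)[of n] s(5)[of n] s(5)[of "Suc n"] by simp
    qed
    from this[of N] show "eq_upto 1 (c ((c ^^ N) v)) ((c ^^ N) v)" using s(2) by simp
  qed
qed

lemma delayed_fixpoint_unique:
  assumes "finite S" "delayed S c" "v \<in> controls" "v' \<in> controls"
    and eq: "eq_upto 1 (c v) v" "eq_upto 1 (c v') v'"
  shows "eq_upto 1 v v'"
proof -
  obtain N s where "grid S N s"
    using finite_grid[OF assms(1)] by blast
  note s = gridD[OF this]
  have "n \<le> N \<Longrightarrow> eq_upto (s n) v v'" for n
  proof (induction n)
    case 0
    then show ?case using s(1) by (simp add: eq_upto_0)
  next
    case (Suc n)
    have *: "s (Suc n) \<le> 1" using s(5)[OF Suc.prems] by simp
    have "eq_upto (s (Suc n)) v (c v)" using eq_upto_mono[OF eq_upto_sym[OF eq(1)] *] .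
    also have "eq_upto (s (Suc n)) (c v) (c v')"
      using Suc s(3)[of n] s(4)[of n] s(5)[of n] * by (intro delayedD[OF assms(2-4), of "s n"]) auto
    also have "eq_upto (s (Suc n)) (c v') v'" using eq_upto_mono[OF eq(2) *] .
    finally show ?case .
  qed
  from this[of N] show ?thesis using s(2) by simp
qed

definition const_control :: "real ^ 'a \<Rightarrow> real \<Rightarrow> real ^ 'a::finite" where
  "const_control b = (\<lambda>s. if s \<in> {0..1} then b else undefined)"

lemma const_control_in_controls: "b \<in> prob_simplex \<Longrightarrow> const_control b \<in> controls"
proof (intro controlsI)
  show "const_control b \<in> borel_measurable (lebesgue_on {0..1})"
    by (subst measurable_cong[where g = "\<lambda>_. b"]) (auto simp: space_restrict_space const_control_def)
qed (auto simp: const_control_def)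

text \<open>The property behind the choice in \<open>induced_controls\<close>. A payoff may be
  computed from any pair that satisfies it, see \<open>running_payoff_induced\<close>.\<close>

definition plays_induce ::
  "((real \<Rightarrow> real ^ 'j) \<Rightarrow> real \<Rightarrow> real ^ 'i) \<Rightarrow> ((real \<Rightarrow> real ^ 'i) \<Rightarrow> real \<Rightarrow> real ^ 'j) \<Rightarrow>
   (real \<Rightarrow> real ^ 'i::finite) \<Rightarrow> (real \<Rightarrow> real ^ 'j::finite) \<Rightarrow> bool" where
  "plays_induce a b u v \<longleftrightarrow>
     u \<in> controls \<and> v \<in> controls \<and> eq_upto 1 (a v) u \<and> eq_upto 1 (b u) v"

lemma plays_induce_swap: "plays_induce a b u v \<longleftrightarrow> plays_induce b a v u"
  by (auto simp: plays_induce_def)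

lemma plays_induce_unique:
  assumes "finite S" "delayed S a" "finite T" "delayed T b"
    "a ` controls \<subseteq> controls" "b ` controls \<subseteq> controls"
    "plays_induce a b u v" "plays_induce a b u' v'"
  shows "eq_upto 1 u u' \<and> eq_upto 1 v v'"
proof -
  have fixpoint: "eq_upto 1 (b (a v)) v" if "plays_induce a b u v" for u v
  proof -
    have uv: "u \<in> controls" "v \<in> controls" "eq_upto 1 (a v) u" "eq_upto 1 (b u) v"
      using that by (auto simp: plays_induce_def)
    have "eq_upto 1 (b (a v)) (b u)"
      using uv assms(5) by (intro delayed_nonanticipative[OF assms(3,4)]) auto
    then show ?thesis using uv(4) by (rule eq_upto_trans)
  qed
  have uv: "v \<in> controls" "v' \<in> controls" "eq_upto 1 u (a v)" "eq_upto 1 (a v') u'"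
    using assms(7,8) by (auto simp: plays_induce_def eq_upto_sym)
  have v: "eq_upto 1 v v'"
    by (rule delayed_fixpoint_unique[OF assms(1) delayed_comp[OF assms(2,3,4,5)] uv(1,2)
          fixpoint[OF assms(7)] fixpoint[OF assms(8)]])
  have "eq_upto 1 (a v) (a v')"
    using v uv by (intro delayed_nonanticipative[OF assms(1,2)]) auto
  then have "eq_upto 1 u u'"
    by (rule eq_upto_trans[OF eq_upto_trans[OF uv(3)] uv(4)])
  with v show ?thesis by simp
qed

lemma plays_induce_exists:
  fixes S T :: "real set"
  assumes "finite S" "finite T"
  shows "\<exists>N. \<forall>(a :: (real \<Rightarrow> real ^ 'j) \<Rightarrow> real \<Rightarrow> real ^ 'i)
      (b :: (real \<Rightarrow> real ^ 'i::finite) \<Rightarrow> real \<Rightarrow> real ^ 'j::finite) v.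
    delayed S a \<and> delayed T b \<and> a ` controls \<subseteq> controls \<and> b ` controls \<subseteq> controls \<and> v \<in> controls \<longrightarrow>
    plays_induce a b (a (((\<lambda>v. b (a v)) ^^ N) v)) (((\<lambda>v. b (a v)) ^^ N) v)"
proof -
  obtain N where N: "\<And>(c :: (real \<Rightarrow> real ^ 'j) \<Rightarrow> real \<Rightarrow> real ^ 'j) v. delayed S c \<Longrightarrow>
    c ` controls \<subseteq> controls \<Longrightarrow> v \<in> controls \<Longrightarrow> eq_upto 1 (c ((c ^^ N) v)) ((c ^^ N) v)"
    using delayed_iterate_stabilizes[OF assms(1)] by blast
  show ?thesis
  proof (intro exI[of _ N] allI impI, elim conjE)
    fix a :: "(real \<Rightarrow> real ^ 'j) \<Rightarrow> real \<Rightarrow> real ^ 'i"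
      and b :: "(real \<Rightarrow> real ^ 'i) \<Rightarrow> real \<Rightarrow> real ^ 'j" and v :: "real \<Rightarrow> real ^ 'j"
    assume a: "delayed S a" and b: "delayed T b"
      and maps: "a ` controls \<subseteq> controls" "b ` controls \<subseteq> controls" and v: "v \<in> controls"
    let ?c = "\<lambda>v. b (a v)"
    have c: "?c ` controls \<subseteq> controls" using maps by auto
    have "(?c ^^ n) v \<in> controls" for n
      by (induction n) (use c v in auto)
    then show "plays_induce a b (a ((?c ^^ N) v)) ((?c ^^ N) v)"
      using N[OF delayed_comp[OF a assms(2) b maps(1)] c v] maps by (auto simp: plays_induce_def)
  qed
qed

lemma induced_controls_plays_induce:
  assumes "finite S" "delayed S a" "finite T" "delayed T b"
    "a ` controls \<subseteq> controls" "b ` controls \<subseteq> controls"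
  shows "case induced_controls a b of (u, v) \<Rightarrow> plays_induce a b u v"
proof -
  have "\<exists>u v. plays_induce a b u v"
    using plays_induce_exists[OF assms(1,3)] assms(2,4-6)
      const_control_in_controls[OF axis_in_prob_simplex] by blast
  then have "\<exists>x. case x of (u, v) \<Rightarrow> plays_induce a b u v"
    by auto
  from someI_ex[OF this] show ?thesis
    unfolding induced_controls_def plays_induce_def AE_lebesgue_on_iff_eq_upto .
qed

lemma running_payoff_cong:
  assumes "u \<in> controls" "v \<in> controls" "u' \<in> controls" "v' \<in> controls"
    "eq_upto 1 u u'" "eq_upto 1 v v'"
  shows "running_payoff A (u, v) = running_payoff A (u', v')"
  unfolding running_payoff_def prod.case
proof (rule integral_cong_AE)
  have "AE s in lebesgue_on {0..1}. u s = u' s" "AE s in lebesgue_on {0..1}. v s = v' s"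
    using assms(5,6) by (simp_all add: AE_lebesgue_on_iff_eq_upto)
  then show "AE s in lebesgue_on {0..1}. u s \<bullet> (A *v v s) = u' s \<bullet> (A *v v' s)"
    by eventually_elim simp
qed (use integrable_running_payoff assms in \<open>blast dest: borel_measurable_integrable\<close>)+

lemma running_payoff_induced:
  assumes "finite S" "delayed S a" "finite T" "delayed T b"
    "a ` controls \<subseteq> controls" "b ` controls \<subseteq> controls" "plays_induce a b u v"
  shows "running_payoff A (induced_controls a b) = running_payoff A (u, v)"
proof -
  obtain u' v' where eq: "induced_controls a b = (u', v')" by fastforce
  then have *: "plays_induce a b u' v'"
    using induced_controls_plays_induce[OF assms(1-6)] by simp
  then show ?thesis
    unfolding eq using plays_induce_unique[OF assms(1-6) * assms(7)] assms(7)
    by (intro running_payoff_cong) (auto simp: plays_induce_def)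
qed

section \<open>Expected payoffs\<close>

lemma prob_space_cube: "prob_space (cube m)"
proof -
  have "prob_space (restrict_space lborel {0..1::real})"
    by (intro prob_spaceI) (simp add: emeasure_restrict_space space_restrict_space)
  then show ?thesis
    unfolding cube_def by (intro prob_space_PiM)
qed

definition expected_payoff ::
  "real ^ 'j::finite ^ 'i::finite \<Rightarrow> ('j, 'i) strategy \<Rightarrow> ('i, 'j) strategy \<Rightarrow> real" where
  "expected_payoff A \<alpha> \<beta> =
     (\<integral>(\<omega>1, \<omega>2). running_payoff A (induced_controls (snd \<alpha> \<omega>1) (snd \<beta> \<omega>2))
        \<partial>(cube (fst \<alpha>) \<Otimes>\<^sub>M cube (fst \<beta>)))"

lemma strategies_induce:
  assumes "\<alpha> \<in> random_strategies" "\<beta> \<in> random_strategies"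
    "\<omega>1 \<in> space (cube (fst \<alpha>))" "\<omega>2 \<in> space (cube (fst \<beta>))"
  shows "case induced_controls (snd \<alpha> \<omega>1) (snd \<beta> \<omega>2) of (u, v) \<Rightarrow>
      plays_induce (snd \<alpha> \<omega>1) (snd \<beta> \<omega>2) u v"
    and "plays_induce (snd \<alpha> \<omega>1) (snd \<beta> \<omega>2) u v \<Longrightarrow>
      running_payoff A (induced_controls (snd \<alpha> \<omega>1) (snd \<beta> \<omega>2)) = running_payoff A (u, v)"
proof -
  obtain S T where "finite S" "delayed S (snd \<alpha> \<omega>1)" "finite T" "delayed T (snd \<beta> \<omega>2)"
    using random_strategiesD(3) assms by metis
  moreover have "snd \<alpha> \<omega>1 ` controls \<subseteq> controls" "snd \<beta> \<omega>2 ` controls \<subseteq> controls"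
    using strategy_in_controls assms by blast+
  ultimately show
    "case induced_controls (snd \<alpha> \<omega>1) (snd \<beta> \<omega>2) of (u, v) \<Rightarrow>
      plays_induce (snd \<alpha> \<omega>1) (snd \<beta> \<omega>2) u v"
    "plays_induce (snd \<alpha> \<omega>1) (snd \<beta> \<omega>2) u v \<Longrightarrow>
      running_payoff A (induced_controls (snd \<alpha> \<omega>1) (snd \<beta> \<omega>2)) = running_payoff A (u, v)"
    by (rule induced_controls_plays_induce, rule running_payoff_induced)
qed

lemma induced_payoff_bound:
  assumes "\<alpha> \<in> random_strategies" "\<beta> \<in> random_strategies"
    "\<omega>1 \<in> space (cube (fst \<alpha>))" "\<omega>2 \<in> space (cube (fst \<beta>))"
  shows "\<bar>running_payoff A (induced_controls (snd \<alpha> \<omega>1) (snd \<beta> \<omega>2))\<bar> \<le> matrix_bound A"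
  using strategies_induce(1)[OF assms] running_payoff_bound
  by (auto simp: plays_induce_def split: prod.splits)

text \<open>The chosen pair need not depend measurably on the events. Its payoff, however, is that
  of the \<open>N\<close>-th iterate of the composed strategies started at a constant control, with
  one \<open>N\<close> for all events, and this is a finite composition of measurable maps.\<close>

lemma induced_payoff_measurable:
  assumes \<alpha>: "\<alpha> \<in> random_strategies" and \<beta>: "\<beta> \<in> random_strategies"
  shows "(\<lambda>(\<omega>1, \<omega>2). running_payoff A (induced_controls (snd \<alpha> \<omega>1) (snd \<beta> \<omega>2)))
    \<in> borel_measurable (cube (fst \<alpha>) \<Otimes>\<^sub>M cube (fst \<beta>))" (is "?f \<in> borel_measurable ?M")
proof -
  note meas [measurable] = random_strategiesD(2)[OF \<alpha>] random_strategiesD(2)[OF \<beta>]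
  obtain S where S: "finite S" "\<And>\<omega>. \<omega> \<in> space (cube (fst \<alpha>)) \<Longrightarrow> delayed S (snd \<alpha> \<omega>)"
    using random_strategiesD(3)[OF \<alpha>] by auto
  obtain T where T: "finite T" "\<And>\<omega>. \<omega> \<in> space (cube (fst \<beta>)) \<Longrightarrow> delayed T (snd \<beta> \<omega>)"
    using random_strategiesD(3)[OF \<beta>] by auto
  define v0 :: "real \<Rightarrow> real ^ 'a" where "v0 = const_control (axis undefined 1)"
  have v0: "v0 \<in> controls"
    unfolding v0_def by (intro const_control_in_controls axis_in_prob_simplex)
  define V where "V = (\<lambda>n \<omega>. ((\<lambda>v. snd \<beta> (snd \<omega>) (snd \<alpha> (fst \<omega>) v)) ^^ n) v0)"
  have V_meas: "V n \<in> ?M \<rightarrow>\<^sub>M control_space" for n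
  proof (induction n)
    case 0
    have "V 0 = (\<lambda>_. v0)" by (simp add: V_def)
    then show ?case using v0 by simp
  next
    case (Suc n)
    note Suc [measurable]
    have 1 [measurable]: "(\<lambda>\<omega>. snd \<alpha> (fst \<omega>) (V n \<omega>)) \<in> ?M \<rightarrow>\<^sub>M control_space"
      using measurable_compose[OF _ meas(1), of "\<lambda>\<omega>. (fst \<omega>, V n \<omega>)" ?M] by simp
    have "(\<lambda>\<omega>. snd \<beta> (snd \<omega>) (snd \<alpha> (fst \<omega>) (V n \<omega>))) \<in> ?M \<rightarrow>\<^sub>M control_space"
      using measurable_compose[OF _ meas(2), of "\<lambda>\<omega>. (snd \<omega>, snd \<alpha> (fst \<omega>) (V n \<omega>))" ?M] by simp
    moreover have "V (Suc n) = (\<lambda>\<omega>. snd \<beta> (snd \<omega>) (snd \<alpha> (fst \<omega>) (V n \<omega>)))"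
      by (simp add: V_def)
    ultimately show ?case by simp
  qed
  obtain N where N: "\<And>(a :: (real \<Rightarrow> real ^ 'a) \<Rightarrow> real \<Rightarrow> real ^ 'b) b v. delayed S a \<Longrightarrow> delayed T b \<Longrightarrow>
    a ` controls \<subseteq> controls \<Longrightarrow> b ` controls \<subseteq> controls \<Longrightarrow> v \<in> controls \<Longrightarrow>
    plays_induce a b (a (((\<lambda>v. b (a v)) ^^ N) v)) (((\<lambda>v. b (a v)) ^^ N) v)"
    using plays_induce_exists[OF S(1) T(1)] by blast
  have "?f \<omega> = running_payoff A (snd \<alpha> (fst \<omega>) (V N \<omega>), V N \<omega>)" if mem: "\<omega> \<in> space ?M" for \<omega>
  proof -
    obtain \<omega>1 \<omega>2 where \<omega>: "\<omega> = (\<omega>1, \<omega>2)" "\<omega>1 \<in> space (cube (fst \<alpha>))" "\<omega>2 \<in> space (cube (fst \<beta>))"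
      using mem by (auto simp: space_pair_measure)
    have "plays_induce (snd \<alpha> \<omega>1) (snd \<beta> \<omega>2) (snd \<alpha> \<omega>1 (V N \<omega>)) (V N \<omega>)"
      unfolding V_def \<omega>(1) fst_conv snd_conv
      using strategy_in_controls[OF \<alpha> \<omega>(2)] strategy_in_controls[OF \<beta> \<omega>(3)]
      by (intro N[of "snd \<alpha> \<omega>1" "snd \<beta> \<omega>2" v0] S(2) T(2) v0 \<omega>(2,3)) auto
    from strategies_induce(2)[OF \<alpha> \<beta> \<omega>(2,3) this] show ?thesis by (simp add: \<omega>)
  qed
  moreover have "(\<lambda>\<omega>. running_payoff A (snd \<alpha> (fst \<omega>) (V N \<omega>), V N \<omega>)) \<in> borel_measurable ?M"
  proof -
    note V_meas [measurable]
    have 1 [measurable]: "(\<lambda>\<omega>. snd \<alpha> (fst \<omega>) (V N \<omega>)) \<in> ?M \<rightarrow>\<^sub>M control_space"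
      using measurable_compose[OF _ meas(1), of "\<lambda>\<omega>. (fst \<omega>, V N \<omega>)" ?M] by simp
    show ?thesis by measurable
  qed
  ultimately show ?thesis
    by (simp cong: measurable_cong)
qed

lemma induced_payoff_integrable:
  assumes \<alpha>: "\<alpha> \<in> random_strategies" and \<beta>: "\<beta> \<in> random_strategies"
  shows "integrable (cube (fst \<alpha>) \<Otimes>\<^sub>M cube (fst \<beta>))
    (\<lambda>(\<omega>1, \<omega>2). running_payoff A (induced_controls (snd \<alpha> \<omega>1) (snd \<beta> \<omega>2)))"
proof -
  interpret pair_prob_space "cube (fst \<alpha>)" "cube (fst \<beta>)"
    by (intro pair_prob_space.intro pair_sigma_finite.intro prob_space_cube prob_space_imp_sigma_finite)
  show ?thesis
    using induced_payoff_bound[OF assms]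
    by (intro P.integrable_const_bound[of _ "matrix_bound A"] AE_I2 induced_payoff_measurable assms)
      (auto simp: space_pair_measure)
qed

lemma expected_payoff_bound:
  assumes "\<alpha> \<in> random_strategies" "\<beta> \<in> random_strategies"
  shows "\<bar>expected_payoff A \<alpha> \<beta>\<bar> \<le> matrix_bound A"
proof -
  interpret pair_prob_space "cube (fst \<alpha>)" "cube (fst \<beta>)"
    by (intro pair_prob_space.intro pair_sigma_finite.intro prob_space_cube prob_space_imp_sigma_finite)
  have "norm (expected_payoff A \<alpha> \<beta>) \<le>
    (\<integral>\<omega>. matrix_bound A \<partial>(cube (fst \<alpha>) \<Otimes>\<^sub>M cube (fst \<beta>)))"
    unfolding expected_payoff_def using induced_payoff_bound[OF assms]
    by (intro norm_integral_le induced_payoff_integrable assms) (auto simp: space_pair_measure)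
  then show ?thesis by (simp add: P.prob_space)
qed

lemma induced_payoff_swap:
  assumes "\<alpha> \<in> random_strategies" "\<beta> \<in> random_strategies"
    "\<omega>1 \<in> space (cube (fst \<alpha>))" "\<omega>2 \<in> space (cube (fst \<beta>))"
  shows "running_payoff (- transpose A) (induced_controls (snd \<beta> \<omega>2) (snd \<alpha> \<omega>1)) =
    - running_payoff A (induced_controls (snd \<alpha> \<omega>1) (snd \<beta> \<omega>2))"
proof -
  obtain u v where eq: "induced_controls (snd \<alpha> \<omega>1) (snd \<beta> \<omega>2) = (u, v)" by fastforce
  then have "plays_induce (snd \<beta> \<omega>2) (snd \<alpha> \<omega>1) v u"
    using strategies_induce(1)[OF assms] by (subst plays_induce_swap) simp
  then have "running_payoff (- transpose A) (induced_controls (snd \<beta> \<omega>2) (snd \<alpha> \<omega>1)) =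
    running_payoff (- transpose A) (v, u)"
    using strategies_induce(2) assms by blast
  moreover have "y \<bullet> ((- transpose A) *v x) = - (x \<bullet> (A *v y))" for x y
    unfolding inner_matrix_vector
    by (subst sum.swap) (simp add: transpose_def sum_negf mult_ac)
  ultimately show ?thesis
    by (simp add: running_payoff_def eq)
qed

lemma expected_payoff_swap:
  assumes "\<alpha> \<in> random_strategies" "\<beta> \<in> random_strategies"
  shows "expected_payoff (- transpose A) \<beta> \<alpha> = - expected_payoff A \<alpha> \<beta>"
proof -
  interpret pair_prob_space "cube (fst \<alpha>)" "cube (fst \<beta>)"
    by (intro pair_prob_space.intro pair_sigma_finite.intro prob_space_cube prob_space_imp_sigma_finite)
  have "expected_payoff (- transpose A) \<beta> \<alpha> =
    (\<integral>(\<omega>2, \<omega>1). - running_payoff A (induced_controls (snd \<alpha> \<omega>1) (snd \<beta> \<omega>2))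
        \<partial>(cube (fst \<beta>) \<Otimes>\<^sub>M cube (fst \<alpha>)))"
    unfolding expected_payoff_def using induced_payoff_swap[OF assms]
    by (intro Bochner_Integration.integral_cong) (auto simp: space_pair_measure)
  also have "\<dots> = - (\<integral>(\<omega>2, \<omega>1). running_payoff A (induced_controls (snd \<alpha> \<omega>1) (snd \<beta> \<omega>2))
        \<partial>(cube (fst \<beta>) \<Otimes>\<^sub>M cube (fst \<alpha>)))"
    by (simp add: case_prod_unfold)
  also have "\<dots> = - expected_payoff A \<alpha> \<beta>"
    unfolding expected_payoff_def
    using integral_product_swap[OF induced_payoff_measurable[OF assms]] by simp
  finally show ?thesis .
qed

section \<open>Pure strategies of player 1\<close>

definition det_strategy ::
  "((real \<Rightarrow> real ^ 'b::finite) \<Rightarrow> real \<Rightarrow> real ^ 'a::finite) \<Rightarrow> bool" where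
  "det_strategy a \<longleftrightarrow> a \<in> control_space \<rightarrow>\<^sub>M control_space \<and> (\<exists>S. finite S \<and> delayed S a)"

text \<open>The outcome of the lottery of player 1 is frozen. Expected payoffs are averages of these
  quantities (\<open>expected_payoff_eq_integral\<close>), so strategies of player 2 can be tested
  against pure strategies.\<close>

definition det_payoff ::
  "real ^ 'j::finite ^ 'i::finite \<Rightarrow> ((real \<Rightarrow> real ^ 'j) \<Rightarrow> real \<Rightarrow> real ^ 'i) \<Rightarrow>
   ('i, 'j) strategy \<Rightarrow> real" where
  "det_payoff A a \<beta> = (\<integral>\<omega>. running_payoff A (induced_controls a (snd \<beta> \<omega>)) \<partial>cube (fst \<beta>))"

lemma det_strategyI: "\<alpha> \<in> random_strategies \<Longrightarrow> \<omega> \<in> space (cube (fst \<alpha>)) \<Longrightarrow> det_strategy (snd \<alpha> \<omega>)"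
  using random_strategiesD(3)[of \<alpha>]
    measurable_compose[OF measurable_Pair1'[of \<omega>] random_strategiesD(2)[of \<alpha>]]
  unfolding det_strategy_def by auto

lemma det_strategy_in_controls: "det_strategy a \<Longrightarrow> v \<in> controls \<Longrightarrow> a v \<in> controls"
  unfolding det_strategy_def using measurable_space[of a control_space control_space v] by simp

lemma det_strategy_random: "det_strategy a \<Longrightarrow> (1, \<lambda>_. a) \<in> random_strategies"
  unfolding det_strategy_def random_strategies_iff
  using measurable_compose[OF measurable_snd] by (auto simp: case_prod_unfold)

lemma det_payoff_bounded_measurable:
  assumes "det_strategy a" "\<beta> \<in> random_strategies"
  shows "(\<lambda>\<omega>. running_payoff A (induced_controls a (snd \<beta> \<omega>))) \<in> borel_measurable (cube (fst \<beta>))"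
    and "\<omega> \<in> space (cube (fst \<beta>)) \<Longrightarrow> \<bar>running_payoff A (induced_controls a (snd \<beta> \<omega>))\<bar> \<le> matrix_bound A"
    and "integrable (cube (fst \<beta>)) (\<lambda>\<omega>. running_payoff A (induced_controls a (snd \<beta> \<omega>)))"
proof -
  note \<alpha> = det_strategy_random[OF assms(1)]
  obtain \<omega>1 where \<omega>1: "\<omega>1 \<in> space (cube 1)"
    using prob_space.not_empty[OF prob_space_cube] by blast
  show 1: "(\<lambda>\<omega>. running_payoff A (induced_controls a (snd \<beta> \<omega>))) \<in> borel_measurable (cube (fst \<beta>))"
    using measurable_compose[OF measurable_Pair1'[OF \<omega>1]
        induced_payoff_measurable[OF \<alpha> assms(2), unfolded fst_conv snd_conv]] by simp
  show 2: "\<bar>running_payoff A (induced_controls a (snd \<beta> \<omega>))\<bar> \<le> matrix_bound A"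
    if "\<omega> \<in> space (cube (fst \<beta>))" for \<omega>
    using induced_payoff_bound[OF \<alpha> assms(2) _ that, of \<omega>1] \<omega>1 by simp
  interpret prob_space "cube (fst \<beta>)" by (rule prob_space_cube)
  show "integrable (cube (fst \<beta>)) (\<lambda>\<omega>. running_payoff A (induced_controls a (snd \<beta> \<omega>)))"
    using 2 by (intro integrable_const_bound[OF _ 1, of "matrix_bound A"] AE_I2) auto
qed

lemma expected_payoff_eq_integral:
  assumes "\<alpha> \<in> random_strategies" "\<beta> \<in> random_strategies"
  shows "integrable (cube (fst \<alpha>)) (\<lambda>\<omega>. det_payoff A (snd \<alpha> \<omega>) \<beta>)"
    "expected_payoff A \<alpha> \<beta> = (\<integral>\<omega>. det_payoff A (snd \<alpha> \<omega>) \<beta> \<partial>cube (fst \<alpha>))"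
proof -
  interpret pair_prob_space "cube (fst \<alpha>)" "cube (fst \<beta>)"
    by (intro pair_prob_space.intro pair_sigma_finite.intro prob_space_cube prob_space_imp_sigma_finite)
  show "integrable (cube (fst \<alpha>)) (\<lambda>\<omega>. det_payoff A (snd \<alpha> \<omega>) \<beta>)"
    using integrable_fst'[OF induced_payoff_integrable[OF assms]] by (simp add: det_payoff_def)
  show "expected_payoff A \<alpha> \<beta> = (\<integral>\<omega>. det_payoff A (snd \<alpha> \<omega>) \<beta> \<partial>cube (fst \<alpha>))"
    using integral_fst'[OF induced_payoff_integrable[OF assms]]
    by (simp add: det_payoff_def expected_payoff_def)
qed

lemma expected_payoff_det:
  assumes "det_strategy a" "\<beta> \<in> random_strategies"
  shows "expected_payoff A (1, \<lambda>_. a) \<beta> = det_payoff A a \<beta>"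
  using expected_payoff_eq_integral(2)[OF det_strategy_random[OF assms(1)] assms(2)]
    prob_space.prob_space[OF prob_space_cube] by simp

section \<open>Changing the probability space and mixing\<close>

text \<open>The extra coordinates are ignored and leave the payoff unchanged; this brings several
  strategies onto one cube.\<close>

definition pad_strategy :: "nat \<Rightarrow> ('b::finite, 'a::finite) strategy \<Rightarrow> ('b, 'a) strategy" where
  "pad_strategy M \<beta> = (M, \<lambda>\<omega>. snd \<beta> (restrict \<omega> {..<fst \<beta>}))"

lemma measurable_restrict_cube: "m \<le> M \<Longrightarrow> (\<lambda>\<omega>. restrict \<omega> {..<m}) \<in> cube M \<rightarrow>\<^sub>M cube m"
  unfolding cube_def by (intro measurable_restrict_subset) auto

lemma product_prob_space_unit: "product_prob_space (\<lambda>_::nat. restrict_space lborel {0..1::real})"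
  by (intro product_prob_spaceI prob_spaceI) (simp add: emeasure_restrict_space space_restrict_space)

lemma integral_restrict_cube:
  fixes f :: "_ \<Rightarrow> real"
  assumes "m \<le> M" "f \<in> borel_measurable (cube m)"
  shows "(\<integral>\<omega>. f (restrict \<omega> {..<m}) \<partial>cube M) = (\<integral>\<omega>. f \<omega> \<partial>cube m)"
proof -
  interpret product_prob_space "\<lambda>_::nat. restrict_space lborel {0..1::real}" "{..<M}"
    by (rule product_prob_space_unit)
  have "distr (cube M) (cube m) (\<lambda>\<omega>. restrict \<omega> {..<m}) = cube m"
    unfolding cube_def using assms(1) by (intro distr_PiM_restrict_finite) auto
  then show ?thesis
    using integral_distr[OF measurable_restrict_cube[OF assms(1)] assms(2)] by simp
qed

lemma pad_strategy_random:
  assumes "\<beta> \<in> random_strategies" "fst \<beta> \<le> M"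
  shows "pad_strategy M \<beta> \<in> random_strategies"
proof -
  obtain S where S: "finite S" "\<And>\<omega>. \<omega> \<in> space (cube (fst \<beta>)) \<Longrightarrow> delayed S (snd \<beta> \<omega>)"
    using random_strategiesD(3)[OF assms(1)] by auto
  note r = measurable_restrict_cube[OF assms(2)]
  have "(\<lambda>(\<omega>, v). snd \<beta> (restrict \<omega> {..<fst \<beta>}) v) \<in> cube M \<Otimes>\<^sub>M control_space \<rightarrow>\<^sub>M control_space"
    using measurable_compose[OF _ random_strategiesD(2)[OF assms(1)],
        of "\<lambda>(\<omega>, v). (restrict \<omega> {..<fst \<beta>}, v)" "cube M \<Otimes>\<^sub>M control_space"] r
    by (simp add: case_prod_unfold measurable_Pair)
  moreover have "\<forall>\<omega>\<in>space (cube M). delayed S (snd \<beta> (restrict \<omega> {..<fst \<beta>}))"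
    using S(2) measurable_space[OF r] by blast
  ultimately show ?thesis
    unfolding pad_strategy_def random_strategies_iff
    using S(1) random_strategiesD(1)[OF assms(1)] assms(2) by auto
qed

lemma det_payoff_pad:
  assumes "det_strategy a" "\<beta> \<in> random_strategies" "fst \<beta> \<le> M"
  shows "det_payoff A a (pad_strategy M \<beta>) = det_payoff A a \<beta>"
  unfolding det_payoff_def pad_strategy_def fst_conv snd_conv
  by (rule integral_restrict_cube[OF assms(3) det_payoff_bounded_measurable(1)[OF assms(1,2)]])

lemma integral_unit_if:
  assumes "0 \<le> \<mu>" "\<mu> \<le> (1::real)"
  shows "(\<integral>y. (if y < \<mu> then c else d) \<partial>restrict_space lborel {0..1}) = \<mu> * c + (1 - \<mu>) * (d::real)"
proof -
  have "(\<integral>y. (if y < \<mu> then c else d) \<partial>restrict_space lborel {0..1}) =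
    (\<integral>y. c * indicator {0..<\<mu>} y + d * indicator {\<mu>..1} y \<partial>lborel)"
    using assms
    by (subst integral_restrict_space)
      (auto intro!: Bochner_Integration.integral_cong simp: indicator_def)
  also have "\<dots> = \<mu> * c + (1 - \<mu>) * d"
    using assms by (subst Bochner_Integration.integral_add) auto
  finally show ?thesis .
qed

text \<open>The coordinate \<open>M\<close>, which neither component sees, is the lottery: for
  \<open>\<mu>\<close> in \<open>[0, 1]\<close> it falls below \<open>\<mu>\<close> with probability
  \<open>\<mu>\<close>.\<close>

definition mix_strategy ::
  "real \<Rightarrow> nat \<Rightarrow> ('b::finite, 'a::finite) strategy \<Rightarrow> ('b, 'a) strategy \<Rightarrow> ('b, 'a) strategy" where
  "mix_strategy \<mu> M \<beta> \<beta>' = (Suc M, \<lambda>\<omega>.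
     if \<omega> M < \<mu> then snd \<beta> (restrict \<omega> {..<M}) else snd \<beta>' (restrict \<omega> {..<M}))"

lemma cube_component_measurable: "(\<lambda>\<omega>. \<omega> M) \<in> borel_measurable (cube (Suc M))"
proof -
  have "(\<lambda>\<omega>. \<omega> M) \<in> cube (Suc M) \<rightarrow>\<^sub>M restrict_space lborel {0..1}"
    unfolding cube_def by (rule measurable_component_singleton) simp
  then show ?thesis
    by (rule measurable_compose) (simp add: measurable_restrict_space1)
qed

lemma mix_strategy_random:
  assumes \<beta>: "\<beta> \<in> random_strategies" "fst \<beta> = M" and \<beta>': "\<beta>' \<in> random_strategies" "fst \<beta>' = M"
  shows "mix_strategy \<mu> M \<beta> \<beta>' \<in> random_strategies"
proof -
  obtain S where S: "finite S" "\<And>\<omega>. \<omega> \<in> space (cube M) \<Longrightarrow> delayed S (snd \<beta> \<omega>)"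
    using random_strategiesD(3)[OF \<beta>(1)] \<beta>(2) by auto
  obtain S' where S': "finite S'" "\<And>\<omega>. \<omega> \<in> space (cube M) \<Longrightarrow> delayed S' (snd \<beta>' \<omega>)"
    using random_strategiesD(3)[OF \<beta>'(1)] \<beta>'(2) by auto
  let ?P = "cube (Suc M) \<Otimes>\<^sub>M control_space"
  note r = measurable_restrict_cube[of M "Suc M", simplified]
  have pair: "(\<lambda>x. (restrict (fst x) {..<M}, snd x)) \<in> ?P \<rightarrow>\<^sub>M cube M \<Otimes>\<^sub>M control_space"
    using r by (intro measurable_Pair measurable_compose[OF measurable_fst r] measurable_snd)
  have "(\<lambda>x. snd \<beta> (restrict (fst x) {..<M}) (snd x)) \<in> ?P \<rightarrow>\<^sub>M control_space"
    using measurable_compose[OF pair random_strategiesD(2)[OF \<beta>(1), unfolded \<beta>(2)]] by simp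
  moreover have "(\<lambda>x. snd \<beta>' (restrict (fst x) {..<M}) (snd x)) \<in> ?P \<rightarrow>\<^sub>M control_space"
    using measurable_compose[OF pair random_strategiesD(2)[OF \<beta>'(1), unfolded \<beta>'(2)]] by simp
  moreover have [measurable]: "(\<lambda>x. fst x M) \<in> borel_measurable ?P"
    using measurable_compose[OF measurable_fst cube_component_measurable] .
  have "{x \<in> space ?P. fst x M < \<mu>} \<in> sets ?P"
    by measurable
  ultimately have "(\<lambda>x. if fst x M < \<mu> then snd \<beta> (restrict (fst x) {..<M}) (snd x)
      else snd \<beta>' (restrict (fst x) {..<M}) (snd x)) \<in> ?P \<rightarrow>\<^sub>M control_space"
    by (intro measurable_If) auto
  then have "(\<lambda>(\<omega>, v). (if \<omega> M < \<mu> then snd \<beta> (restrict \<omega> {..<M}) else snd \<beta>' (restrict \<omega> {..<M})) v)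
    \<in> ?P \<rightarrow>\<^sub>M control_space"
    by (rule measurable_cong[THEN iffD1, rotated]) (auto split: prod.splits)
  moreover have "delayed (S \<union> S') (if \<omega> M < \<mu> then snd \<beta> (restrict \<omega> {..<M})
      else snd \<beta>' (restrict \<omega> {..<M}))" if "\<omega> \<in> space (cube (Suc M))" for \<omega>
    using measurable_space[OF r that] S(2) S'(2) delayed_mono[of S _ "S \<union> S'"] delayed_mono[of S' _ "S \<union> S'"]
    by auto
  ultimately show ?thesis
    unfolding mix_strategy_def random_strategies_iff using S(1) S'(1)
    by (intro conjI exI[of _ "S \<union> S'"] ballI) simp_all
qed

lemma det_payoff_mix:
  assumes a: "det_strategy a" and \<beta>: "\<beta> \<in> random_strategies" "fst \<beta> = M"
    and \<beta>': "\<beta>' \<in> random_strategies" "fst \<beta>' = M" and \<mu>: "0 \<le> \<mu>" "\<mu> \<le> 1"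
  shows "det_payoff A a (mix_strategy \<mu> M \<beta> \<beta>') = \<mu> * det_payoff A a \<beta> + (1 - \<mu>) * det_payoff A a \<beta>'"
proof -
  let ?U = "\<lambda>_::nat. restrict_space lborel {0..1::real}"
  interpret product_prob_space ?U "{..<M}"
    by (rule product_prob_space_unit)
  define f where "f = (\<lambda>\<omega>. running_payoff A (induced_controls a (snd \<beta> \<omega>)))"
  define f' where "f' = (\<lambda>\<omega>. running_payoff A (induced_controls a (snd \<beta>' \<omega>)))"
  define F where "F = (\<lambda>\<omega>. running_payoff A (induced_controls a (snd (mix_strategy \<mu> M \<beta> \<beta>') \<omega>)))"
  have F: "F \<omega> = (if \<omega> M < \<mu> then f (restrict \<omega> {..<M}) else f' (restrict \<omega> {..<M}))" for \<omega>
    by (simp add: F_def f_def f'_def mix_strategy_def)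
  have int: "integrable (cube M) f" "integrable (cube M) f'"
    unfolding f_def f'_def using det_payoff_bounded_measurable(3)[OF a \<beta>(1)]
      det_payoff_bounded_measurable(3)[OF a \<beta>'(1)] \<beta>(2) \<beta>'(2) by simp_all
  have "integrable (cube (Suc M)) F"
    unfolding F_def using det_payoff_bounded_measurable(3)[OF a mix_strategy_random[OF \<beta> \<beta>']]
    by (simp add: mix_strategy_def)
  moreover have insert: "insert M {..<M} = {..<Suc M}" by auto
  \<comment> \<open>Fubini isolates the lottery coordinate.\<close>
  ultimately have "(\<integral>\<omega>. F \<omega> \<partial>cube (Suc M)) = (\<integral>x. \<integral>y. F (x(M := y)) \<partial>?U M \<partial>cube M)"
    unfolding cube_def using product_integral_insert[of "{..<M}" M F] by simp
  also have "\<dots> = (\<integral>x. \<mu> * f x + (1 - \<mu>) * f' x \<partial>cube M)"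
  proof (rule Bochner_Integration.integral_cong[OF refl])
    fix x assume "x \<in> space (cube M)"
    then have "x \<in> extensional {..<M}" by (simp add: cube_def space_PiM PiE_def)
    then have *: "restrict (x(M := y)) {..<M} = x" for y
      by (auto simp: fun_eq_iff extensional_def)
    show "(\<integral>y. F (x(M := y)) \<partial>?U M) = \<mu> * f x + (1 - \<mu>) * f' x"
      by (simp only: F * fun_upd_same integral_unit_if[OF \<mu>])
  qed
  also have "\<dots> = \<mu> * (\<integral>x. f x \<partial>cube M) + (1 - \<mu>) * (\<integral>x. f' x \<partial>cube M)"
    using int by simp
  finally show ?thesis
    by (simp add: det_payoff_def F_def f_def f'_def \<beta>(2) \<beta>'(2)) (simp add: mix_strategy_def)
qed

text \<open>One mixture works for all matrices and all opponents at once, as it must since player 2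
  does not know \<open>k\<close>. It is the source of convexity both for splitting in
  \<open>upper_value_L_convex\<close> and for separation in \<open>conjK_less\<close>.\<close>

lemma mixture_exists:
  assumes \<beta>: "\<beta> \<in> random_strategies" and \<beta>': "\<beta>' \<in> random_strategies" and \<mu>: "0 \<le> \<mu>" "\<mu> \<le> 1"
  shows "\<exists>\<gamma>\<in>random_strategies. \<forall>A. \<forall>\<alpha>\<in>random_strategies.
    expected_payoff A \<alpha> \<gamma> = \<mu> * expected_payoff A \<alpha> \<beta> + (1 - \<mu>) * expected_payoff A \<alpha> \<beta>'"
proof -
  define M where "M = max (fst \<beta>) (fst \<beta>')"
  have le: "fst \<beta> \<le> M" "fst \<beta>' \<le> M" by (auto simp: M_def)
  define \<gamma> where "\<gamma> = mix_strategy \<mu> M (pad_strategy M \<beta>) (pad_strategy M \<beta>')"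
  note pad = pad_strategy_random[OF \<beta> le(1)] pad_strategy_random[OF \<beta>' le(2)]
  have fst_pad: "fst (pad_strategy M \<beta>) = M" "fst (pad_strategy M \<beta>') = M"
    by (simp_all add: pad_strategy_def)
  have \<gamma>: "\<gamma> \<in> random_strategies"
    unfolding \<gamma>_def by (rule mix_strategy_random[OF pad(1) fst_pad(1) pad(2) fst_pad(2)])
  have *: "det_payoff A a \<gamma> = \<mu> * det_payoff A a \<beta> + (1 - \<mu>) * det_payoff A a \<beta>'"
    if "det_strategy a" for A a
    unfolding \<gamma>_def det_payoff_mix[OF that pad(1) fst_pad(1) pad(2) fst_pad(2) \<mu>]
    by (simp add: det_payoff_pad that \<beta> \<beta>' le)
  have "expected_payoff A \<alpha> \<gamma> = \<mu> * expected_payoff A \<alpha> \<beta> + (1 - \<mu>) * expected_payoff A \<alpha> \<beta>'"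
    if \<alpha>: "\<alpha> \<in> random_strategies" for A \<alpha>
  proof -
    have "expected_payoff A \<alpha> \<gamma> =
      (\<integral>\<omega>. \<mu> * det_payoff A (snd \<alpha> \<omega>) \<beta> + (1 - \<mu>) * det_payoff A (snd \<alpha> \<omega>) \<beta>' \<partial>cube (fst \<alpha>))"
      unfolding expected_payoff_eq_integral(2)[OF \<alpha> \<gamma>]
      by (intro Bochner_Integration.integral_cong refl * det_strategyI \<alpha>)
    then show ?thesis
      using expected_payoff_eq_integral[OF \<alpha> \<beta>] expected_payoff_eq_integral[OF \<alpha> \<beta>'] by simp
  qed
  with \<gamma> show ?thesis by blast
qed

section \<open>Concatenation in time\<close>

definition tail_control :: "real \<Rightarrow> (real \<Rightarrow> real ^ 'a::finite) \<Rightarrow> real \<Rightarrow> real ^ 'a" where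
  "tail_control h u = (\<lambda>s. if s \<in> {0..1} then u (h + (1 - h) * s) else undefined)"

definition prefix_control :: "real \<Rightarrow> real ^ 'a::finite \<Rightarrow> (real \<Rightarrow> real ^ 'a) \<Rightarrow> real \<Rightarrow> real ^ 'a" where
  "prefix_control h b v = (\<lambda>t. if t \<in> {0..1} then (if t < h then b else v ((t - h) / (1 - h))) else undefined)"

text \<open>Against a constant action on \<open>[0, h)\<close> the payoff is linear in the control
  of player 1 and depends on it through this average only: the average is all that player 2 has to
  remember from the first period.\<close>

definition mean_control :: "real \<Rightarrow> (real \<Rightarrow> real ^ 'a::finite) \<Rightarrow> real ^ 'a" where
  "mean_control h u = (\<chi> i. (\<integral>s. indicator {0..<h} s * u s $ i \<partial>lebesgue_on {0..1}) / h)"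

section \<open>Change of time scale\<close>

lemma affine_measurable_lebesgue: "c \<noteq> 0 \<Longrightarrow> (\<lambda>x::real. t + c * x) \<in> lebesgue \<rightarrow>\<^sub>M lebesgue"
  using lebesgue_affine_measurable[where c = "\<lambda>_::real. c" and t = t] by simp

lemma AE_lebesgue_affine:
  assumes "AE x in lebesgue. P x" "c \<noteq> (0::real)"
  shows "AE x in lebesgue. P (t + c * x)"
proof -
  have "AE x in density (distr lebesgue lebesgue (\<lambda>x. t + c * x)) (\<lambda>_. ennreal \<bar>c\<bar>). P x"
    using assms(1) by (subst (asm) lebesgue_real_affine[OF assms(2), of t])
  then have "AE x in distr lebesgue lebesgue (\<lambda>x. t + c * x). P x"
    using assms(2) by (subst (asm) AE_density) auto
  then show ?thesis
    by (rule AE_distrD[OF affine_measurable_lebesgue[OF assms(2)]])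
qed

context
  fixes h :: real
  assumes h: "0 < h" "h < 1"
begin

text \<open>The integral over the second period is rescaled to the unit interval, which is the
  origin of the factor \<open>1 - h\<close> in the dynamic programming inequality.\<close>

lemma integral_split_head_tail:
  fixes f :: "real \<Rightarrow> real"
  assumes int: "integrable (lebesgue_on {0..1}) f"
  shows "(\<integral>s. f s \<partial>lebesgue_on {0..1}) =
    (\<integral>s. indicator {0..<h} s * f s \<partial>lebesgue_on {0..1}) +
    (1 - h) * (\<integral>s. f (h + (1 - h) * s) \<partial>lebesgue_on {0..1})"
proof -
  have intf: "integrable lebesgue (\<lambda>x. indicator {0..1} x * f x)"
    using int integrable_restrict_space[of "{0..1::real}" lebesgue f] by simp
  have int_ind: "integrable lebesgue (\<lambda>x. indicator S x * f x)"
    if "S \<in> sets lebesgue" "S \<subseteq> {0..1}" for S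
  proof -
    have "integrable lebesgue (\<lambda>x. indicator S x *\<^sub>R (indicator {0..1} x * f x))"
      by (rule integrable_mult_indicator[OF that(1) intf])
    moreover have "(\<lambda>x. indicator S x *\<^sub>R (indicator {0..1} x * f x)) = (\<lambda>x. indicator S x * f x)"
      using that(2) by (auto simp: indicator_def fun_eq_iff)
    ultimately show ?thesis by (simp only:)
  qed
  have "(\<integral>s. f s \<partial>lebesgue_on {0..1}) = (\<integral>x. indicator {0..1} x * f x \<partial>lebesgue)"
    by (subst integral_restrict_space) auto
  also have "\<dots> = (\<integral>x. indicator {0..<h} x * f x + indicator {h..1} x * f x \<partial>lebesgue)"
    using h by (intro Bochner_Integration.integral_cong) (auto simp: indicator_def)
  also have "\<dots> = (\<integral>x. indicator {0..<h} x * f x \<partial>lebesgue) + (\<integral>x. indicator {h..1} x * f x \<partial>lebesgue)"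
    using h by (intro Bochner_Integration.integral_add int_ind) auto
  also have "(\<integral>x. indicator {h..1} x * f x \<partial>lebesgue) =
    (1 - h) * (\<integral>x. indicator {h..1} (h + (1 - h) * x) * f (h + (1 - h) * x) \<partial>lebesgue)"
    using h by (subst lebesgue_integral_real_affine[of "1 - h" _ h]) auto
  also have "(\<integral>x. indicator {h..1} (h + (1 - h) * x) * f (h + (1 - h) * x) \<partial>lebesgue)
    = (\<integral>x. indicator {0..1} x * f (h + (1 - h) * x) \<partial>lebesgue)"
  proof (rule Bochner_Integration.integral_cong[OF refl])
    fix x :: real
    have "h + (1 - h) * x \<in> {h..1} \<longleftrightarrow> x \<in> {0..1}"
    proof -
      have "h + (1 - h) * x \<le> 1 \<longleftrightarrow> (1 - h) * x \<le> (1 - h) * 1" by (simp add: algebra_simps)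
      also have "\<dots> \<longleftrightarrow> x \<le> 1" using h by (subst mult_le_cancel_left_pos) auto
      finally show ?thesis using h by (auto simp: zero_le_mult_iff)
    qed
    then show "indicator {h..1} (h + (1 - h) * x) * f (h + (1 - h) * x) =
      indicator {0..1} x * f (h + (1 - h) * x)"
      by (simp add: indicator_def)
  qed
  also have "\<dots> = (\<integral>s. f (h + (1 - h) * s) \<partial>lebesgue_on {0..1})"
    by (subst integral_restrict_space) auto
  also have "(\<integral>x. indicator {0..<h} x * f x \<partial>lebesgue) =
    (\<integral>s. indicator {0..<h} s * f s \<partial>lebesgue_on {0..1})"
    using h by (subst integral_restrict_space)
      (auto intro!: Bochner_Integration.integral_cong simp: indicator_def)
  finally show ?thesis .
qed

lemma affine_tail_mem: "s \<in> {0..1} \<Longrightarrow> h + (1 - h) * s \<in> {h..1}"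
proof -
  assume "s \<in> {0..1}"
  then have "(1 - h) * s \<le> (1 - h) * 1" "0 \<le> (1 - h) * s"
    using h by (auto intro!: mult_left_le mult_nonneg_nonneg)
  then show ?thesis by auto
qed

lemma tail_control_in_controls:
  assumes "u \<in> controls"
  shows "tail_control h u \<in> controls"
proof (rule controlsI)
  have "(\<lambda>s. h + (1 - h) * s) \<in> lebesgue_on {0..1} \<rightarrow>\<^sub>M lebesgue_on {0..1}"
    using h affine_tail_mem
    by (intro measurable_restrict_space2 measurable_restrict_space1 affine_measurable_lebesgue)
      (force simp: space_restrict_space)+
  from measurable_compose[OF this controlsD(1)[OF assms]]
  show "tail_control h u \<in> borel_measurable (lebesgue_on {0..1})"
    by (rule measurable_cong[THEN iffD1, rotated]) (simp add: tail_control_def space_restrict_space)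
  show "tail_control h u s \<in> prob_simplex" if "s \<in> {0..1}" for s
    using controlsD(2)[OF assms, of "h + (1 - h) * s"] affine_tail_mem[OF that] that h
    by (simp add: tail_control_def)
qed (auto simp: tail_control_def)

lemma prefix_control_in_controls:
  assumes b: "b \<in> prob_simplex" and v: "v \<in> controls"
  shows "prefix_control h b v \<in> controls"
proof (rule controlsI)
  have quot: "(t - h) / (1 - h) = - h / (1 - h) + (1 / (1 - h)) * t" for t
    by (simp add: diff_divide_distrib)
  have "(\<lambda>s. indicator {0..1} s *\<^sub>R v s) \<in> borel_measurable lebesgue"
    using controlsD(1)[OF v] by (subst (asm) borel_measurable_restrict_space_iff) auto
  from measurable_compose[OF affine_measurable_lebesgue this, of "1 / (1 - h)" "- h / (1 - h)"]
  have "(\<lambda>t. indicator {0..1} ((t - h) / (1 - h)) *\<^sub>R v ((t - h) / (1 - h))) \<in> borel_measurable lebesgue"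
    using h unfolding quot by simp
  then have "(\<lambda>t. if t < h then b else indicator {0..1} ((t - h) / (1 - h)) *\<^sub>R v ((t - h) / (1 - h)))
    \<in> borel_measurable lebesgue"
    by (intro measurable_If) auto
  then have "(\<lambda>t. if t < h then b else indicator {0..1} ((t - h) / (1 - h)) *\<^sub>R v ((t - h) / (1 - h)))
    \<in> borel_measurable (lebesgue_on {0..1})"
    by (rule measurable_restrict_space1)
  then show "prefix_control h b v \<in> borel_measurable (lebesgue_on {0..1})"
    by (rule measurable_cong[THEN iffD1, rotated])
      (use h in \<open>auto simp: prefix_control_def space_restrict_space field_simps\<close>)
  show "prefix_control h b v s \<in> prob_simplex" if "s \<in> {0..1}" for s
    using controlsD(2)[OF v, of "(s - h) / (1 - h)"] that h b
    by (auto simp: prefix_control_def field_simps)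
qed (auto simp: prefix_control_def)

lemma tail_prefix_control:
  assumes "v \<in> controls"
  shows "tail_control h (prefix_control h b v) = v"
proof
  fix s
  show "tail_control h (prefix_control h b v) s = v s"
  proof (cases "s \<in> {0..1}")
    case True
    define t where "t = h + (1 - h) * s"
    have "t \<in> {0..1}" "\<not> t < h" "(t - h) / (1 - h) = s"
      using affine_tail_mem[OF True] h by (auto simp: t_def)
    with True show ?thesis
      unfolding tail_control_def t_def[symmetric] prefix_control_def by (simp only: if_True if_False)
  qed (use controlsD(3)[OF assms] in \<open>auto simp: tail_control_def\<close>)
qed

lemma L1_dist_split:
  assumes "u \<in> controls" "u' \<in> controls"
  shows "L1_dist u u' = (\<integral>s. indicator {0..<h} s * norm (u s - u' s) \<partial>lebesgue_on {0..1}) +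
    (1 - h) * L1_dist (tail_control h u) (tail_control h u')"
proof -
  have "L1_dist (tail_control h u) (tail_control h u') =
    (\<integral>s. norm (u (h + (1 - h) * s) - u' (h + (1 - h) * s)) \<partial>lebesgue_on {0..1})"
    unfolding L1_dist_def
    by (intro Bochner_Integration.integral_cong) (auto simp: tail_control_def space_restrict_space)
  then show ?thesis
    using integral_split_head_tail[OF integrable_control_diff[OF assms]] by (simp add: L1_dist_def)
qed

lemma L1_dist_nonneg: "0 \<le> L1_dist u u'"
  unfolding L1_dist_def by (intro integral_nonneg_AE) simp

lemma tail_control_measurable: "tail_control h \<in> control_space \<rightarrow>\<^sub>M control_space"
proof (rule measurable_control_space_lipschitz)
  fix u u' :: "real \<Rightarrow> real ^ 'a" assume u: "u \<in> controls" "u' \<in> controls"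
  have "0 \<le> (\<integral>s. indicator {0..<h} s * norm (u s - u' s) \<partial>lebesgue_on {0..1})"
    by (intro integral_nonneg_AE) simp
  then have "(1 - h) * L1_dist (tail_control h u) (tail_control h u') \<le> L1_dist u u'"
    using L1_dist_split[OF u] by simp
  then show "L1_dist (tail_control h u) (tail_control h u') \<le> 1 / (1 - h) * L1_dist u u'"
    using h by (simp add: field_simps)
qed (use h tail_control_in_controls in auto)

lemma prefix_control_measurable:
  assumes "b \<in> prob_simplex"
  shows "prefix_control h b \<in> control_space \<rightarrow>\<^sub>M control_space"
proof (rule measurable_control_space_lipschitz)
  fix v v' :: "real \<Rightarrow> real ^ 'a" assume v: "v \<in> controls" "v' \<in> controls"
  have "(\<integral>s. indicator {0..<h} s * norm (prefix_control h b v s - prefix_control h b v' s) \<partial>lebesgue_on {0..1})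
    = (\<integral>s. 0 \<partial>lebesgue_on {0..1::real})"
    by (intro Bochner_Integration.integral_cong)
      (auto simp: prefix_control_def space_restrict_space indicator_def)
  then have "L1_dist (prefix_control h b v) (prefix_control h b v') = (1 - h) * L1_dist v v'"
    using L1_dist_split[OF prefix_control_in_controls[OF assms v(1)] prefix_control_in_controls[OF assms v(2)]]
    by (simp add: tail_prefix_control v)
  also have "\<dots> \<le> 1 * L1_dist v v'"
    using h L1_dist_nonneg by (intro mult_right_mono) auto
  finally show "L1_dist (prefix_control h b v) (prefix_control h b v') \<le> 1 * L1_dist v v'" .
qed (use prefix_control_in_controls assms in auto)

section \<open>The mean action before time \<open>h\<close>\<close>

lemma integrable_indicator_component:
  assumes "u \<in> controls"
  shows "integrable (lebesgue_on {0..1}) (\<lambda>s. indicator {0..<h} s * u s $ i)"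
proof (rule integrable_unit_bounded)
  have [measurable]: "(\<lambda>s. u s $ i) \<in> borel_measurable (lebesgue_on {0..1})"
    by (rule control_component_measurable[OF assms])
  have [measurable]: "indicator {0..<h} \<in> borel_measurable (lebesgue_on {0..1::real})"
    by (intro measurable_restrict_space1 borel_measurable_indicator) auto
  show "(\<lambda>s. indicator {0..<h} s * u s $ i) \<in> borel_measurable (lebesgue_on {0..1})"
    by measurable
  show "norm (indicator {0..<h} s * u s $ i) \<le> 1" if "s \<in> {0..1}" for s
    using control_component_le_1[OF assms that] by (simp add: indicator_def)
qed

lemma integral_unit_indicator: "(\<integral>s. indicator {0..<h} s \<partial>lebesgue_on {0..1}) = h"
proof -
  have "(\<lambda>x. indicator {0..1} x *\<^sub>R indicator {0..<h} x) = (indicator {0..<h} :: real \<Rightarrow> real)"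
    using h by (auto simp: indicator_def fun_eq_iff)
  then have "(\<integral>s. indicator {0..<h} s \<partial>lebesgue_on {0..1}) = (\<integral>s. (indicator {0..<h} s :: real) \<partial>lebesgue)"
    by (subst integral_restrict_space) auto
  then show ?thesis using h by simp
qed

lemma mean_control_in_prob_simplex:
  assumes "u \<in> controls"
  shows "mean_control h u \<in> prob_simplex"
proof -
  have "0 \<le> (\<integral>s. indicator {0..<h} s * u s $ i \<partial>lebesgue_on {0..1})" for i
    by (intro integral_nonneg_AE AE_I2)
      (use prob_simplexD(1)[OF controlsD(2)[OF assms]] in \<open>auto simp: space_restrict_space\<close>)
  moreover have "(\<Sum>i\<in>UNIV. \<integral>s. indicator {0..<h} s * u s $ i \<partial>lebesgue_on {0..1}) = h"
  proof -
    have "(\<Sum>i\<in>UNIV. \<integral>s. indicator {0..<h} s * u s $ i \<partial>lebesgue_on {0..1}) =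
      (\<integral>s. (\<Sum>i\<in>UNIV. indicator {0..<h} s * u s $ i) \<partial>lebesgue_on {0..1})"
      by (rule Bochner_Integration.integral_sum[symmetric]) (rule integrable_indicator_component[OF assms])
    also have "\<dots> = (\<integral>s. indicator {0..<h} s \<partial>lebesgue_on {0..1})"
    proof (rule Bochner_Integration.integral_cong[OF refl])
      fix s assume "s \<in> space (lebesgue_on {0..1::real})"
      then have "(\<Sum>i\<in>UNIV. u s $ i) = 1"
        using prob_simplexD(3)[OF controlsD(2)[OF assms]] by (simp add: space_restrict_space)
      then show "(\<Sum>i\<in>UNIV. indicator {0..<h} s * u s $ i) = indicator {0..<h} s"
        by (subst sum_distrib_left[symmetric]) simp
    qed
    finally show ?thesis by (simp only: integral_unit_indicator)
  qed
  ultimately show ?thesis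
    using h by (auto simp: prob_simplex_def mean_control_def simp flip: sum_divide_distrib)
qed

lemma mean_control_measurable:
  "(mean_control h :: _ \<Rightarrow> real ^ 'a::finite) \<in> borel_measurable control_space"
proof (rule borel_measurable_control_space_lipschitz)
  fix u u' :: "real \<Rightarrow> real ^ 'a" assume u: "u \<in> controls" "u' \<in> controls"
  have "\<bar>mean_control h u $ i - mean_control h u' $ i\<bar> \<le> L1_dist u u' / h" for i
  proof -
    have "dist (\<integral>s. indicator {0..<h} s * u s $ i \<partial>lebesgue_on {0..1})
      (\<integral>s. indicator {0..<h} s * u' s $ i \<partial>lebesgue_on {0..1}) \<le> 1 * L1_dist u u'"
    proof (rule integral_unit_diff_le_L1_dist[OF u integrable_indicator_component])
      show "\<bar>indicator {0..<h} s * x $ i - indicator {0..<h} s * y $ i\<bar> \<le> 1 * norm (x - y)"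
        for s and x y :: "real ^ 'a"
        using component_le_norm_cart[of "x - y" i] by (simp add: indicator_def)
    qed
    then have "\<bar>(\<integral>s. indicator {0..<h} s * u s $ i \<partial>lebesgue_on {0..1}) -
      (\<integral>s. indicator {0..<h} s * u' s $ i \<partial>lebesgue_on {0..1})\<bar> / h \<le> L1_dist u u' / h"
      using h by (intro divide_right_mono) (auto simp: dist_real_def)
    then show ?thesis
      unfolding mean_control_def vec_lambda_beta diff_divide_distrib[symmetric] abs_divide using h by simp
  qed
  then have "(\<Sum>i\<in>UNIV. \<bar>(mean_control h u - mean_control h u') $ i\<bar>) \<le> (\<Sum>i\<in>(UNIV::'a set). L1_dist u u' / h)"
    by (intro sum_mono) simp
  then show "dist (mean_control h u) (mean_control h u') \<le> (CARD('a) / h) * L1_dist u u'"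
    using norm_le_l1_cart[of "mean_control h u - mean_control h u'"] by (simp add: dist_norm)
qed (use h in simp)

lemma mean_control_cong:
  assumes "u \<in> controls" "u' \<in> controls" "eq_upto h u u'"
  shows "mean_control h u = mean_control h u'"
proof -
  have "(\<integral>s. indicator {0..<h} s * u s $ i \<partial>lebesgue_on {0..1}) =
    (\<integral>s. indicator {0..<h} s * u' s $ i \<partial>lebesgue_on {0..1})" for i
  proof (rule integral_cong_AE)
    have "AE s in lebesgue. s \<in> {0..1} \<longrightarrow> indicator {0..<h} s * u s $ i = indicator {0..<h} s * u' s $ i"
      using assms(3) unfolding eq_upto_def by eventually_elim (auto simp: indicator_def)
    then show "AE s in lebesgue_on {0..1}. indicator {0..<h} s * u s $ i = indicator {0..<h} s * u' s $ i"
      by (subst AE_restrict_space_iff) auto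
  qed (use integrable_indicator_component assms in \<open>blast dest: borel_measurable_integrable\<close>)+
  then show ?thesis by (simp add: mean_control_def)
qed

lemma eq_upto_prefix_const: "eq_upto h (prefix_control h b v) (const_control b)"
proof -
  have "AE s in lebesgue. s \<noteq> h"
    using AE_not_in[of "{h}" lebesgue] by simp
  then show ?thesis
    unfolding eq_upto_def
    by eventually_elim (use h in \<open>auto simp: prefix_control_def const_control_def\<close>)
qed

lemma eq_upto_tail:
  assumes "eq_upto (h + (1 - h) * y) u u'" "y \<le> 1"
  shows "eq_upto y (tail_control h u) (tail_control h u')"
proof -
  have "AE s in lebesgue. h + (1 - h) * s \<in> {0..h + (1 - h) * y} \<longrightarrow>
    u (h + (1 - h) * s) = u' (h + (1 - h) * s)"
    using AE_lebesgue_affine[OF assms(1)[unfolded eq_upto_def], of "1 - h" h] h by simp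
  then show ?thesis
    unfolding eq_upto_def
  proof eventually_elim
    case (elim s)
    show ?case
    proof
      assume s: "s \<in> {0..y}"
      then have "(1 - h) * s \<le> (1 - h) * y" "0 \<le> (1 - h) * s"
        using h by (auto intro: mult_left_mono)
      then show "tail_control h u s = tail_control h u' s"
        using elim h by (simp add: tail_control_def)
    qed
  qed
qed

lemma eq_upto_prefix:
  assumes "eq_upto x v v'"
  shows "eq_upto (h + (1 - h) * x) (prefix_control h b v) (prefix_control h b v')"
proof -
  have quot: "(t - h) / (1 - h) = - h / (1 - h) + (1 / (1 - h)) * t" for t
    by (simp add: diff_divide_distrib)
  have "AE t in lebesgue. (t - h) / (1 - h) \<in> {0..x} \<longrightarrow> v ((t - h) / (1 - h)) = v' ((t - h) / (1 - h))"
    using AE_lebesgue_affine[OF assms[unfolded eq_upto_def], of "1 / (1 - h)" "- h / (1 - h)"] h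
    unfolding quot by simp
  then show ?thesis
    unfolding eq_upto_def
  proof eventually_elim
    case (elim t)
    show ?case
    proof
      assume t: "t \<in> {0..h + (1 - h) * x}"
      show "prefix_control h b v t = prefix_control h b v' t"
      proof (cases "t < h")
        case False
        then have "(t - h) / (1 - h) \<in> {0..x}"
          using t h by (auto simp: field_simps)
        then show ?thesis using elim by (simp add: prefix_control_def)
      qed (simp add: prefix_control_def)
    qed
  qed
qed

section \<open>Payoffs and strategies across time \<open>h\<close>\<close>

lemma running_payoff_split:
  assumes u: "u \<in> controls" and v: "v \<in> controls" and b: "b \<in> prob_simplex"
  shows "running_payoff A (u, prefix_control h b v) =
    h * (mean_control h u \<bullet> (A *v b)) + (1 - h) * running_payoff A (tail_control h u, v)"
proof -
  let ?w = "prefix_control h b v"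
  have w: "?w \<in> controls" by (rule prefix_control_in_controls[OF b v])
  have "(\<integral>s. indicator {0..<h} s * (u s \<bullet> (A *v ?w s)) \<partial>lebesgue_on {0..1}) =
    (\<integral>s. (\<Sum>i\<in>UNIV. (A *v b) $ i * (indicator {0..<h} s * u s $ i)) \<partial>lebesgue_on {0..1})"
    by (intro Bochner_Integration.integral_cong)
      (auto simp: prefix_control_def space_restrict_space indicator_def inner_vec_def mult.commute)
  also have "\<dots> = (\<Sum>i\<in>UNIV. (A *v b) $ i * (\<integral>s. indicator {0..<h} s * u s $ i \<partial>lebesgue_on {0..1}))"
    using integrable_indicator_component[OF u] by simp
  also have "\<dots> = h * (mean_control h u \<bullet> (A *v b))"
    using h by (simp add: inner_vec_def mean_control_def sum_distrib_left mult.commute)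
  finally have head: "(\<integral>s. indicator {0..<h} s * (u s \<bullet> (A *v ?w s)) \<partial>lebesgue_on {0..1}) =
    h * (mean_control h u \<bullet> (A *v b))" .
  have "(\<integral>s. u (h + (1 - h) * s) \<bullet> (A *v ?w (h + (1 - h) * s)) \<partial>lebesgue_on {0..1}) =
    (\<integral>s. tail_control h u s \<bullet> (A *v tail_control h ?w s) \<partial>lebesgue_on {0..1})"
    by (intro Bochner_Integration.integral_cong) (auto simp: tail_control_def space_restrict_space)
  then show ?thesis
    using integral_split_head_tail[OF integrable_running_payoff[OF u w, of A]] head
    by (simp add: running_payoff_def tail_prefix_control[OF v])
qed

text \<open>The continuation of a strategy of player 1 once player 2 has played \<open>b\<close>
  before \<open>h\<close>, seen as a strategy on the unit interval.\<close>

definition tail_response ::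
  "real ^ 'b::finite \<Rightarrow> ((real \<Rightarrow> real ^ 'b) \<Rightarrow> real \<Rightarrow> real ^ 'a::finite) \<Rightarrow>
   (real \<Rightarrow> real ^ 'b) \<Rightarrow> real \<Rightarrow> real ^ 'a" where
  "tail_response b a = (\<lambda>v. tail_control h (a (prefix_control h b v)))"

lemma tail_response_det_strategy:
  assumes "det_strategy a" "b \<in> prob_simplex"
  shows "det_strategy (tail_response b a)"
proof -
  have a: "a \<in> control_space \<rightarrow>\<^sub>M control_space"
    using assms(1) by (simp add: det_strategy_def)
  obtain S where S: "finite S" "delayed S a"
    using assms(1) by (auto simp: det_strategy_def)
  have "tail_response b a \<in> control_space \<rightarrow>\<^sub>M control_space"
    unfolding tail_response_def
    by (rule measurable_compose[OF measurable_compose[OF prefix_control_measurable[OF assms(2)] a]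
          tail_control_measurable])
  moreover have "delayed ((\<lambda>s. (s - h) / (1 - h)) ` S) (tail_response b a)"
    unfolding delayed_def
  proof (intro allI ballI impI, elim conjE)
    fix x y and v1 v2 :: "real \<Rightarrow> real ^ 'a"
    assume v: "v1 \<in> controls" "v2 \<in> controls" and xy: "0 \<le> x" "x < y" "y \<le> 1"
      and gap: "(\<lambda>s. (s - h) / (1 - h)) ` S \<inter> {x<..<y} = {}" and eq: "eq_upto x v1 v2"
    have "S \<inter> {h + (1 - h) * x<..<h + (1 - h) * y} = {}"
    proof (rule ccontr)
      assume "S \<inter> {h + (1 - h) * x<..<h + (1 - h) * y} \<noteq> {}"
      then obtain s where s: "s \<in> S" "h + (1 - h) * x < s" "s < h + (1 - h) * y" by auto
      then have "(s - h) / (1 - h) \<in> {x<..<y}" using h by (auto simp: field_simps)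
      then show False using gap s(1) by blast
    qed
    moreover have "h + (1 - h) * x < h + (1 - h) * y" "0 \<le> h + (1 - h) * x"
      using xy h by (auto intro!: add_nonneg_nonneg mult_nonneg_nonneg)
    moreover have "h + (1 - h) * y \<le> 1" using affine_tail_mem[of y] xy by simp
    ultimately have "eq_upto (h + (1 - h) * y) (a (prefix_control h b v1)) (a (prefix_control h b v2))"
      by (intro delayedD[OF S(2) _ _ _ _ _ _ eq_upto_prefix[OF eq]] prefix_control_in_controls assms v)
    then show "eq_upto y (tail_response b a v1) (tail_response b a v2)"
      unfolding tail_response_def using xy(3) by (rule eq_upto_tail)
  qed
  ultimately show ?thesis
    using S(1) by (auto simp: det_strategy_def)
qed

text \<open>The \<open>\<beta> j\<close> are strategies for the game after time \<open>h\<close>, rescaled to \<open>[0, 1]\<close>.\<close>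

definition concat_strategy ::
  "real ^ 'a::finite \<Rightarrow> (real ^ 'b::finite \<Rightarrow> nat) \<Rightarrow> (nat \<Rightarrow> ('b, 'a) strategy) \<Rightarrow> nat \<Rightarrow> ('b, 'a) strategy" where
  "concat_strategy b sel \<beta> M = (M, \<lambda>\<omega> u.
     prefix_control h b (snd (\<beta> (sel (mean_control h u))) \<omega> (tail_control h u)))"

text \<open>The selection uses only what happened before \<open>h\<close>, and \<open>h\<close>
  itself becomes a delay time. The bound \<open>n\<close> on the selector keeps the union of the
  rescaled delay sets finite.\<close>

lemma concat_strategy_random:
  fixes sel :: "real ^ 'b::finite \<Rightarrow> nat" and b :: "real ^ 'a::finite"
  assumes b: "b \<in> prob_simplex" and sel: "sel \<in> borel \<rightarrow>\<^sub>M count_space UNIV"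
    and less: "\<And>x. x \<in> prob_simplex \<Longrightarrow> sel x < n"
    and \<beta>: "\<And>j. \<beta> j \<in> random_strategies" "\<And>j. fst (\<beta> j) = M"
  shows "concat_strategy b sel \<beta> M \<in> random_strategies"
proof -
  have "\<exists>S. finite S \<and> (\<forall>\<omega>\<in>space (cube M). delayed S (snd (\<beta> j) \<omega>))" for j
    using random_strategiesD(3)[OF \<beta>(1)[of j]] \<beta>(2) by simp
  then obtain S where S: "\<And>j. finite (S j)" "\<And>j \<omega>. \<omega> \<in> space (cube M) \<Longrightarrow> delayed (S j) (snd (\<beta> j) \<omega>)"
    by metis
  let ?P = "cube M \<Otimes>\<^sub>M control_space"
  have "(\<lambda>x. sel (mean_control h (snd x))) \<in> ?P \<rightarrow>\<^sub>M count_space UNIV"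
    by (rule measurable_compose[OF measurable_snd measurable_compose[OF mean_control_measurable sel]])
  moreover have "(\<lambda>x. snd (\<beta> j) (fst x) (tail_control h (snd x))) \<in> ?P \<rightarrow>\<^sub>M control_space" for j
    using measurable_compose[OF measurable_Pair[OF measurable_fst
          measurable_compose[OF measurable_snd tail_control_measurable]]
        random_strategiesD(2)[OF \<beta>(1)[of j], unfolded \<beta>(2)]] by simp
  ultimately have "(\<lambda>x. snd (\<beta> (sel (mean_control h (snd x)))) (fst x) (tail_control h (snd x)))
    \<in> ?P \<rightarrow>\<^sub>M control_space"
    by (rule measurable_compose_countable[rotated])
  from measurable_compose[OF this prefix_control_measurable[OF b]]
  have "(\<lambda>(\<omega>, u). prefix_control h b (snd (\<beta> (sel (mean_control h u))) \<omega> (tail_control h u)))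
    \<in> ?P \<rightarrow>\<^sub>M control_space"
    by (simp add: case_prod_unfold)
  moreover define T where "T = insert h (\<Union>j<n. (\<lambda>s. h + (1 - h) * s) ` S j)"
  have "delayed T (\<lambda>u. prefix_control h b (snd (\<beta> (sel (mean_control h u))) \<omega> (tail_control h u)))"
    if \<omega>: "\<omega> \<in> space (cube M)" for \<omega>
    unfolding delayed_def
  proof (intro allI ballI impI, elim conjE)
    fix x y and u1 u2 :: "real \<Rightarrow> real ^ 'b"
    assume u: "u1 \<in> controls" "u2 \<in> controls" and xy: "0 \<le> x" "x < y" "y \<le> 1"
      and gap: "T \<inter> {x<..<y} = {}" and eq: "eq_upto x u1 u2"
    let ?r = "\<lambda>u. snd (\<beta> (sel (mean_control h u))) \<omega> (tail_control h u)"
    show "eq_upto y (prefix_control h b (?r u1)) (prefix_control h b (?r u2))"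
    proof (cases "x < h")
      case True
      \<comment> \<open>As \<open>h\<close> lies in \<open>T\<close>, a gap that starts before
        \<open>h\<close> ends no later than \<open>h\<close>, and up to there the output is the
        constant \<open>b\<close>.\<close>
      then have "y \<le> h" using gap by (auto simp: T_def)
      have "eq_upto h (prefix_control h b (?r u1)) (prefix_control h b (?r u2))"
        by (rule eq_upto_trans[OF eq_upto_prefix_const eq_upto_sym[OF eq_upto_prefix_const]])
      then show ?thesis using \<open>y \<le> h\<close> by (rule eq_upto_mono)
    next
      case False
      define x' where "x' = (x - h) / (1 - h)"
      define y' where "y' = (y - h) / (1 - h)"
      have "x' < y'"
        unfolding x'_def y'_def using h xy by (intro divide_strict_right_mono) auto
      moreover have "y' \<le> 1" "0 \<le> x'"
        using h xy False by (auto simp: x'_def y'_def)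
      ultimately have x'y': "x = h + (1 - h) * x'" "y = h + (1 - h) * y'" "0 \<le> x'" "x' < y'" "y' \<le> 1"
        using h by (auto simp: x'_def y'_def)
      have mean: "mean_control h u2 = mean_control h u1"
        using mean_control_cong[OF u eq_upto_mono[OF eq]] False by simp
      define j where "j = sel (mean_control h u1)"
      have "j < n" using less mean_control_in_prob_simplex[OF u(1)] by (simp add: j_def)
      have "S j \<inter> {x'<..<y'} = {}"
      proof (rule ccontr)
        assume "S j \<inter> {x'<..<y'} \<noteq> {}"
        then obtain s where s: "s \<in> S j" "x' < s" "s < y'" by auto
        then have "h + (1 - h) * s \<in> T" using \<open>j < n\<close> by (auto simp: T_def)
        moreover have "h + (1 - h) * s \<in> {x<..<y}" using s h by (simp add: x'y'(1,2))
        ultimately show False using gap by blast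
      qed
      moreover have "eq_upto x' (tail_control h u1) (tail_control h u2)"
        using eq x'y' by (intro eq_upto_tail) auto
      ultimately have "eq_upto y' (snd (\<beta> j) \<omega> (tail_control h u1)) (snd (\<beta> j) \<omega> (tail_control h u2))"
        using x'y' by (intro delayedD[OF S(2)[OF \<omega>]] tail_control_in_controls u)
      then have "eq_upto y' (?r u1) (?r u2)" by (simp add: mean j_def)
      then show ?thesis unfolding x'y'(2) by (rule eq_upto_prefix)
    qed
  qed
  moreover have "finite T" using S(1) by (simp add: T_def)
  ultimately show ?thesis
    unfolding concat_strategy_def random_strategies_iff
    using random_strategiesD(1)[OF \<beta>(1)[of 0]] \<beta>(2) by (intro conjI exI[of _ T]) auto
qed

text \<open>Controls induced in the tail game become controls induced in the whole game by putting
  \<open>b\<close> in front. As \<open>a\<close> is nonanticipative, its mean before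
  \<open>h\<close> is that of its reply to the constant \<open>b\<close>, so the index
  \<open>sel m\<close> is the same for all random events of player 2.\<close>

lemma det_payoff_concat:
  fixes sel :: "real ^ 'b::finite \<Rightarrow> nat" and b :: "real ^ 'a::finite"
  assumes b: "b \<in> prob_simplex" and sel: "sel \<in> borel \<rightarrow>\<^sub>M count_space UNIV"
    and less: "\<And>x. x \<in> prob_simplex \<Longrightarrow> sel x < n"
    and \<beta>: "\<And>j. \<beta> j \<in> random_strategies" "\<And>j. fst (\<beta> j) = M"
    and a: "det_strategy a"
  defines "m \<equiv> mean_control h (a (const_control b))"
  shows "det_payoff A a (concat_strategy b sel \<beta> M) =
    h * (m \<bullet> (A *v b)) + (1 - h) * det_payoff A (tail_response b a) (\<beta> (sel m))"
proof -
  let ?j = "sel m" and ?a' = "tail_response b a"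
  let ?C = "concat_strategy b sel \<beta> M"
  have C: "?C \<in> random_strategies" by (rule concat_strategy_random[OF b sel less \<beta>])
  have fst_C: "fst ?C = M" by (simp add: concat_strategy_def)
  have a': "det_strategy ?a'" by (rule tail_response_det_strategy[OF a b])
  obtain S where S: "finite S" "delayed S a" using a by (auto simp: det_strategy_def)
  have pointwise: "running_payoff A (induced_controls a (snd ?C \<omega>)) =
    h * (m \<bullet> (A *v b)) + (1 - h) * running_payoff A (induced_controls ?a' (snd (\<beta> ?j) \<omega>))"
    if \<omega>: "\<omega> \<in> space (cube M)" for \<omega>
  proof -
    obtain \<omega>1 where \<omega>1: "\<omega>1 \<in> space (cube 1)"
      using prob_space.not_empty[OF prob_space_cube] by blast
    have \<omega>': "\<omega> \<in> space (cube (fst (\<beta> ?j)))" using \<omega> \<beta>(2) by simp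
    obtain u' v' where eq: "induced_controls ?a' (snd (\<beta> ?j) \<omega>) = (u', v')" by fastforce
    then have "plays_induce ?a' (snd (\<beta> ?j) \<omega>) u' v'"
      using strategies_induce(1)[OF det_strategy_random[OF a'] \<beta>(1)[of ?j] _ \<omega>', of \<omega>1] \<omega>1 by simp
    then have uv': "u' \<in> controls" "v' \<in> controls" "eq_upto 1 (?a' v') u'" "eq_upto 1 (snd (\<beta> ?j) \<omega> u') v'"
      by (auto simp: plays_induce_def)
    define v where "v = prefix_control h b v'"
    define u where "u = a v"
    have v: "v \<in> controls" unfolding v_def by (rule prefix_control_in_controls[OF b uv'(2)])
    have u: "u \<in> controls" unfolding u_def by (rule det_strategy_in_controls[OF a v])
    have const: "const_control b \<in> controls" by (rule const_control_in_controls[OF b])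
    have "eq_upto h u (a (const_control b))"
      unfolding u_def using h
      by (intro delayed_nonanticipative[OF S v const]) (auto simp: v_def eq_upto_prefix_const)
    then have mean: "mean_control h u = m"
      unfolding m_def by (rule mean_control_cong[OF u det_strategy_in_controls[OF a const]])
    have tail_u: "tail_control h u = ?a' v'"
      by (simp add: tail_response_def u_def v_def)
    obtain T where T: "finite T" "delayed T (snd (\<beta> ?j) \<omega>)"
      using random_strategiesD(3)[OF \<beta>(1)[of ?j]] \<omega>' by auto
    have "eq_upto 1 (snd (\<beta> ?j) \<omega> (tail_control h u)) (snd (\<beta> ?j) \<omega> u')"
      unfolding tail_u
      by (intro delayed_nonanticipative[OF T] det_strategy_in_controls[OF a'] uv') auto
    then have "eq_upto 1 (snd (\<beta> ?j) \<omega> (tail_control h u)) v'"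
      using uv'(4) by (rule eq_upto_trans)
    then have "eq_upto 1 (snd ?C \<omega> u) v"
      using eq_upto_prefix[of 1 _ v' b] by (simp add: concat_strategy_def mean v_def)
    then have "plays_induce a (snd ?C \<omega>) u v"
      using u v by (simp add: plays_induce_def u_def)
    then have "running_payoff A (induced_controls a (snd ?C \<omega>)) = running_payoff A (u, v)"
      using strategies_induce(2)[OF det_strategy_random[OF a] C, of \<omega>1 \<omega>] \<omega> \<omega>1 fst_C by simp
    also have "\<dots> = h * (m \<bullet> (A *v b)) + (1 - h) * running_payoff A (tail_control h u, v')"
      unfolding v_def by (simp add: running_payoff_split[OF u uv'(2) b] mean)
    also have "running_payoff A (tail_control h u, v') = running_payoff A (u', v')"
      unfolding tail_u using uv' det_strategy_in_controls[OF a']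
      by (intro running_payoff_cong) auto
    finally show ?thesis by (simp add: eq)
  qed
  interpret prob_space "cube M" by (rule prob_space_cube)
  have "det_payoff A a ?C = (\<integral>\<omega>. h * (m \<bullet> (A *v b)) +
      (1 - h) * running_payoff A (induced_controls ?a' (snd (\<beta> ?j) \<omega>)) \<partial>cube M)"
    unfolding det_payoff_def fst_C by (intro Bochner_Integration.integral_cong refl pointwise)
  also have "\<dots> = h * (m \<bullet> (A *v b)) + (1 - h) * det_payoff A ?a' (\<beta> ?j)"
    using det_payoff_bounded_measurable(3)[OF a' \<beta>(1)[of ?j], of A] \<beta>(2)
    by (subst Bochner_Integration.integral_add) (auto simp: det_payoff_def prob_space)
  finally show ?thesis .
qed

end

section \<open>The upper value\<close>

lemma random_strategies_nonempty:
  "(random_strategies :: ('b::finite, 'a::finite) strategy set) \<noteq> {}"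
proof -
  have c: "const_control (axis undefined 1) \<in> (controls :: (real \<Rightarrow> real ^ 'a) set)"
    by (intro const_control_in_controls axis_in_prob_simplex)
  then have "det_strategy (\<lambda>v :: real \<Rightarrow> real ^ 'b. const_control (axis undefined 1 :: real ^ 'a))"
    unfolding det_strategy_def delayed_def by (auto intro: exI[of _ "{}"])
  then show ?thesis using det_strategy_random by blast
qed

abbreviation profiles :: "('k \<Rightarrow> ('b::finite, 'a::finite) strategy) set" where
  "profiles \<equiv> {\<alpha>. \<forall>k. \<alpha> k \<in> random_strategies}"

lemma profiles_nonempty: "(profiles :: ('k \<Rightarrow> ('b::finite, 'a::finite) strategy) set) \<noteq> {}"
proof -
  obtain s :: "('b, 'a) strategy" where "s \<in> random_strategies"
    using random_strategies_nonempty by blast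
  then show ?thesis by (auto intro!: exI[of _ "\<lambda>_. s"])
qed

section \<open>Payoffs of profiles and almost optimal strategies\<close>

lemma payoff_eq:
  "payoff G \<pi> \<alpha> \<beta> = (\<Sum>(k, l)\<in>UNIV. \<pi> $ (k, l) * expected_payoff (G k l) (\<alpha> k) (\<beta> l))"
  unfolding payoff_def expected_payoff_def ..

definition payoff_scale ::
  "('k::finite \<Rightarrow> 'l::finite \<Rightarrow> real ^ 'j::finite ^ 'i::finite) \<Rightarrow> real" where
  "payoff_scale G = (\<Sum>(k, l)\<in>UNIV. matrix_bound (G k l))"

lemma matrix_bound_nonneg: "0 \<le> matrix_bound A"
  unfolding matrix_bound_def by (intro sum_nonneg) auto

lemma payoff_scale_nonneg: "0 \<le> payoff_scale G"
  unfolding payoff_scale_def by (intro sum_nonneg) (auto simp: matrix_bound_nonneg)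

lemma payoff_diff_le:
  assumes "\<alpha> \<in> profiles" "\<beta> \<in> profiles"
  shows "payoff G \<pi> \<alpha> \<beta> - payoff G \<pi>' \<alpha> \<beta> \<le> payoff_scale G * norm (\<pi> - \<pi>')"
proof -
  have "payoff G \<pi> \<alpha> \<beta> - payoff G \<pi>' \<alpha> \<beta> =
    (\<Sum>(k, l)\<in>UNIV. (\<pi> - \<pi>') $ (k, l) * expected_payoff (G k l) (\<alpha> k) (\<beta> l))"
    unfolding payoff_eq sum_subtractf[symmetric]
    by (intro sum.cong) (auto simp: left_diff_distrib)
  also have "\<dots> \<le> (\<Sum>(k, l)\<in>UNIV. matrix_bound (G k l) * norm (\<pi> - \<pi>'))"
  proof (intro sum_mono, clarify)
    fix k l
    have "(\<pi> - \<pi>') $ (k, l) * expected_payoff (G k l) (\<alpha> k) (\<beta> l)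
      \<le> \<bar>(\<pi> - \<pi>') $ (k, l)\<bar> * \<bar>expected_payoff (G k l) (\<alpha> k) (\<beta> l)\<bar>"
      by (simp flip: abs_mult)
    also have "\<dots> \<le> norm (\<pi> - \<pi>') * matrix_bound (G k l)"
      using assms by (intro mult_mono component_le_norm_cart expected_payoff_bound) auto
    finally show "(\<pi> - \<pi>') $ (k, l) * expected_payoff (G k l) (\<alpha> k) (\<beta> l)
      \<le> matrix_bound (G k l) * norm (\<pi> - \<pi>')"
      by (simp add: mult.commute)
  qed
  also have "\<dots> = payoff_scale G * norm (\<pi> - \<pi>')"
    by (simp add: payoff_scale_def sum_distrib_right case_prod_unfold)
  finally show ?thesis .
qed

lemma payoff_bound:
  assumes "\<alpha> \<in> profiles" "\<beta> \<in> profiles"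
  shows "\<bar>payoff G \<pi> \<alpha> \<beta>\<bar> \<le> payoff_scale G * norm \<pi>"
proof -
  have "payoff G 0 \<alpha> \<beta> = 0" by (simp add: payoff_eq)
  then show ?thesis
    using payoff_diff_le[OF assms, of G \<pi> 0] payoff_diff_le[OF assms, of G 0 \<pi>] by (simp add: abs_le_iff)
qed

lemma bdd_payoff:
  assumes "\<beta> \<in> profiles"
  shows "bdd_above ((\<lambda>\<alpha>. payoff G \<pi> \<alpha> \<beta>) ` profiles)"
  using payoff_bound[OF _ assms, of _ G \<pi>] by (intro bdd_aboveI2[of _ _ "payoff_scale G * norm \<pi>"]) (simp add: abs_le_iff)

lemma bdd_payoff':
  assumes "\<alpha> \<in> profiles"
  shows "bdd_below ((\<lambda>\<beta>. payoff G \<pi> \<alpha> \<beta>) ` profiles)"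
  using payoff_bound[OF assms, of _ G \<pi>]
  by (intro bdd_belowI2[of _ "- (payoff_scale G * norm \<pi>)"]) (simp add: abs_le_iff minus_le_iff)

lemma bdd_SUP_payoff:
  fixes G :: "'k::finite \<Rightarrow> 'l::finite \<Rightarrow> real ^ 'j::finite ^ 'i::finite"
  shows "bdd_below ((\<lambda>\<beta>. SUP \<alpha>\<in>profiles. payoff G \<pi> \<alpha> \<beta>) ` profiles)"
proof (rule bdd_belowI2)
  fix \<beta> :: "'l \<Rightarrow> ('i, 'j) strategy" assume \<beta>: "\<beta> \<in> profiles"
  obtain \<alpha> :: "'k \<Rightarrow> ('j, 'i) strategy" where \<alpha>: "\<alpha> \<in> profiles" using profiles_nonempty by blast
  have "- (payoff_scale G * norm \<pi>) \<le> payoff G \<pi> \<alpha> \<beta>"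
    using payoff_bound[OF \<alpha> \<beta>, of G \<pi>] by (simp add: abs_le_iff)
  also have "\<dots> \<le> (SUP \<alpha>\<in>profiles. payoff G \<pi> \<alpha> \<beta>)"
    by (rule cSUP_upper[OF \<alpha> bdd_payoff[OF \<beta>]])
  finally show "- (payoff_scale G * norm \<pi>) \<le> (SUP \<alpha>\<in>profiles. payoff G \<pi> \<alpha> \<beta>)" .
qed

lemma upper_value_le:
  assumes "\<beta> \<in> profiles" "\<And>\<alpha>. \<alpha> \<in> profiles \<Longrightarrow> payoff G \<pi> \<alpha> \<beta> \<le> c"
  shows "upper_value G \<pi> \<le> c"
proof -
  have "upper_value G \<pi> \<le> (SUP \<alpha>\<in>profiles. payoff G \<pi> \<alpha> \<beta>)"
    unfolding upper_value_def by (rule cINF_lower[OF bdd_SUP_payoff assms(1)])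
  also have "\<dots> \<le> c"
    using assms(2) by (intro cSUP_least profiles_nonempty)
  finally show ?thesis .
qed

lemma upper_value_less:
  assumes "upper_value G \<pi> < c"
  shows "\<exists>\<beta>\<in>profiles. \<forall>\<alpha>\<in>profiles. payoff G \<pi> \<alpha> \<beta> \<le> c"
proof -
  obtain \<beta> where \<beta>: "\<beta> \<in> profiles" "(SUP \<alpha>\<in>profiles. payoff G \<pi> \<alpha> \<beta>) < c"
    using assms unfolding upper_value_def cINF_less_iff[OF profiles_nonempty bdd_SUP_payoff] by blast
  have "payoff G \<pi> \<alpha> \<beta> \<le> c" if "\<alpha> \<in> profiles" for \<alpha>
    using cSUP_upper[OF that bdd_payoff[OF \<beta>(1)], of G \<pi>] \<beta>(2) by linarith
  with \<beta>(1) show ?thesis by blast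
qed

lemma lower_le_upper_value:
  fixes G :: "'k::finite \<Rightarrow> 'l::finite \<Rightarrow> real ^ 'j::finite ^ 'i::finite"
  shows "lower_value G \<pi> \<le> upper_value G \<pi>"
  unfolding lower_value_def
proof (intro cSUP_least profiles_nonempty)
  fix \<alpha> :: "'k \<Rightarrow> ('j, 'i) strategy" assume \<alpha>: "\<alpha> \<in> profiles"
  show "(INF \<beta>\<in>profiles. payoff G \<pi> \<alpha> \<beta>) \<le> upper_value G \<pi>"
    unfolding upper_value_def
  proof (intro cINF_greatest profiles_nonempty)
    fix \<beta> :: "'l \<Rightarrow> ('i, 'j) strategy" assume \<beta>: "\<beta> \<in> profiles"
    show "(INF \<beta>\<in>profiles. payoff G \<pi> \<alpha> \<beta>) \<le> (SUP \<alpha>\<in>profiles. payoff G \<pi> \<alpha> \<beta>)"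
      using cINF_lower[OF bdd_payoff'[OF \<alpha>] \<beta>, of G \<pi>] cSUP_upper[OF \<alpha> bdd_payoff[OF \<beta>], of G \<pi>]
      by linarith
  qed
qed

lemma payoff_swap:
  assumes "\<alpha> \<in> profiles" "\<beta> \<in> profiles"
  shows "payoff (swap_game G) (swap_vec \<pi>) \<beta> \<alpha> = - payoff G \<pi> \<alpha> \<beta>"
proof -
  have "payoff (swap_game G) (swap_vec \<pi>) \<beta> \<alpha> =
    (\<Sum>(l, k)\<in>UNIV. - (\<pi> $ (k, l) * expected_payoff (G k l) (\<alpha> k) (\<beta> l)))"
    unfolding payoff_eq swap_game_def using assms
    by (auto intro!: sum.cong simp: expected_payoff_swap)
  also have "\<dots> = (\<Sum>(k, l)\<in>UNIV. - (\<pi> $ (k, l) * expected_payoff (G k l) (\<alpha> k) (\<beta> l)))"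
    by (rule sum_swap_pair[symmetric])
  finally show ?thesis
    by (simp add: payoff_eq case_prod_unfold sum_negf)
qed

lemma lower_value_eq_swap: "lower_value G = swap_fun (upper_value (swap_game G))"
proof
  fix \<pi>
  have "upper_value (swap_game G) (swap_vec \<pi>) =
    (INF \<alpha>\<in>profiles. SUP \<beta>\<in>profiles. - payoff G \<pi> \<alpha> \<beta>)"
    unfolding upper_value_def by (intro INF_cong SUP_cong refl payoff_swap) auto
  then show "lower_value G \<pi> = swap_fun (upper_value (swap_game G)) \<pi>"
    unfolding lower_value_def swap_fun_def
    by (simp add: Inf_real_def image_image)
qed

lemma upper_value_lipschitz:
  fixes G :: "'k::finite \<Rightarrow> 'l::finite \<Rightarrow> real ^ 'j::finite ^ 'i::finite"
  shows "(payoff_scale G)-lipschitz_on S (upper_value G)"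
proof -
  have "upper_value G x \<le> upper_value G y + payoff_scale G * norm (x - y)" for x y
  proof (rule field_le_epsilon)
    fix e :: real assume "e > 0"
    then obtain \<beta> where \<beta>: "\<beta> \<in> profiles" "\<And>\<alpha>. \<alpha> \<in> profiles \<Longrightarrow> payoff G y \<alpha> \<beta> \<le> upper_value G y + e"
      using upper_value_less[of G y "upper_value G y + e"] by auto
    show "upper_value G x \<le> upper_value G y + payoff_scale G * norm (x - y) + e"
    proof (rule upper_value_le[OF \<beta>(1)])
      fix \<alpha> :: "'k \<Rightarrow> ('j, 'i) strategy" assume "\<alpha> \<in> profiles"
      then show "payoff G x \<alpha> \<beta> \<le> upper_value G y + payoff_scale G * norm (x - y) + e"
        using payoff_diff_le[OF _ \<beta>(1), of \<alpha> G x y] \<beta>(2)[of \<alpha>] by simp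
    qed
  qed
  then have "\<bar>upper_value G x - upper_value G y\<bar> \<le> payoff_scale G * norm (x - y)" for x y
    using norm_minus_commute[of x y] by (simp add: abs_le_iff) (metis add.commute diff_le_eq)
  then show ?thesis
    by (intro lipschitz_onI payoff_scale_nonneg) (simp add: dist_norm)
qed

text \<open>What type \<open>k\<close> of player 1 can obtain against \<open>\<beta>\<close> when
  \<open>l\<close> has the law \<open>Q $ k\<close>. The payoff is a sum over the types weighted by
  \<open>p\<close>, and player 1 maximizes each term separately; for fixed \<open>\<beta>\<close>
  the best total is therefore linear in \<open>p\<close>.\<close>

definition best_response ::
  "('k::finite \<Rightarrow> 'l::finite \<Rightarrow> real ^ 'j::finite ^ 'i::finite) \<Rightarrow> real ^ 'l ^ 'k \<Rightarrow>
   ('l \<Rightarrow> ('i, 'j) strategy) \<Rightarrow> 'k \<Rightarrow> real" where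
  "best_response G Q \<beta> k =
     (SUP \<alpha>\<in>random_strategies. \<Sum>l\<in>UNIV. Q $ k $ l * expected_payoff (G k l) \<alpha> (\<beta> l))"

lemma payoff_disintK:
  "payoff G (disintK p Q) \<alpha> \<beta> =
    (\<Sum>k\<in>UNIV. p $ k * (\<Sum>l\<in>UNIV. Q $ k $ l * expected_payoff (G k l) (\<alpha> k) (\<beta> l)))"
  unfolding payoff_eq disintK_def
  by (simp add: sum_distrib_left mult.assoc sum.cartesian_product case_prod_unfold)

lemma bdd_response:
  fixes G :: "'k::finite \<Rightarrow> 'l::finite \<Rightarrow> real ^ 'j::finite ^ 'i::finite"
  assumes "\<beta> \<in> profiles"
  shows "bdd_above ((\<lambda>\<alpha>. \<Sum>l\<in>UNIV. Q $ k $ l * expected_payoff (G k l) \<alpha> (\<beta> l)) ` random_strategies)"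
proof (rule bdd_aboveI2)
  fix \<alpha> :: "('j, 'i) strategy" assume \<alpha>: "\<alpha> \<in> random_strategies"
  have "Q $ k $ l * expected_payoff (G k l) \<alpha> (\<beta> l) \<le> \<bar>Q $ k $ l\<bar> * matrix_bound (G k l)" for l
  proof -
    have "Q $ k $ l * expected_payoff (G k l) \<alpha> (\<beta> l) \<le> \<bar>Q $ k $ l\<bar> * \<bar>expected_payoff (G k l) \<alpha> (\<beta> l)\<bar>"
      by (simp flip: abs_mult)
    also have "\<dots> \<le> \<bar>Q $ k $ l\<bar> * matrix_bound (G k l)"
      using \<alpha> assms by (intro mult_left_mono expected_payoff_bound) auto
    finally show ?thesis .
  qed
  then show "(\<Sum>l\<in>UNIV. Q $ k $ l * expected_payoff (G k l) \<alpha> (\<beta> l))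
    \<le> (\<Sum>l\<in>UNIV. \<bar>Q $ k $ l\<bar> * matrix_bound (G k l))"
    by (intro sum_mono)
qed

lemma le_best_response:
  assumes "\<beta> \<in> profiles" "\<alpha> \<in> random_strategies"
  shows "(\<Sum>l\<in>UNIV. Q $ k $ l * expected_payoff (G k l) \<alpha> (\<beta> l)) \<le> best_response G Q \<beta> k"
  unfolding best_response_def by (rule cSUP_upper[OF assms(2) bdd_response[OF assms(1)]])

lemma best_response_le:
  assumes "\<And>\<alpha>. \<alpha> \<in> random_strategies \<Longrightarrow>
    (\<Sum>l\<in>UNIV. Q $ k $ l * expected_payoff (G k l) \<alpha> (\<beta> l)) \<le> c"
  shows "best_response G Q \<beta> k \<le> c"
  unfolding best_response_def by (intro cSUP_least random_strategies_nonempty assms)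

lemma upper_value_le_best_response:
  fixes G :: "'k::finite \<Rightarrow> 'l::finite \<Rightarrow> real ^ 'j::finite ^ 'i::finite"
  assumes "\<beta> \<in> profiles" "p \<in> prob_simplex"
  shows "upper_value G (disintK p Q) \<le> (\<Sum>k\<in>UNIV. p $ k * best_response G Q \<beta> k)"
proof (rule upper_value_le[OF assms(1)])
  fix \<alpha> :: "'k \<Rightarrow> ('j, 'i) strategy" assume "\<alpha> \<in> profiles"
  then show "payoff G (disintK p Q) \<alpha> \<beta> \<le> (\<Sum>k\<in>UNIV. p $ k * best_response G Q \<beta> k)"
    unfolding payoff_disintK
    using prob_simplexD(1)[OF assms(2)] by (intro sum_mono mult_left_mono le_best_response assms) auto
qed

text \<open>Almost optimal replies of all types are assembled into a single profile, so a guarantee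
  of \<open>\<beta>\<close> against profiles bounds the weighted sum of best responses.\<close>

lemma upper_value_less_best_response:
  fixes G :: "'k::finite \<Rightarrow> 'l::finite \<Rightarrow> real ^ 'j::finite ^ 'i::finite"
  assumes "upper_value G (disintK p Q) < c" "p \<in> prob_simplex"
  shows "\<exists>\<beta>\<in>profiles. (\<Sum>k\<in>UNIV. p $ k * best_response G Q \<beta> k) \<le> c"
proof -
  obtain \<beta> :: "'l \<Rightarrow> ('i, 'j) strategy" where \<beta>: "\<beta> \<in> profiles"
    and le: "\<And>\<alpha>. \<alpha> \<in> profiles \<Longrightarrow> payoff G (disintK p Q) \<alpha> \<beta> \<le> c"
    using upper_value_less[OF assms(1)] by blast
  have "(\<Sum>k\<in>UNIV. p $ k * best_response G Q \<beta> k) \<le> c"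
  proof (rule field_le_epsilon)
    fix e :: real assume "e > 0"
    have "\<exists>\<alpha>\<in>random_strategies. best_response G Q \<beta> k - e <
      (\<Sum>l\<in>UNIV. Q $ k $ l * expected_payoff (G k l) \<alpha> (\<beta> l))" for k
      using less_cSUP_iff[OF random_strategies_nonempty bdd_response[OF \<beta>],
          of "best_response G Q \<beta> k - e" Q k G] \<open>e > 0\<close> by (simp add: best_response_def)
    then have "\<exists>\<alpha>. \<forall>k. \<alpha> k \<in> random_strategies \<and> best_response G Q \<beta> k - e <
      (\<Sum>l\<in>UNIV. Q $ k $ l * expected_payoff (G k l) (\<alpha> k) (\<beta> l))"
      by (intro choice) blast
    then obtain \<alpha> where \<alpha>: "\<And>k. \<alpha> k \<in> random_strategies" "\<And>k. best_response G Q \<beta> k - e <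
      (\<Sum>l\<in>UNIV. Q $ k $ l * expected_payoff (G k l) (\<alpha> k) (\<beta> l))"
      by blast
    have "(\<Sum>k\<in>UNIV. p $ k * best_response G Q \<beta> k) - e = (\<Sum>k\<in>UNIV. p $ k * (best_response G Q \<beta> k - e))"
      using prob_simplexD(3)[OF assms(2)]
      by (simp add: right_diff_distrib sum_subtractf flip: sum_distrib_right)
    also have "\<dots> \<le> payoff G (disintK p Q) \<alpha> \<beta>"
      unfolding payoff_disintK
      using prob_simplexD(1)[OF assms(2)] \<alpha>(2) by (intro sum_mono mult_left_mono) (auto simp: less_imp_le)
    also have "\<dots> \<le> c" using le \<alpha>(1) by simp
    finally show "(\<Sum>k\<in>UNIV. p $ k * best_response G Q \<beta> k) \<le> c + e" by simp
  qed
  with \<beta> show ?thesis by blast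
qed

text \<open>For fixed \<open>Q\<close> the upper value is an infimum of functions linear in
  \<open>p\<close>, one for each \<open>\<beta>\<close>.\<close>

lemma upper_value_K_concave:
  fixes G :: "'k::finite \<Rightarrow> 'l::finite \<Rightarrow> real ^ 'j::finite ^ 'i::finite"
  shows "K_concave (upper_value G)"
  unfolding K_concave_def concave_on_iff
proof (intro allI impI conjI ballI)
  fix Q :: "real ^ 'l ^ 'k" and x y :: "real ^ 'k" and u v :: real
  assume x: "x \<in> prob_simplex" and y: "y \<in> prob_simplex" and uv: "0 \<le> u" "0 \<le> v" "u + v = 1"
  have xy: "u *\<^sub>R x + v *\<^sub>R y \<in> prob_simplex"
    by (rule convexD[OF convex_prob_simplex x y uv])
  show "u * upper_value G (disintK x Q) + v * upper_value G (disintK y Q)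
    \<le> upper_value G (disintK (u *\<^sub>R x + v *\<^sub>R y) Q)"
  proof (rule field_le_epsilon)
    fix e :: real assume "e > 0"
    then obtain \<beta> where \<beta>: "\<beta> \<in> profiles" "(\<Sum>k\<in>UNIV. (u *\<^sub>R x + v *\<^sub>R y) $ k * best_response G Q \<beta> k)
      \<le> upper_value G (disintK (u *\<^sub>R x + v *\<^sub>R y) Q) + e"
      using upper_value_less_best_response[OF _ xy,
          of G Q "upper_value G (disintK (u *\<^sub>R x + v *\<^sub>R y) Q) + e"] by auto
    have "u * upper_value G (disintK x Q) + v * upper_value G (disintK y Q) \<le>
      u * (\<Sum>k\<in>UNIV. x $ k * best_response G Q \<beta> k) + v * (\<Sum>k\<in>UNIV. y $ k * best_response G Q \<beta> k)"
      using uv by (intro add_mono mult_left_mono upper_value_le_best_response \<beta>(1) x y)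
    also have "\<dots> = (\<Sum>k\<in>UNIV. (u *\<^sub>R x + v *\<^sub>R y) $ k * best_response G Q \<beta> k)"
      by (simp add: sum_distrib_left sum.distrib[symmetric] algebra_simps)
    finally show "u * upper_value G (disintK x Q) + v * upper_value G (disintK y Q)
      \<le> upper_value G (disintK (u *\<^sub>R x + v *\<^sub>R y) Q) + e"
      using \<beta>(2) by linarith
  qed
qed (rule convex_prob_simplex)

text \<open>The informed player 2 splits: given \<open>l\<close>, it plays the strategy for \<open>x\<close> with the conditional
  probability \<open>u * x l / (u * x l + v * y l)\<close>.\<close>

lemma upper_value_L_convex:
  fixes G :: "'k::finite \<Rightarrow> 'l::finite \<Rightarrow> real ^ 'j::finite ^ 'i::finite"
  shows "L_convex (upper_value G)"
  unfolding L_convex_def convex_on_def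
proof (intro allI impI conjI ballI)
  fix P :: "real ^ 'k ^ 'l" and x y :: "real ^ 'l" and u v :: real
  assume x: "x \<in> prob_simplex" and y: "y \<in> prob_simplex" and uv: "0 \<le> u" "0 \<le> v" "u + v = 1"
  let ?q = "u *\<^sub>R x + v *\<^sub>R y"
  show "upper_value G (disintL ?q P)
    \<le> u * upper_value G (disintL x P) + v * upper_value G (disintL y P)"
  proof (rule field_le_epsilon)
    fix e :: real assume "e > 0"
    obtain \<beta> where \<beta>: "\<And>l. \<beta> l \<in> random_strategies"
      "\<And>\<alpha>. \<alpha> \<in> profiles \<Longrightarrow> payoff G (disintL x P) \<alpha> \<beta> \<le> upper_value G (disintL x P) + e"
      using upper_value_less[of G "disintL x P" "upper_value G (disintL x P) + e"] \<open>e > 0\<close> by auto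
    obtain \<beta>' where \<beta>': "\<And>l. \<beta>' l \<in> random_strategies"
      "\<And>\<alpha>. \<alpha> \<in> profiles \<Longrightarrow> payoff G (disintL y P) \<alpha> \<beta>' \<le> upper_value G (disintL y P) + e"
      using upper_value_less[of G "disintL y P" "upper_value G (disintL y P) + e"] \<open>e > 0\<close> by auto
    \<comment> \<open>If both weights vanish the quotient is \<open>0\<close> by the convention for
      division; then \<open>?q $ l = 0\<close> and \<open>q_\<mu>\<close> holds all the
      same.\<close>
    define \<mu> where "\<mu> = (\<lambda>l. u * x $ l / (u * x $ l + v * y $ l))"
    have xy: "0 \<le> u * x $ l" "0 \<le> v * y $ l" for l
      using prob_simplexD(1)[OF x] prob_simplexD(1)[OF y] uv by auto
    have \<mu>: "0 \<le> \<mu> l" "\<mu> l \<le> 1" for l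
      unfolding \<mu>_def using xy[of l] by (auto intro!: divide_le_eq_1[THEN iffD2])
    have q_\<mu>: "?q $ l * \<mu> l = u * x $ l" "?q $ l * (1 - \<mu> l) = v * y $ l" for l
    proof -
      show 1: "?q $ l * \<mu> l = u * x $ l"
      proof (cases "u * x $ l + v * y $ l = 0")
        case True
        then have "u * x $ l = 0" using xy[of l] by linarith
        then show ?thesis using True by (simp add: \<mu>_def)
      qed (simp add: \<mu>_def)
      show "?q $ l * (1 - \<mu> l) = v * y $ l"
        unfolding right_diff_distrib 1 by simp
    qed
    have "\<exists>\<gamma>. \<forall>l. \<gamma> l \<in> random_strategies \<and> (\<forall>A. \<forall>\<alpha>\<in>random_strategies. expected_payoff A \<alpha> (\<gamma> l) =
        \<mu> l * expected_payoff A \<alpha> (\<beta> l) + (1 - \<mu> l) * expected_payoff A \<alpha> (\<beta>' l))"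
      using mixture_exists[OF \<beta>(1) \<beta>'(1) \<mu>] by (intro choice) blast
    then obtain \<gamma> where \<gamma>: "\<And>l. \<gamma> l \<in> random_strategies"
      "\<And>l A \<alpha>. \<alpha> \<in> random_strategies \<Longrightarrow> expected_payoff A \<alpha> (\<gamma> l) =
        \<mu> l * expected_payoff A \<alpha> (\<beta> l) + (1 - \<mu> l) * expected_payoff A \<alpha> (\<beta>' l)"
      by blast
    show "upper_value G (disintL ?q P)
      \<le> u * upper_value G (disintL x P) + v * upper_value G (disintL y P) + e"
    proof (rule upper_value_le[of \<gamma>])
      fix \<alpha> :: "'k \<Rightarrow> ('j, 'i) strategy" assume \<alpha>: "\<alpha> \<in> profiles"
      have summand: "?q $ l * c * (\<mu> l * s + (1 - \<mu> l) * t) = u * (x $ l * c * s) + v * (y $ l * c * t)" for l c s t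
      proof -
        have "?q $ l * c * (\<mu> l * s + (1 - \<mu> l) * t) = (?q $ l * \<mu> l) * c * s + (?q $ l * (1 - \<mu> l)) * c * t"
          by (simp add: algebra_simps)
        then show ?thesis unfolding q_\<mu> by simp
      qed
      have "payoff G (disintL ?q P) \<alpha> \<gamma> =
        u * payoff G (disintL x P) \<alpha> \<beta> + v * payoff G (disintL y P) \<alpha> \<beta>'"
        unfolding payoff_eq sum_distrib_left sum.distrib[symmetric]
      proof (intro sum.cong refl, clarify)
        fix k l
        have "\<alpha> k \<in> random_strategies" using \<alpha> by simp
        then show "disintL ?q P $ (k, l) * expected_payoff (G k l) (\<alpha> k) (\<gamma> l) =
          u * (disintL x P $ (k, l) * expected_payoff (G k l) (\<alpha> k) (\<beta> l)) +
          v * (disintL y P $ (k, l) * expected_payoff (G k l) (\<alpha> k) (\<beta>' l))"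
          using summand[of l "P $ l $ k"] by (simp only: \<gamma>(2) disintL_def vec_lambda_beta fst_conv snd_conv)
      qed
      also have "\<dots> \<le> u * (upper_value G (disintL x P) + e) + v * (upper_value G (disintL y P) + e)"
        using uv \<beta>(2)[OF \<alpha>] \<beta>'(2)[OF \<alpha>] by (intro add_mono mult_left_mono) auto
      also have "\<dots> = u * upper_value G (disintL x P) + v * upper_value G (disintL y P) + (u + v) * e"
        by (simp add: algebra_simps)
      finally show "payoff G (disintL ?q P) \<alpha> \<gamma>
        \<le> u * upper_value G (disintL x P) + v * upper_value G (disintL y P) + e"
        using uv by simp
    qed (use \<gamma> in simp)
  qed
qed (rule convex_prob_simplex)

section \<open>Dynamic programming in the dual game\<close>

lemma upper_value_bound:
  fixes G :: "'k::finite \<Rightarrow> 'l::finite \<Rightarrow> real ^ 'j::finite ^ 'i::finite"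
  shows "\<bar>upper_value G \<pi>\<bar> \<le> payoff_scale G * norm \<pi>"
proof -
  obtain \<alpha> :: "'k \<Rightarrow> ('j, 'i) strategy" where \<alpha>: "\<alpha> \<in> profiles" using profiles_nonempty by blast
  obtain \<beta> :: "'l \<Rightarrow> ('i, 'j) strategy" where \<beta>: "\<beta> \<in> profiles" using profiles_nonempty by blast
  have "upper_value G \<pi> \<le> payoff_scale G * norm \<pi>"
    using payoff_bound[OF _ \<beta>, of _ G \<pi>] by (intro upper_value_le[OF \<beta>]) (simp add: abs_le_iff)
  moreover have "- (payoff_scale G * norm \<pi>) \<le> upper_value G \<pi>"
  proof (rule field_le_epsilon)
    fix e :: real assume "e > 0"
    then obtain \<beta> where \<beta>: "\<beta> \<in> profiles" "payoff G \<pi> \<alpha> \<beta> \<le> upper_value G \<pi> + e"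
      using upper_value_less[of G \<pi> "upper_value G \<pi> + e"] \<alpha> by auto
    then show "- (payoff_scale G * norm \<pi>) \<le> upper_value G \<pi> + e"
      using payoff_bound[OF \<alpha> \<beta>(1), of G \<pi>] by (simp add: abs_le_iff)
  qed
  ultimately show ?thesis by (simp add: abs_le_iff)
qed

context
  fixes G :: "'k::finite \<Rightarrow> 'l::finite \<Rightarrow> real ^ 'j::finite ^ 'i::finite" and Q :: "real ^ 'l ^ 'k"
  assumes Q: "\<And>k. Q $ k \<in> prob_simplex"
begin

lemma bdd_conjK: "bdd_above ((\<lambda>p. upper_value G (disintK p Q) - p \<bullet> \<zeta>) ` prob_simplex)"
proof (rule bdd_aboveI2)
  fix p :: "real ^ 'k" assume p: "p \<in> prob_simplex"
  have "upper_value G (disintK p Q) \<le> payoff_scale G * norm (disintK p Q)"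
    using upper_value_bound[of G "disintK p Q"] by (simp add: abs_le_iff)
  also have "\<dots> \<le> payoff_scale G * 1"
    using norm_prob_simplex[OF disintK_in_prob_simplex[OF p Q]]
    by (intro mult_left_mono payoff_scale_nonneg)
  finally have "upper_value G (disintK p Q) \<le> payoff_scale G" by simp
  moreover have "\<bar>p \<bullet> \<zeta>\<bar> \<le> 1 * norm \<zeta>"
    using Cauchy_Schwarz_ineq2[of p \<zeta>] norm_prob_simplex[OF p]
    by (meson mult_right_mono norm_ge_zero order_trans)
  ultimately show "upper_value G (disintK p Q) - p \<bullet> \<zeta> \<le> payoff_scale G + norm \<zeta>"
    by (simp add: abs_le_iff)
qed

text \<open>The easy half of the description of the conjugate as the value of the dual game;
  \<open>conjK_less\<close> is the converse up to strictness.\<close>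

lemma conjK_le:
  assumes "\<beta> \<in> profiles" "\<And>k. best_response G Q \<beta> k \<le> \<zeta> $ k + c"
  shows "conjK (upper_value G) \<zeta> Q \<le> c"
  unfolding conjK_def
proof (intro cSUP_least prob_simplex_nonempty)
  fix p :: "real ^ 'k" assume p: "p \<in> prob_simplex"
  have "upper_value G (disintK p Q) \<le> (\<Sum>k\<in>UNIV. p $ k * (\<zeta> $ k + c))"
    using upper_value_le_best_response[OF assms(1) p] assms(2) prob_simplexD(1)[OF p]
    by (meson order_trans sum_mono mult_left_mono)
  also have "\<dots> = p \<bullet> \<zeta> + c"
    using prob_simplexD(3)[OF p]
    by (simp add: inner_vec_def distrib_left sum.distrib flip: sum_distrib_right)
  finally show "upper_value G (disintK p Q) - p \<bullet> \<zeta> \<le> c" by simp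
qed

text \<open>By minimax, the conjugate is the value player 2 can guarantee in the dual game, in which
  player 1 chooses \<open>k\<close> and pays \<open>\<zeta> $ k\<close>.\<close>

lemma conjK_less:
  assumes "conjK (upper_value G) \<zeta> Q < c"
  shows "\<exists>\<beta>\<in>profiles. \<forall>k. best_response G Q \<beta> k \<le> \<zeta> $ k + c"
proof -
  \<comment> \<open>Upper bounds, type by type, that player 2 can enforce on the net gain of player
    1; convexity comes from mixing two strategies separately for each \<open>l\<close>.\<close>
  define C where "C = {x :: real ^ 'k. \<exists>\<beta>\<in>profiles. \<forall>k. best_response G Q \<beta> k - \<zeta> $ k \<le> x $ k}"
  have "(\<chi> k. c) \<in> C"
  proof (rule separation_upward_closed)
    show "convex C"
    proof (rule convexI)
      fix x y :: "real ^ 'k" and u v :: real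
      assume xy: "x \<in> C" "y \<in> C" and uv: "0 \<le> u" "0 \<le> v" "u + v = 1"
      obtain \<beta> where \<beta>: "\<And>l. \<beta> l \<in> random_strategies" "\<And>k. best_response G Q \<beta> k - \<zeta> $ k \<le> x $ k"
        using xy(1) by (auto simp: C_def)
      obtain \<beta>' where \<beta>': "\<And>l. \<beta>' l \<in> random_strategies" "\<And>k. best_response G Q \<beta>' k - \<zeta> $ k \<le> y $ k"
        using xy(2) by (auto simp: C_def)
      have "u \<le> 1" "1 - u = v" using uv by auto
      then have "\<exists>\<gamma>. \<gamma> \<in> random_strategies \<and> (\<forall>A. \<forall>\<alpha>\<in>random_strategies. expected_payoff A \<alpha> \<gamma> =
          u * expected_payoff A \<alpha> (\<beta> l) + v * expected_payoff A \<alpha> (\<beta>' l))" for l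
        using mixture_exists[OF \<beta>(1)[of l] \<beta>'(1)[of l] uv(1)] by blast
      then have "\<exists>\<gamma>. \<forall>l. \<gamma> l \<in> random_strategies \<and> (\<forall>A. \<forall>\<alpha>\<in>random_strategies. expected_payoff A \<alpha> (\<gamma> l) =
          u * expected_payoff A \<alpha> (\<beta> l) + v * expected_payoff A \<alpha> (\<beta>' l))"
        by (intro choice) blast
      then obtain \<gamma> where \<gamma>: "\<And>l. \<gamma> l \<in> random_strategies"
        "\<And>l A \<alpha>. \<alpha> \<in> random_strategies \<Longrightarrow> expected_payoff A \<alpha> (\<gamma> l) =
          u * expected_payoff A \<alpha> (\<beta> l) + v * expected_payoff A \<alpha> (\<beta>' l)"
        by blast
      have "best_response G Q \<gamma> k \<le> u * best_response G Q \<beta> k + v * best_response G Q \<beta>' k" for k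
      proof (rule best_response_le)
        fix \<alpha> :: "('j, 'i) strategy" assume \<alpha>: "\<alpha> \<in> random_strategies"
        have "(\<Sum>l\<in>UNIV. Q $ k $ l * expected_payoff (G k l) \<alpha> (\<gamma> l)) =
          u * (\<Sum>l\<in>UNIV. Q $ k $ l * expected_payoff (G k l) \<alpha> (\<beta> l)) +
          v * (\<Sum>l\<in>UNIV. Q $ k $ l * expected_payoff (G k l) \<alpha> (\<beta>' l))"
          unfolding sum_distrib_left sum.distrib[symmetric] \<gamma>(2)[OF \<alpha>]
          by (intro sum.cong refl) (simp add: algebra_simps)
        also have "\<dots> \<le> u * best_response G Q \<beta> k + v * best_response G Q \<beta>' k"
          using uv \<alpha> \<beta>(1) \<beta>'(1) by (intro add_mono mult_left_mono le_best_response) auto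
        finally show "(\<Sum>l\<in>UNIV. Q $ k $ l * expected_payoff (G k l) \<alpha> (\<gamma> l))
          \<le> u * best_response G Q \<beta> k + v * best_response G Q \<beta>' k" .
      qed
      moreover have "u * best_response G Q \<beta> k + v * best_response G Q \<beta>' k - \<zeta> $ k \<le> u * x $ k + v * y $ k" for k
      proof -
        have "u * (best_response G Q \<beta> k - \<zeta> $ k) + v * (best_response G Q \<beta>' k - \<zeta> $ k) \<le> u * x $ k + v * y $ k"
          using uv \<beta>(2) \<beta>'(2) by (intro add_mono mult_left_mono) auto
        moreover have "u * \<zeta> $ k + v * \<zeta> $ k = \<zeta> $ k"
          using uv(3) by (metis distrib_right mult_1)
        ultimately show ?thesis by (simp add: right_diff_distrib)
      qed
      ultimately have "best_response G Q \<gamma> k - \<zeta> $ k \<le> (u *\<^sub>R x + v *\<^sub>R y) $ k" for k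
        by (smt (verit) vector_add_component vector_scaleR_component real_scaleR_def)
      then show "u *\<^sub>R x + v *\<^sub>R y \<in> C"
        using \<gamma>(1) by (auto simp: C_def)
    qed
    show "C \<noteq> {}"
    proof -
      obtain \<beta> :: "'l \<Rightarrow> ('i, 'j) strategy" where "\<beta> \<in> profiles" using profiles_nonempty by blast
      then have "(\<chi> k. best_response G Q \<beta> k - \<zeta> $ k) \<in> C" by (auto simp: C_def)
      then show ?thesis by blast
    qed
    show "y \<in> C" if "x \<in> C" "\<And>k. x $ k \<le> y $ k" for x y
      using that order_trans unfolding C_def by blast
    fix p :: "real ^ 'k" assume p: "p \<in> prob_simplex"
    have "upper_value G (disintK p Q) - p \<bullet> \<zeta> < c"
      using cSUP_upper[OF p bdd_conjK[of \<zeta>]] assms by (simp add: conjK_def)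
    then obtain c' where c': "upper_value G (disintK p Q) < c'" "c' < c + p \<bullet> \<zeta>"
      using dense[of "upper_value G (disintK p Q)" "c + p \<bullet> \<zeta>"] by auto
    then obtain \<beta> where \<beta>: "\<beta> \<in> profiles" "(\<Sum>k\<in>UNIV. p $ k * best_response G Q \<beta> k) \<le> c'"
      using upper_value_less_best_response[OF c'(1) p] by blast
    have "p \<bullet> (\<chi> k. best_response G Q \<beta> k - \<zeta> $ k) = (\<Sum>k\<in>UNIV. p $ k * best_response G Q \<beta> k) - p \<bullet> \<zeta>"
      by (simp add: inner_vec_def right_diff_distrib sum_subtractf)
    moreover have "(\<chi> k. best_response G Q \<beta> k - \<zeta> $ k) \<in> C"
      using \<beta>(1) by (auto simp: C_def)
    ultimately show "\<exists>x\<in>C. p \<bullet> x < c"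
      using \<beta>(2) c'(2) by (intro bexI[of _ "\<chi> k. best_response G Q \<beta> k - \<zeta> $ k"]) auto
  qed
  then show ?thesis
    by (auto simp: C_def diff_le_eq add.commute)
qed

text \<open>The affine functions in the supremum have slopes \<open>- p\<close> of norm at most
  1.\<close>

lemma conjK_lipschitz: "conjK (upper_value G) \<zeta> Q \<le> conjK (upper_value G) \<zeta>' Q + norm (\<zeta> - \<zeta>')"
  unfolding conjK_def[of _ \<zeta>]
proof (intro cSUP_least prob_simplex_nonempty)
  fix p :: "real ^ 'k" assume p: "p \<in> prob_simplex"
  have "\<bar>p \<bullet> (\<zeta> - \<zeta>')\<bar> \<le> 1 * norm (\<zeta> - \<zeta>')"
    using Cauchy_Schwarz_ineq2[of p "\<zeta> - \<zeta>'"] norm_prob_simplex[OF p]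
    by (meson mult_right_mono norm_ge_zero order_trans)
  moreover have "upper_value G (disintK p Q) - p \<bullet> \<zeta>' \<le> conjK (upper_value G) \<zeta>' Q"
    unfolding conjK_def by (rule cSUP_upper[OF p bdd_conjK])
  ultimately show "upper_value G (disintK p Q) - p \<bullet> \<zeta> \<le> conjK (upper_value G) \<zeta>' Q + norm (\<zeta> - \<zeta>')"
    by (simp add: inner_diff_right abs_le_iff)
qed

lemma usc_conjK: "usc (\<lambda>\<zeta>. conjK (upper_value G) \<zeta> Q)"
  unfolding usc_def
proof (intro allI impI)
  fix x c assume less: "conjK (upper_value G) x Q < c"
  have "conjK (upper_value G) y Q < c" if "dist y x < c - conjK (upper_value G) x Q" for y
    using conjK_lipschitz[of y x] that by (simp add: dist_norm)
  then show "\<forall>\<^sub>F y in nhds x. conjK (upper_value G) y Q < c"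
    unfolding eventually_nhds_metric using less
    by (intro exI[of _ "c - conjK (upper_value G) x Q"]) auto
qed

text \<open>The expected payoff of each type \<open>k\<close> while player 2 plays \<open>b\<close>
  for every \<open>l\<close>; \<open>h\<close> times this vector is subtracted from the dual
  parameter at time \<open>h\<close>.\<close>

definition mean_payoff :: "real ^ 'j \<Rightarrow> real ^ 'i \<Rightarrow> real ^ 'k" where
  "mean_payoff b a = (\<chi> k. \<Sum>l\<in>UNIV. Q $ k $ l * (a \<bullet> (G k l *v b)))"

lemma continuous_on_mean_payoff: "continuous_on S (mean_payoff b)"
  unfolding mean_payoff_def by (intro continuous_intros continuous_on_vec_lambda)

lemma inner_mean_payoff:
  "p \<bullet> mean_payoff b a = a \<bullet> (avg_matrix G (disintK p Q) *v b)"
  unfolding inner_avg_matrix disintK_def mean_payoff_def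
  by (simp add: inner_vec_def[of p] sum_distrib_left mult.assoc sum.cartesian_product case_prod_unfold)

text \<open>Averaging over the lottery of player 1 preserves an upper bound that is valid for every
  outcome.\<close>

lemma best_response_le_det:
  assumes \<beta>: "\<beta> \<in> profiles"
    and le: "\<And>a. det_strategy a \<Longrightarrow> (\<Sum>l\<in>UNIV. Q $ k $ l * det_payoff (G k l) a (\<beta> l)) \<le> c"
  shows "best_response G Q \<beta> k \<le> c"
proof (rule best_response_le)
  fix \<alpha> :: "('j, 'i) strategy" assume \<alpha>: "\<alpha> \<in> random_strategies"
  interpret prob_space "cube (fst \<alpha>)" by (rule prob_space_cube)
  have int: "integrable (cube (fst \<alpha>)) (\<lambda>\<omega>. det_payoff (G k l) (snd \<alpha> \<omega>) (\<beta> l))" for l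
    using \<beta> by (intro expected_payoff_eq_integral(1) \<alpha>) simp
  have "(\<Sum>l\<in>UNIV. Q $ k $ l * expected_payoff (G k l) \<alpha> (\<beta> l)) =
    (\<Sum>l\<in>UNIV. \<integral>\<omega>. Q $ k $ l * det_payoff (G k l) (snd \<alpha> \<omega>) (\<beta> l) \<partial>cube (fst \<alpha>))"
    using \<beta> by (intro sum.cong refl) (simp add: expected_payoff_eq_integral(2)[OF \<alpha>])
  also have "\<dots> = (\<integral>\<omega>. (\<Sum>l\<in>UNIV. Q $ k $ l * det_payoff (G k l) (snd \<alpha> \<omega>) (\<beta> l)) \<partial>cube (fst \<alpha>))"
    using int by (intro Bochner_Integration.integral_sum[symmetric]) auto
  also have "\<dots> \<le> (\<integral>\<omega>. c \<partial>cube (fst \<alpha>))"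
    using int by (intro integral_mono le det_strategyI[OF \<alpha>]) auto
  finally show "(\<Sum>l\<in>UNIV. Q $ k $ l * expected_payoff (G k l) \<alpha> (\<beta> l)) \<le> c"
    by (simp add: prob_space)
qed

text \<open>Player 2 plays \<open>b\<close> up to time \<open>h\<close> without revealing anything, and then an almost optimal
  strategy of the dual game at the updated parameter, which is known up to a finite covering of the
  possible mean actions of player 1.\<close>

lemma conjK_dynamic_programming:
  assumes b: "b \<in> prob_simplex" and h: "0 < h" "h < 1"
    and W: "\<And>a. a \<in> prob_simplex \<Longrightarrow>
      (1 - h) * conjK (upper_value G) ((1 / (1 - h)) *\<^sub>R (\<zeta> - h *\<^sub>R mean_payoff b a)) Q \<le> W"
  shows "conjK (upper_value G) \<zeta> Q \<le> W"
proof (rule field_le_epsilon)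
  fix e :: real assume "e > 0"
  \<comment> \<open>One half pays for the covering, the other for the near optimality of the
    continuations.\<close>
  define e' where "e' = e / 2"
  have "e' > 0" using \<open>e > 0\<close> by (simp add: e'_def)
  let ?g = "mean_payoff b"
  have "uniformly_continuous_on prob_simplex ?g"
    by (intro compact_uniformly_continuous continuous_on_mean_payoff compact_prob_simplex)
  then obtain d where "d > 0" and d: "\<And>x y. x \<in> prob_simplex \<Longrightarrow> y \<in> prob_simplex \<Longrightarrow> dist y x < d \<Longrightarrow>
      dist (?g y) (?g x) < e'"
    unfolding uniformly_continuous_on_def using \<open>e' > 0\<close> by meson
  obtain T where T: "finite T" "T \<subseteq> prob_simplex" "(prob_simplex :: (real ^ 'i) set) \<subseteq> (\<Union>x\<in>T. ball x d)"
    using seq_compact_imp_totally_bounded[OF compact_imp_seq_compact[OF compact_prob_simplex]] \<open>d > 0\<close>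
    by metis
  obtain xs where xs: "set xs = T" using finite_list[OF T(1)] by blast
  define n where "n = length xs"
  \<comment> \<open>The alternative \<open>n \<le> j\<close> makes the least index exist for every
    vector, also outside the simplex; on the simplex the index stays below \<open>n\<close>.\<close>
  define sel where "sel = (\<lambda>x. LEAST j. n \<le> j \<or> dist (xs ! j) x < d)"
  have sel_meas: "sel \<in> borel \<rightarrow>\<^sub>M count_space UNIV"
    unfolding sel_def by measurable
  have sel: "sel x < n \<and> dist (xs ! sel x) x < d" if x: "x \<in> prob_simplex" for x
  proof -
    obtain y where "y \<in> T" "dist y x < d" using T(3) x by auto
    then obtain j where j: "j < n" "dist (xs ! j) x < d"
      using xs by (metis in_set_conv_nth n_def)
    have "sel x \<le> j" unfolding sel_def using j by (intro Least_le) simp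
    moreover have "n \<le> sel x \<or> dist (xs ! sel x) x < d"
      unfolding sel_def by (rule LeastI[of _ j]) (use j in simp)
    ultimately show ?thesis using j(1) by auto
  qed
  \<comment> \<open>Solves \<open>h * g + (1 - h) * \<zeta>' = \<zeta>\<close> with \<open>g\<close>
    the mean payoff at the covering point: each type has collected its share before
    \<open>h\<close>, and the remaining game has weight \<open>1 - h\<close>.\<close>
  define \<zeta>' where "\<zeta>' = (\<lambda>j. (1 / (1 - h)) *\<^sub>R (\<zeta> - h *\<^sub>R ?g (xs ! j)))"
  have "\<exists>\<beta>\<in>profiles. \<forall>k. best_response G Q \<beta> k \<le> \<zeta>' j $ k + (conjK (upper_value G) (\<zeta>' j) Q + e')" for j
    using \<open>e' > 0\<close> by (intro conjK_less) simp
  then have "\<exists>B. \<forall>j. B j \<in> profiles \<and>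
      (\<forall>k. best_response G Q (B j) k \<le> \<zeta>' j $ k + (conjK (upper_value G) (\<zeta>' j) Q + e'))"
    by (intro choice) blast
  then obtain B where B: "\<And>j. B j \<in> profiles"
    "\<And>j k. best_response G Q (B j) k \<le> \<zeta>' j $ k + (conjK (upper_value G) (\<zeta>' j) Q + e')"
    by blast
  \<comment> \<open>\<open>concat_strategy\<close> needs all continuations for a given
    \<open>l\<close> on one cube. Capping the index at \<open>n\<close> leaves finitely many
    dimensions to majorize, and on the simplex the selector stays below the cap.\<close>
  define M where "M = (\<lambda>l. Max ((\<lambda>j. fst (B j l)) ` {..n}))"
  have le_M: "fst (B (min j n) l) \<le> M l" for j l
    unfolding M_def by (intro Max_ge) auto
  define \<beta> where "\<beta> = (\<lambda>l j. pad_strategy (M l) (B (min j n) l))"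
  have B_random: "B j l \<in> random_strategies" for j l using B(1) by simp
  have \<beta>: "\<beta> l j \<in> random_strategies" "fst (\<beta> l j) = M l" for l j
    unfolding \<beta>_def by (rule pad_strategy_random[OF B_random le_M]) (simp add: pad_strategy_def)
  define \<gamma> where "\<gamma> = (\<lambda>l. concat_strategy h b sel (\<beta> l) (M l))"
  have \<gamma>: "\<gamma> \<in> profiles"
    unfolding \<gamma>_def using concat_strategy_random[OF h b sel_meas, of n] sel \<beta> by blast
  show "conjK (upper_value G) \<zeta> Q \<le> W + e"
  proof (rule conjK_le[OF \<gamma>], rule best_response_le_det[OF \<gamma>])
    fix k and a :: "(real \<Rightarrow> real ^ 'j) \<Rightarrow> real \<Rightarrow> real ^ 'i" assume a: "det_strategy a"
    define m where "m = mean_control h (a (const_control b))"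
    define a' where "a' = tail_response h b a"
    define j where "j = sel m"
    have m: "m \<in> prob_simplex"
      unfolding m_def by (intro mean_control_in_prob_simplex h det_strategy_in_controls[OF a]
          const_control_in_controls b)
    have j: "j < n" "dist (xs ! j) m < d" using sel[OF m] by (auto simp: j_def)
    have xs_j: "xs ! j \<in> prob_simplex" using j(1) xs T(2) nth_mem by (auto simp: n_def)
    have a': "det_strategy a'" unfolding a'_def by (rule tail_response_det_strategy[OF h a b])
    have "det_payoff A a (\<gamma> l) = h * (m \<bullet> (A *v b)) + (1 - h) * expected_payoff A (1, \<lambda>_. a') (B j l)" for A l
    proof -
      have "det_payoff A a (\<gamma> l) = h * (m \<bullet> (A *v b)) + (1 - h) * det_payoff A a' (\<beta> l j)"
        unfolding \<gamma>_def a'_def j_def m_def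
        by (rule det_payoff_concat[OF h b sel_meas, of n]) (use sel \<beta> a in auto)
      moreover have "det_payoff A a' (\<beta> l j) = expected_payoff A (1, \<lambda>_. a') (B j l)"
        unfolding \<beta>_def det_payoff_pad[OF a' B_random le_M] expected_payoff_det[OF a' B_random]
        using j(1) by (simp add: min_def)
      ultimately show ?thesis by simp
    qed
    then have "(\<Sum>l\<in>UNIV. Q $ k $ l * det_payoff (G k l) a (\<gamma> l)) =
      h * ?g m $ k + (1 - h) * (\<Sum>l\<in>UNIV. Q $ k $ l * expected_payoff (G k l) (1, \<lambda>_. a') (B j l))"
      by (simp add: mean_payoff_def sum_distrib_left distrib_left sum.distrib mult_ac)
    also have "\<dots> \<le> h * ?g m $ k + (1 - h) * (\<zeta>' j $ k + (conjK (upper_value G) (\<zeta>' j) Q + e'))"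
      using h le_best_response[OF B(1) det_strategy_random[OF a'], of Q k G j] B(2)[of j k]
      by (intro add_left_mono mult_left_mono) auto
    also have "\<dots> = \<zeta> $ k + h * (?g m $ k - ?g (xs ! j) $ k) +
      (1 - h) * conjK (upper_value G) (\<zeta>' j) Q + (1 - h) * e'"
    proof -
      have "(1 - h) * \<zeta>' j $ k = \<zeta> $ k - h * ?g (xs ! j) $ k"
        using h by (simp add: \<zeta>'_def)
      then show ?thesis by (simp add: algebra_simps)
    qed
    also have "\<dots> \<le> \<zeta> $ k + 1 * e' + W + 1 * e'"
    proof (intro add_mono order_refl)
      have "\<bar>?g m $ k - ?g (xs ! j) $ k\<bar> \<le> e'"
        using component_le_norm_cart[of "?g m - ?g (xs ! j)" k] d[OF m xs_j j(2)]
        by (simp add: dist_norm norm_minus_commute)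
      then have "h * \<bar>?g m $ k - ?g (xs ! j) $ k\<bar> \<le> 1 * e'"
        using h \<open>e' > 0\<close> by (intro mult_mono) auto
      then show "h * (?g m $ k - ?g (xs ! j) $ k) \<le> 1 * e'"
        using h mult_left_mono[OF abs_ge_self[of "?g m $ k - ?g (xs ! j) $ k"], of h] by linarith
      show "(1 - h) * conjK (upper_value G) (\<zeta>' j) Q \<le> W"
        unfolding \<zeta>'_def by (rule W[OF xs_j])
      show "(1 - h) * e' \<le> 1 * e'"
        using h \<open>e' > 0\<close> by (intro mult_right_mono) auto
    qed
    finally show "(\<Sum>l\<in>UNIV. Q $ k $ l * det_payoff (G k l) a (\<gamma> l)) \<le> \<zeta> $ k + (W + e)"
      by (simp add: e'_def)
  qed
qed

text \<open>One sufficiently small \<open>h\<close> for each error \<open>e\<close> replaces the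
  limit. Dynamic programming compares the conjugate at \<open>\<zeta>\<close> with its values at
  nearby points, where the test function bounds it; the action \<open>b\<close> is almost optimal in
  the average game at \<open>- D\<close>.\<close>

lemma conjK_viscosity:
  assumes deriv: "GDERIV \<phi> \<zeta> :> D" and max: "local_max_at (\<lambda>y. conjK (upper_value G) y Q - \<phi> y) \<zeta>"
  shows "conjK (upper_value G) \<zeta> Q \<le> D \<bullet> \<zeta> + avg_value G (disintK (- D) Q)"
proof (rule field_le_epsilon)
  fix e :: real assume "e > 0"
  let ?w = "\<lambda>y. conjK (upper_value G) y Q"
  define M where "M = avg_matrix G (disintK (- D) Q)"
  define v where "v = avg_value G (disintK (- D) Q)"
  obtain b where b: "b \<in> prob_simplex" "\<And>a. a \<in> prob_simplex \<Longrightarrow> a \<bullet> (M *v b) \<le> v + e / 2"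
    using minimax_approx[of M "v + e / 2"] \<open>e > 0\<close> by (auto simp: v_def M_def avg_value_eq)
  let ?g = "mean_payoff b"
  have "compact ((\<lambda>a. \<zeta> - ?g a) ` prob_simplex)"
    by (intro compact_continuous_image continuous_intros continuous_on_mean_payoff compact_prob_simplex)
  then obtain R where "R > 0" and R: "\<And>a. a \<in> prob_simplex \<Longrightarrow> norm (\<zeta> - ?g a) \<le> R"
    using compact_imp_bounded bounded_pos by (metis image_eqI)
  \<comment> \<open>\<open>R\<close> bounds the displacement of the parameter per unit of
    \<open>t\<close>, so the first order error of \<open>\<phi>\<close> contributes
    \<open>e' * R = e / 2\<close>; the other half of \<open>e\<close> comes from
    \<open>b\<close>.\<close>
  define e' where "e' = e / (2 * R)"
  have "e' > 0" using \<open>e > 0\<close> \<open>R > 0\<close> by (simp add: e'_def)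
  have "(\<phi> has_derivative (\<lambda>y. y \<bullet> D)) (at \<zeta>)"
    using deriv by (simp add: gderiv_def)
  then obtain d where "d > 0" and d: "\<And>y. norm (y - \<zeta>) < d \<Longrightarrow>
      norm (\<phi> y - \<phi> \<zeta> - (y - \<zeta>) \<bullet> D) \<le> e' * norm (y - \<zeta>)"
    unfolding has_derivative_at_alt using \<open>e' > 0\<close> by blast
  obtain d' where "d' > 0" and d': "\<And>y. dist y \<zeta> < d' \<Longrightarrow> ?w y - \<phi> y \<le> ?w \<zeta> - \<phi> \<zeta>"
    using max unfolding local_max_at_def eventually_nhds_metric by blast
  \<comment> \<open>Keeps every displaced point strictly inside both neighbourhoods of
    \<open>\<zeta>\<close>.\<close>
  define t where "t = min d d' / (2 * R)"
  have "t > 0" using \<open>d > 0\<close> \<open>d' > 0\<close> \<open>R > 0\<close> by (simp add: t_def)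
  have tR: "t * R < d" "t * R < d'"
    using \<open>d > 0\<close> \<open>d' > 0\<close> \<open>R > 0\<close> by (auto simp: t_def min_def)
  \<comment> \<open>With this \<open>h\<close> the updated parameter is
    \<open>\<zeta> + t *\<^sub>R (\<zeta> - ?g a)\<close> and the weight of the continuation is
    \<open>1 / (1 + t)\<close>. The first order change \<open>D \<bullet> (\<zeta> - ?g a)\<close>
    yields two terms of the equation, and the discount by \<open>1 + t\<close> yields the term
    \<open>- w\<close>.\<close>
  define h where "h = t / (1 + t)"
  have h: "0 < h" "h < 1" "1 - h = 1 / (1 + t)"
    using \<open>t > 0\<close> by (auto simp: h_def field_simps)
  have "?w \<zeta> \<le> (1 / (1 + t)) * (?w \<zeta> + t * (D \<bullet> \<zeta> + v + e / 2 + e' * R))"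
  proof (rule conjK_dynamic_programming[OF b(1) h(1,2)])
    fix a :: "real ^ 'i" assume a: "a \<in> prob_simplex"
    define y where "y = \<zeta> + t *\<^sub>R (\<zeta> - ?g a)"
    have "(1 / (1 - h)) *\<^sub>R (\<zeta> - h *\<^sub>R ?g a) = (1 + t) *\<^sub>R \<zeta> - ((1 + t) * h) *\<^sub>R ?g a"
      unfolding h(3) by (simp add: scaleR_diff_right)
    also have "(1 + t) * h = t" using \<open>t > 0\<close> by (simp add: h_def)
    finally have y: "(1 / (1 - h)) *\<^sub>R (\<zeta> - h *\<^sub>R ?g a) = y"
      by (simp add: y_def algebra_simps)
    have norm_y: "norm (y - \<zeta>) \<le> t * R"
      using R[OF a] \<open>t > 0\<close> by (simp add: y_def)
    have "?w y - \<phi> y \<le> ?w \<zeta> - \<phi> \<zeta>"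
      using norm_y tR by (intro d') (simp add: dist_norm)
    moreover have "\<phi> y - \<phi> \<zeta> \<le> (y - \<zeta>) \<bullet> D + e' * (t * R)"
    proof -
      have "norm (\<phi> y - \<phi> \<zeta> - (y - \<zeta>) \<bullet> D) \<le> e' * norm (y - \<zeta>)"
        using norm_y tR by (intro d) simp
      also have "\<dots> \<le> e' * (t * R)"
        using norm_y \<open>e' > 0\<close> by (intro mult_left_mono) auto
      finally show ?thesis by (simp add: abs_le_iff)
    qed
    moreover have "(y - \<zeta>) \<bullet> D \<le> t * (D \<bullet> \<zeta> + (v + e / 2))"
    proof -
      have "(- D) \<bullet> ?g a \<le> v + e / 2"
        unfolding inner_mean_payoff using b(2)[OF a] by (simp add: M_def)
      then have "t * (D \<bullet> \<zeta> + (- D) \<bullet> ?g a) \<le> t * (D \<bullet> \<zeta> + (v + e / 2))"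
        using \<open>t > 0\<close> by (intro mult_left_mono) auto
      moreover have "(y - \<zeta>) \<bullet> D = t * (D \<bullet> \<zeta> + (- D) \<bullet> ?g a)"
        by (simp add: y_def inner_diff_left inner_diff_right inner_commute)
      ultimately show ?thesis by simp
    qed
    ultimately have "?w y \<le> ?w \<zeta> + t * (D \<bullet> \<zeta> + v + e / 2 + e' * R)"
      by (simp add: algebra_simps)
    then show "(1 - h) * ?w ((1 / (1 - h)) *\<^sub>R (\<zeta> - h *\<^sub>R ?g a))
      \<le> 1 / (1 + t) * (?w \<zeta> + t * (D \<bullet> \<zeta> + v + e / 2 + e' * R))"
      unfolding y unfolding h(3) using \<open>t > 0\<close> by (intro mult_left_mono) auto
  qed
  then have "(1 + t) * ?w \<zeta> \<le> ?w \<zeta> + t * (D \<bullet> \<zeta> + v + e / 2 + e' * R)"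
    using \<open>t > 0\<close> by (simp add: pos_le_divide_eq mult.commute)
  then have "t * ?w \<zeta> \<le> t * (D \<bullet> \<zeta> + v + e / 2 + e' * R)"
    by (simp add: distrib_right)
  then have "?w \<zeta> \<le> D \<bullet> \<zeta> + v + e / 2 + e' * R"
    using \<open>t > 0\<close> by simp
  moreover have "e' * R = e / 2" using \<open>R > 0\<close> by (simp add: e'_def)
  ultimately show "?w \<zeta> \<le> D \<bullet> \<zeta> + avg_value G (disintK (- D) Q) + e"
    by (simp add: v_def)
qed

end

lemma upper_value_dual_subsolution: "dual_subsolution G (upper_value G)"
  unfolding dual_subsolution_def viscosity_subsolution_def
proof (intro allI impI conjI)
  fix Q :: "real ^ 'b ^ 'a" and \<phi> D \<zeta>
  assume Q: "\<forall>k. Q $ k \<in> prob_simplex"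
  then show "usc (\<lambda>\<zeta>. conjK (upper_value G) \<zeta> Q)"
    by (intro usc_conjK) simp
  assume "C1_gradient \<phi> D \<and> local_max_at (\<lambda>y. conjK (upper_value G) y Q - \<phi> y) \<zeta>"
  then have "conjK (upper_value G) \<zeta> Q \<le> D \<zeta> \<bullet> \<zeta> + avg_value G (disintK (- D \<zeta>) Q)"
    using Q by (intro conjK_viscosity[of Q \<phi>]) (auto simp: C1_gradient_def)
  then show "0 \<le> - conjK (upper_value G) \<zeta> Q + D \<zeta> \<bullet> \<zeta> + avg_value G (disintK (- D \<zeta>) Q)"
    by simp
qed

section \<open>Existence and characterization of the value\<close>

lemma upper_value_le_lower_value:
  assumes "\<pi> \<in> prob_simplex"
  shows "upper_value G \<pi> \<le> lower_value G \<pi>"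
proof (rule dual_comparison[OF upper_value_L_convex upper_value_lipschitz upper_value_dual_subsolution])
  show "K_concave (lower_value G)"
    unfolding lower_value_eq_swap K_concave_swap by (rule upper_value_L_convex)
  show "(payoff_scale (swap_game G))-lipschitz_on prob_simplex (lower_value G)"
    unfolding lower_value_eq_swap by (rule lipschitz_swap_fun[OF upper_value_lipschitz])
  show "dual_subsolution (swap_game G) (swap_fun (lower_value G))"
    unfolding lower_value_eq_swap swap_fun_swap_fun by (rule upper_value_dual_subsolution)
qed (rule assms)

lemma game_value_eq_upper_value: "\<pi> \<in> prob_simplex \<Longrightarrow> game_value G \<pi> = upper_value G \<pi>"
  unfolding game_value_def
  using upper_value_le_lower_value[of \<pi> G] lower_le_upper_value[of G \<pi>] by (intro the_equality) auto

text \<open>\<open>game_value\<close> is a definite description whose agreement with the upper value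
  is known on the simplex only. K-concavity, like the conjugates in
  \<open>dual_subsolution_cong\<close>, evaluates a function at products \<open>disintK p Q\<close>
  of laws, hence on the simplex.\<close>

lemma K_concave_cong:
  assumes "\<And>\<pi>. \<pi> \<in> prob_simplex \<Longrightarrow> \<phi> \<pi> = \<psi> \<pi>" "K_concave \<psi>"
  shows "K_concave \<phi>"
  unfolding K_concave_def concave_on_iff
proof (intro allI impI conjI ballI)
  fix Q :: "real ^ 'b ^ 'a" and x y :: "real ^ 'a" and u v :: real
  assume Q: "\<forall>k. Q $ k \<in> prob_simplex"
    and x: "x \<in> prob_simplex" and y: "y \<in> prob_simplex" and uv: "0 \<le> u" "0 \<le> v" "u + v = 1"
  have "u *\<^sub>R x + v *\<^sub>R y \<in> prob_simplex"
    by (rule convexD[OF convex_prob_simplex x y uv])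
  then show "u * \<phi> (disintK x Q) + v * \<phi> (disintK y Q) \<le> \<phi> (disintK (u *\<^sub>R x + v *\<^sub>R y) Q)"
    using assms Q x y uv by (simp add: K_concave_def concave_on_iff disintK_in_prob_simplex)
qed (rule convex_prob_simplex)

lemma dual_subsolution_cong:
  assumes "\<And>\<pi>. \<pi> \<in> prob_simplex \<Longrightarrow> \<phi> \<pi> = \<psi> \<pi>" "dual_subsolution G \<psi>"
  shows "dual_subsolution G \<phi>"
proof -
  have "conjK \<phi> \<zeta> Q = conjK \<psi> \<zeta> Q" if "\<And>k. Q $ k \<in> prob_simplex" for \<zeta> Q
    unfolding conjK_def using that by (intro SUP_cong) (auto simp: assms(1) disintK_in_prob_simplex)
  then show ?thesis
    using assms(2) unfolding dual_subsolution_def by simp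
qed

lemma dual_solution_game_value: "dual_solution G (game_value G)"
  unfolding dual_solution_iff
proof (intro conjI)
  \<comment> \<open>The exchanged value is the upper value of the exchanged game, because the lower
    and the upper value coincide; L-convexity and (2) thus follow from facts about upper
    values.\<close>
  have swap: "swap_fun (game_value G) \<pi> = upper_value (swap_game G) \<pi>" if "\<pi> \<in> prob_simplex" for \<pi>
    using that upper_value_le_lower_value[of "swap_vec \<pi>" G] lower_le_upper_value[of G "swap_vec \<pi>"]
    by (simp add: swap_fun_def game_value_eq_upper_value)
      (simp add: lower_value_eq_swap swap_fun_def)
  show "K_concave (game_value G)"
    by (rule K_concave_cong[OF game_value_eq_upper_value upper_value_K_concave])
  show "L_convex (game_value G)"
    unfolding K_concave_swap[symmetric] by (rule K_concave_cong[OF swap upper_value_K_concave])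
  show "\<exists>C. C-lipschitz_on prob_simplex (game_value G)"
    using lipschitz_on_transform[OF upper_value_lipschitz game_value_eq_upper_value] by blast
  show "dual_subsolution G (game_value G)"
    by (rule dual_subsolution_cong[OF game_value_eq_upper_value upper_value_dual_subsolution])
  show "dual_subsolution (swap_game G) (swap_fun (game_value G))"
    by (rule dual_subsolution_cong[OF swap upper_value_dual_subsolution])
qed

theorem proposition3p2:
  fixes G :: "'k::finite \<Rightarrow> 'l::finite \<Rightarrow> real ^ 'j::finite ^ 'i::finite"
  shows "dual_solution G (game_value G) \<and>
    (\<forall>\<phi>. dual_solution G \<phi> \<longrightarrow> (\<forall>\<pi>\<in>prob_simplex. \<phi> \<pi> = game_value G \<pi>))"
proof (intro conjI allI impI ballI)
  show is_solution: "dual_solution G (game_value G)"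
    by (rule dual_solution_game_value)
  fix \<phi> and \<pi> :: "real ^ ('k \<times> 'l)"
  assume \<phi>: "dual_solution G \<phi>" and \<pi>: "\<pi> \<in> prob_simplex"
  \<comment> \<open>A solution satisfies (1) and (2), so each of two solutions can take either side
    of the comparison.\<close>
  have "\<phi>1 \<pi> \<le> \<phi>2 \<pi>" if "dual_solution G \<phi>1" "dual_solution G \<phi>2" for \<phi>1 \<phi>2
    using that \<pi> unfolding dual_solution_iff by (auto intro: dual_comparison)
  from this[OF \<phi> is_solution] this[OF is_solution \<phi>] show "\<phi> \<pi> = game_value G \<pi>"
    by simp
qed

end
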